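(* Let $n\in\{1,2\}$, let $a>0$, and let $\mu,\lambda\in\mathbb{R}$ satisfy $\mu>0$ and $\lambda+\frac{2}{n}\mu>0$. Let $m>2$. Let $\rho_0:\mathbb{R}^n\to[0,\infty)$ be an initial density with compact support which is nontrivial (not identically zero), and let $u_0:\mathbb{R}^n\to\mathbb{R}^n$ be an initial velocity. Consider the Cauchy problem for the isothermal compressible Navier-Stokes system $$\partial_t\rho+\mathrm{div}(\rho u)=0,$$ $$\partial_t(\rho u)+\mathrm{div}(\rho u\otimes u)-\mu\Delta u-(\lambda+\mu)\nabla\,\mathrm{div}\,u+\nabla(a\rho)=0,$$ with initial data $\rho(x,0)=\rho_0(x)$, $u(x,0)=u_0(x)$, $x\in\mathbb{R}^n$. Suppose that one of the following conditions holds: (i) $n=1$; (ii) $n=2$ and the data are spherically symmetric, in the sense that $\rho(x,t)=\rho(|x|,t)$ and $u(x,t)=\bar u(|x|,t)\,\frac{x}{|x|}$ for some scalar function $\bar u$ (including at $t=0$). Then any solution $(\rho,u)\in C^1([0,T],H^m(\mathbb{R}^n))$ of this Cauchy problem blows up in finite time; that is, the Cauchy problem has no global solution $(\rho,u)$ (spherically symmetric as in (ii) when $n=2$) belonging to $C^1([0,T],H^m(\mathbb{R}^n))$ for every $T>0$.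
   Context: Here $\rho=\rho(x,t)\in\mathbb{R}$ is the density and $u=u(x,t)\in\mathbb{R}^n$ the velocity of the fluid. The constants $\mu$ and $\lambda$ are the viscosity coefficient and the second viscosity coefficient. The pressure is $P(\rho)=a\rho$ (isothermal case). $H^m(\mathbb{R}^n)$ is the $L^2$-based Sobolev space of order $m$, and $(\rho,u)\in C^1([0,T],H^m(\mathbb{R}^n))$ means that $\rho$ and every component of $u$ are continuously differentiable maps from $[0,T]$ into $H^m(\mathbb{R}^n)$. The divergence of the matrix $\rho u\otimes u$ is the vector with $i$-th component $\sum_{j}\partial_{x_j}(\rho u_iu_j)$. *)

theory Defs
  imports "HOL-Analysis.Analysis"
begin

section \<open>Test functions and distributions on Euclidean space\<close>

definition pdiff :: "'n::finite \<Rightarrow> (real^'n \<Rightarrow> real) \<Rightarrow> real^'n \<Rightarrow> real" where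
  "pdiff i \<phi> x = frechet_derivative \<phi> (at x) (axis i 1)"

primrec Ck :: "nat \<Rightarrow> (real^'n::finite \<Rightarrow> real) \<Rightarrow> bool" where
  "Ck 0 \<phi> \<longleftrightarrow> continuous_on UNIV \<phi>"
| "Ck (Suc k) \<phi> \<longleftrightarrow> (\<forall>x. \<phi> differentiable at x) \<and> (\<forall>i. Ck k (pdiff i \<phi>))"

definition test_function :: "(real^'n::finite \<Rightarrow> real) \<Rightarrow> bool" where
  "test_function \<phi> \<longleftrightarrow> (\<forall>k. Ck k \<phi>) \<and> compact (closure {x. \<phi> x \<noteq> 0})"

text \<open>
  Distributions are represented by their action on test functions; their values on other
  functions are irrelevant, and linearity and continuity hold for all functionals used below.
\<close>

type_synonym 'n distribution = "(real^'n \<Rightarrow> real) \<Rightarrow> real"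

definition dist_of :: "(real^'n::finite \<Rightarrow> real) \<Rightarrow> 'n distribution" where
  "dist_of f \<phi> = (LINT x|lborel. f x * \<phi> x)"

definition dist_deriv :: "'n::finite \<Rightarrow> 'n distribution \<Rightarrow> 'n distribution" where
  "dist_deriv i S \<phi> = - S (pdiff i \<phi>)"

text \<open>One-sided at the end points of the time interval.\<close>

definition time_deriv ::
  "real \<Rightarrow> (real \<Rightarrow> real^'n::finite \<Rightarrow> real) \<Rightarrow> real \<Rightarrow> 'n distribution" where
  "time_deriv T f t \<phi> = vector_derivative (\<lambda>s. dist_of (f s) \<phi>) (at t within {0..T})"

section \<open>Sobolev spaces of real order\<close>

definition L2_function :: "(real^'n::finite \<Rightarrow> real) \<Rightarrow> bool" where
  "L2_function f \<longleftrightarrow> f \<in> borel_measurable lborel \<and> integrable lborel (\<lambda>x. (f x)\<^sup>2)"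

definition inv_fourier :: "(real^'n::finite \<Rightarrow> real) \<Rightarrow> real^'n \<Rightarrow> complex" where
  "inv_fourier \<phi> \<xi> =
     of_real (1 / (2 * pi) ^ CARD('n)) * (LINT x|lborel. cis (\<xi> \<bullet> x) * of_real (\<phi> x))"

text \<open>
  \<open>sobolev_transform m f g\<close> says that \<open>g\<close> is the Fourier transform of \<open>f\<close> and that
  \<open>(1 + |\<xi>|\<^sup>2)\<^bsup>m/2\<^esup> g\<close> is square integrable. The Fourier transform is expressed by duality,
  \<open>\<langle>f, \<phi>\<rangle> = \<langle>g, F\<^sup>-\<^sup>1 \<phi>\<rangle>\<close>, that is, \<open>f = F\<^sup>-\<^sup>1 g\<close> as distributions. For \<open>m \<ge> 0\<close> this
  determines \<open>g\<close> up to a null set.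
\<close>

definition sobolev_transform ::
  "real \<Rightarrow> (real^'n::finite \<Rightarrow> real) \<Rightarrow> (real^'n \<Rightarrow> complex) \<Rightarrow> bool" where
  "sobolev_transform m f g \<longleftrightarrow>
     g \<in> borel_measurable lborel \<and>
     integrable lborel (\<lambda>\<xi>. (1 + (norm \<xi>)\<^sup>2) powr m * (cmod (g \<xi>))\<^sup>2) \<and>
     (\<forall>\<phi>. test_function \<phi> \<longrightarrow>
        of_real (LINT x|lborel. f x * \<phi> x) = (LINT \<xi>|lborel. g \<xi> * inv_fourier \<phi> \<xi>))"

text \<open>
  \<open>H\<^sup>m\<close> for \<open>m \<ge> 0\<close>. Its elements are treated as functions modulo null sets: membership and
  norm do not distinguish functions that agree almost everywhere.
\<close>

definition sobolev :: "real \<Rightarrow> (real^'n::finite \<Rightarrow> real) \<Rightarrow> bool" where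
  "sobolev m f \<longleftrightarrow> L2_function f \<and> (\<exists>g. sobolev_transform m f g)"

definition sobolev_norm :: "real \<Rightarrow> (real^'n::finite \<Rightarrow> real) \<Rightarrow> real" where
  "sobolev_norm m f =
     sqrt (LINT \<xi>|lborel. (1 + (norm \<xi>)\<^sup>2) powr m * (cmod ((SOME g. sobolev_transform m f g) \<xi>))\<^sup>2)"

definition C1_sobolev :: "real \<Rightarrow> real \<Rightarrow> (real \<Rightarrow> real^'n::finite \<Rightarrow> real) \<Rightarrow> bool" where
  "C1_sobolev m T f \<longleftrightarrow>
     (\<exists>f'. \<forall>t\<in>{0..T}.
        sobolev m (f t) \<and> sobolev m (f' t) \<and>
        ((\<lambda>s. sobolev_norm m (\<lambda>x. (f s x - f t x) / (s - t) - f' t x)) \<longlongrightarrow> 0)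
          (at t within {0..T}) \<and>
        ((\<lambda>s. sobolev_norm m (\<lambda>x. f' s x - f' t x)) \<longlongrightarrow> 0) (at t within {0..T}))"

section \<open>The isothermal compressible Navier-Stokes system\<close>

text \<open>
  Fields take time first and space second. For \<open>m > 2\<close> and a solution in \<open>C\<^sup>1([0,T], H\<^sup>m)\<close>
  every term of both equations is an \<open>L\<^sup>2\<close> function of space at each time, so that equality of
  distributions at each time is the same as equality almost everywhere.
\<close>

definition mass_equation ::
  "real \<Rightarrow> (real \<Rightarrow> real^'n::finite \<Rightarrow> real) \<Rightarrow> (real \<Rightarrow> real^'n \<Rightarrow> real^'n) \<Rightarrow> bool" where
  "mass_equation T \<rho> u \<longleftrightarrow>
     (\<forall>t\<in>{0..T}. \<forall>\<phi>. test_function \<phi> \<longrightarrow>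
        time_deriv T \<rho> t \<phi>
        + (\<Sum>j\<in>UNIV. dist_deriv j (dist_of (\<lambda>x. \<rho> t x * u t x $ j)) \<phi>) = 0)"

definition momentum_equation ::
  "real \<Rightarrow> real \<Rightarrow> real \<Rightarrow> real \<Rightarrow> (real \<Rightarrow> real^'n::finite \<Rightarrow> real) \<Rightarrow>
     (real \<Rightarrow> real^'n \<Rightarrow> real^'n) \<Rightarrow> bool" where
  "momentum_equation a \<mu> lam T \<rho> u \<longleftrightarrow>
     (\<forall>t\<in>{0..T}. \<forall>i. \<forall>\<phi>. test_function \<phi> \<longrightarrow>
        time_deriv T (\<lambda>s x. \<rho> s x * u s x $ i) t \<phi>
        + (\<Sum>j\<in>UNIV. dist_deriv j (dist_of (\<lambda>x. \<rho> t x * u t x $ i * u t x $ j)) \<phi>)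
        - \<mu> * (\<Sum>j\<in>UNIV. dist_deriv j (dist_deriv j (dist_of (\<lambda>x. u t x $ i))) \<phi>)
        - (lam + \<mu>) *
            dist_deriv i (\<lambda>\<psi>. \<Sum>j\<in>UNIV. dist_deriv j (dist_of (\<lambda>x. u t x $ j)) \<psi>) \<phi>
        + dist_deriv i (dist_of (\<lambda>x. a * \<rho> t x)) \<phi> = 0)"

definition NS_solution ::
  "real \<Rightarrow> real \<Rightarrow> real \<Rightarrow> real \<Rightarrow> real \<Rightarrow> (real^'n::finite \<Rightarrow> real) \<Rightarrow> (real^'n \<Rightarrow> real^'n) \<Rightarrow>
     (real \<Rightarrow> real^'n \<Rightarrow> real) \<Rightarrow> (real \<Rightarrow> real^'n \<Rightarrow> real^'n) \<Rightarrow> bool" where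
  "NS_solution a \<mu> lam m T \<rho>0 u0 \<rho> u \<longleftrightarrow>
     C1_sobolev m T \<rho> \<and> (\<forall>i. C1_sobolev m T (\<lambda>t x. u t x $ i)) \<and>
     mass_equation T \<rho> u \<and> momentum_equation a \<mu> lam T \<rho> u \<and>
     (AE x in lborel. \<rho> 0 x = \<rho>0 x) \<and> (AE x in lborel. u 0 x = u0 x)"

definition spherically_symmetric ::
  "(real^'n::finite \<Rightarrow> real) \<Rightarrow> (real^'n \<Rightarrow> real^'n) \<Rightarrow> bool" where
  "spherically_symmetric r v \<longleftrightarrow>
     (\<exists>rbar vbar :: real \<Rightarrow> real. AE x in lborel.
        r x = rbar (norm x) \<and> v x = vbar (norm x) *\<^sub>R (x /\<^sub>R norm x))"

end

theory Submission
  imports Defs "HOL-Real_Asymp.Real_Asymp"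
begin

text \<open>
  The proof plays two facts against each other: a gas in vacuum cannot leave the ball that it
  occupies initially, yet its moment of inertia must grow quadratically in time.

  \<^bold>\<open>Reduction to classical fields.\<close> For \<open>m > 2\<close> and \<open>n \<le> 2\<close> the weight
  \<open>(1 + |\<xi>|\<^sup>2)\<^bsup>1-m\<^esup>\<close> is integrable, so Fourier inversion and the inequality between arithmetic
  and geometric means embed \<open>H\<^sup>m\<close> into the bounded \<open>C\<^sup>1\<close> functions with bounded gradient
  (\<open>sobolev_embedding_C1\<close>). A solution in \<open>C\<^sup>1([0,T], H\<^sup>m)\<close> therefore agrees almost everywhere with
  fields that are \<open>C\<^sup>1\<close> in space and time (\<open>C1_sobolev_imp_classical_field\<close>), and the mass
  equation holds at every point.

  \<^bold>\<open>The support does not move.\<close> Where the density vanishes, the momentum equation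
  becomes the Lame system \<open>\<mu> \<Delta>u + (\<lambda> + \<mu>) \<nabla>div u = 0\<close>. A field on the line, and a radial field in the
  plane, is curl free, so that \<open>\<Delta>u = \<nabla>div u\<close> and, as \<open>\<lambda> + 2 \<mu> > 0\<close>, the divergence of \<open>u\<close> is
  constant along the coordinate rays outside a ball that contains the gas. Hence the radial component
  of \<open>u\<close> at distance \<open>s\<close> is \<open>s\<^bsup>1-n\<^esup> (A + B s\<^sup>n)\<close>, which is square integrable near infinity only if it is
  zero: the velocity vanishes outside the gas (\<open>exterior_velocity_zero\<close>). By a
  maximum principle for the transport equation the support spreads at most at the speed of the
  gas at its boundary. This speed is zero at the boundary and the velocity is Lipschitz,
  so during a time \<open>h\<close> the radius grows only by \<open>O(h\<^sup>2)\<close>; cutting \<open>[0,t]\<close> into short pieces shows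
  that it does not grow at all (\<open>support_does_not_spread\<close>). The same maximum principle keeps the density
  nonnegative.

  \<^bold>\<open>Virial identity.\<close> Let \<open>M\<close> be the mass, \<open>I = \<integral> \<rho> |x|\<^sup>2\<close> and \<open>J = \<integral> \<rho> u \<cdot> x\<close>. Since all
  fields are supported in a fixed ball of radius \<open>r\<close>, testing the equations with \<open>1\<close>, \<open>|x|\<^sup>2\<close> and \<open>x\<^sub>i\<close>, cut
  off outside this ball, gives \<open>M' = 0\<close>, \<open>I' = 2 J\<close> and \<open>J' = \<integral> \<rho> |u|\<^sup>2 + n a M \<ge> a M\<close>; the viscous terms
  disappear because second derivatives of affine functions vanish. So
  \<open>2 J(0) T + a M T\<^sup>2 \<le> I(T) \<le> r\<^sup>2 M\<close> for every \<open>T\<close> (\<open>virial_bound\<close>), which is absurd for large \<open>T\<close> as \<open>M > 0\<close>.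
\<close>

section \<open>Smooth cut-off functions\<close>

lemma pdiff_has_derivative: "(f has_derivative f') (at x) \<Longrightarrow> pdiff i f x = f' (axis i 1)"
  by (simp add: pdiff_def flip: frechet_derivative_at)

lemma differentiable_pdiff:
  "f differentiable at x \<Longrightarrow> (f has_derivative frechet_derivative f (at x)) (at x)"
  by (simp add: frechet_derivative_works)

lemma Ck_const: "Ck k (\<lambda>x::real^'n::finite. c)"
proof (induction k arbitrary: c)
  case (Suc k)
  have "pdiff i (\<lambda>x::real^'n. c) = (\<lambda>x. 0)" for i
    by (simp add: pdiff_def fun_eq_iff frechet_derivative_const)
  then show ?case using Suc[of 0] by simp
qed simp

lemma Ck_SucD: "Ck (Suc k) f \<Longrightarrow> Ck k f"
proof (induction k arbitrary: f)
  case 0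
  then show ?case
    by (simp add: continuous_at_imp_continuous_on differentiable_imp_continuous_within)
next
  case (Suc k)
  then show ?case by (metis Ck.simps(2))
qed

lemma Ck_differentiable: "Ck (Suc k) f \<Longrightarrow> f differentiable at x"
  by simp

lemma Ck_add: "Ck k f \<Longrightarrow> Ck k g \<Longrightarrow> Ck k (\<lambda>x. f x + g x)"
proof (induction k arbitrary: f g)
  case 0 then show ?case by (auto intro: continuous_intros)
next
  case (Suc k)
  have "pdiff i (\<lambda>x. f x + g x) = (\<lambda>x. pdiff i f x + pdiff i g x)" for i
    using Suc.prems 
    by (auto simp: fun_eq_iff pdiff_def
        pdiff_has_derivative[OF has_derivative_add[OF differentiable_pdiff differentiable_pdiff], unfolded pdiff_def])
  then show ?case using Suc by auto
qed

lemma pdiff_mult: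
  assumes "f differentiable at x" "g differentiable at x"
  shows "pdiff i (\<lambda>x. f x * g x) x = f x * pdiff i g x + pdiff i f x * g x"
  using pdiff_has_derivative[OF has_derivative_mult[OF assms[THEN differentiable_pdiff]], of i]
  by (simp add: pdiff_def)

lemma Ck_mult: "Ck k f \<Longrightarrow> Ck k g \<Longrightarrow> Ck k (\<lambda>x. f x * g x)"
proof (induction k arbitrary: f g)
  case 0 then show ?case by (auto intro: continuous_intros)
next
  case (Suc k)
  have "pdiff i (\<lambda>x. f x * g x) = (\<lambda>x. f x * pdiff i g x + pdiff i f x * g x)" for i
    using Suc.prems by (auto simp: pdiff_mult fun_eq_iff)
  moreover have "Ck k f" "Ck k g" using Suc.prems Ck_SucD by blast+
  ultimately show ?case using Suc by (auto intro!: Ck_add)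
qed

lemma Ck_prod: "finite I \<Longrightarrow> (\<And>i. i \<in> I \<Longrightarrow> Ck k (f i)) \<Longrightarrow> Ck k (\<lambda>x. \<Prod>i\<in>I. f i x)"
  by (induction I rule: finite_induct) (auto intro: Ck_const Ck_mult)

text \<open>
  The derivative of \<open>1/f\<close> is \<open>- f' (1/f) (1/f)\<close>, so one derivative of
  \<open>f\<close> is traded for products of functions already known to be one order less smooth.
\<close>

lemma Ck_inverse:
  "Ck k f \<Longrightarrow> (\<And>x. f x \<noteq> 0) \<Longrightarrow> Ck k (\<lambda>x::real^'n::finite. inverse (f x))"
proof (induction k)
  case 0 then show ?case by (auto intro: continuous_intros)
next
  case (Suc k)
  have d: "(f has_derivative frechet_derivative f (at x)) (at x)" for x
    using Suc.prems by (simp add: frechet_derivative_works)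
  have d': "((\<lambda>x. inverse (f x)) has_derivative
      (\<lambda>h. - (inverse (f x) * frechet_derivative f (at x) h * inverse (f x)))) (at x)" for x
    using has_derivative_compose[OF d has_derivative_inverse'[OF Suc.prems(2)]] .
  have "pdiff i (\<lambda>x. inverse (f x)) = (\<lambda>x. (-1) * (inverse (f x) * pdiff i f x * inverse (f x)))" for i
    using pdiff_has_derivative[OF d'] by (auto simp: fun_eq_iff pdiff_def)
  moreover have "Ck k (\<lambda>x. inverse (f x))"
    using Suc Ck_SucD by blast
  moreover have "Ck k (pdiff i f)" for i using Suc.prems by simp
  ultimately have "Ck k (pdiff i (\<lambda>x. inverse (f x)))" for i
    by (simp only:) (intro Ck_mult Ck_const)
  then show ?case using d' by (auto simp: differentiable_def)
qed

lemma Ck_coord: "Ck k (\<lambda>x::real^'n::finite. x $ i)"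
proof (cases k)
  case 0 then show ?thesis by (auto intro: continuous_intros)
next
  case (Suc l)
  have d: "((\<lambda>x::real^'n. x $ i) has_derivative (\<lambda>h. h $ i)) (at x)" for x
    by (rule bounded_linear_imp_has_derivative) (rule bounded_linear_vec_nth)
  have "pdiff j (\<lambda>x::real^'n. x $ i) = (\<lambda>x. axis j 1 $ i)" for j
    using pdiff_has_derivative[OF d] by (simp add: fun_eq_iff)
  then show ?thesis using d by (auto simp: Suc differentiable_def Ck_const)
qed

lemma pdiff_translate: "pdiff i (\<lambda>x. f (x - y)) x = pdiff i f (x - y)"
  if "f differentiable at (x - y)"
proof -
  have "(f has_derivative frechet_derivative f (at (x - y))) (at (x - y))"
    using that by (simp add: frechet_derivative_works)
  then have "((\<lambda>x. f (x - y)) has_derivative frechet_derivative f (at (x - y))) (at x)"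
    by (rule has_derivative_compose[rotated, where g = f, unfolded o_def])
       (auto intro!: derivative_eq_intros)
  then show ?thesis by (simp add: pdiff_has_derivative) (simp add: pdiff_def)
qed

lemma Ck_translate: "Ck k f \<Longrightarrow> Ck k (\<lambda>x. f (x - y))"
proof (induction k arbitrary: f)
  case 0
  then show ?case
    by (auto intro!: continuous_on_compose2[of UNIV f] continuous_intros)
next
  case (Suc k)
  have "pdiff i (\<lambda>x. f (x - y)) = (\<lambda>x. pdiff i f (x - y))" for i
    using Suc.prems by (auto simp: pdiff_translate fun_eq_iff)
  moreover have "(\<lambda>x. f (x - y)) differentiable at x" for x
    by (rule differentiable_compose[of f "\<lambda>x. x - y"]) (use Suc.prems in \<open>auto intro: derivative_intros\<close>)
  ultimately show ?case using Suc by auto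
qed

text \<open>
  The flat function \<open>exp (-1/x)\<close>, multiplied by powers of \<open>1/x\<close>: up to
  linear combinations the family over \<open>j\<close> is closed under differentiation, which
  gives smoothness by induction on the order.
\<close>

definition flat_exp :: "nat \<Rightarrow> real \<Rightarrow> real" where
  "flat_exp j x = (if x \<le> 0 then 0 else (1 / x) ^ j * exp (- 1 / x))"

lemma flat_exp_at_right_0: "(flat_exp j \<longlongrightarrow> 0) (at_right 0)"
proof -
  have "((\<lambda>x. inverse x ^ j / exp (inverse x)) \<longlongrightarrow> (0::real)) (at_right 0)"
    by (rule filterlim_compose[OF tendsto_power_div_exp_0 filterlim_inverse_at_top_right])
  moreover have "eventually (\<lambda>x. inverse x ^ j / exp (inverse x) = flat_exp j x) (at_right (0::real))"
    by (rule eventually_at_right_less[THEN eventually_mono])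
       (auto simp: flat_exp_def divide_simps exp_minus)
  ultimately show ?thesis by (rule Lim_transform_eventually)
qed

text \<open>
  Only \<open>x = 0\<close> needs an argument: the difference quotient there is the next member of
  the family, which tends to \<open>0\<close> because the exponential beats every power.
\<close>

lemma flat_exp_deriv:
  "(flat_exp j has_real_derivative flat_exp (j + 2) x - real j * flat_exp (Suc j) x) (at x)"
proof -
  consider "x < 0" | "x = 0" | "x > 0" by linarith
  then show ?thesis
  proof cases
    case 1
    have "((\<lambda>_. 0) has_real_derivative 0) (at x)" by simp
    then have "(flat_exp j has_real_derivative 0) (at x)"
      by (rule has_field_derivative_transform_within[where d = "-x"])
         (use 1 in \<open>auto simp: flat_exp_def dist_real_def\<close>)
    then show ?thesis using 1 by (simp add: flat_exp_def)
  next
    case 2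
    have "((\<lambda>h. flat_exp j h / h) \<longlongrightarrow> 0) (at 0)"
    proof (rule filterlim_split_at)
      have "eventually (\<lambda>h. 0 = flat_exp j h / h) (at_left (0::real))"
        by (rule eventually_mono[OF eventually_at_left_real[of "-1" 0]]) (auto simp: flat_exp_def)
      then show "((\<lambda>h. flat_exp j h / h) \<longlongrightarrow> 0) (at_left 0)"
        by (rule Lim_transform_eventually[OF tendsto_const])
      have "eventually (\<lambda>h. flat_exp (Suc j) h = flat_exp j h / h) (at_right (0::real))"
        using eventually_at_right_less by eventually_elim (auto simp: flat_exp_def)
      then show "((\<lambda>h. flat_exp j h / h) \<longlongrightarrow> 0) (at_right 0)"
        by (rule Lim_transform_eventually[OF flat_exp_at_right_0])
    qed
    then show ?thesis using 2 by (simp add: DERIV_def flat_exp_def)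
  next
    case 3
    have "((\<lambda>x. (1 / x) ^ j * exp (- 1 / x)) has_real_derivative
        flat_exp (j + 2) x - real j * flat_exp (Suc j) x) (at x)"
    proof (cases j)
      case 0
      then show ?thesis using 3 
        by (auto intro!: derivative_eq_intros simp: flat_exp_def power2_eq_square field_simps)
    next
      case (Suc l)
      have "((\<lambda>x. 1 / x) has_real_derivative - (1 / x)\<^sup>2) (at x)"
        using 3 by (auto intro!: derivative_eq_intros simp: power2_eq_square)
      from DERIV_power[OF this, of j]
      have p: "((\<lambda>x. (1 / x) ^ j) has_real_derivative - real j * (1 / x) ^ Suc j) (at x)"
        by (rule DERIV_cong) (simp add: Suc power2_eq_square diff_divide_distrib add_divide_distrib algebra_simps)
      have e: "((\<lambda>x. exp (- 1 / x)) has_real_derivative exp (- 1 / x) * (1 / x)\<^sup>2) (at x)"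
        using 3 by (auto intro!: derivative_eq_intros simp: power2_eq_square)
      show ?thesis
        using DERIV_mult[OF p e] 3
        by (simp add: flat_exp_def power_add algebra_simps power2_eq_square)
    qed
    then show ?thesis
      by (rule has_field_derivative_transform_within[where d = x])
         (use 3 in \<open>auto simp: flat_exp_def dist_real_def\<close>)
  qed
qed

lemma Ck_flat_exp: "Ck k (\<lambda>x::real^'n::finite. flat_exp j (c * x $ i + d))"
proof (induction k arbitrary: j)
  case 0
  have "continuous_on UNIV (flat_exp j)"
    using flat_exp_deriv DERIV_isCont by (blast intro: continuous_at_imp_continuous_on)
  then show ?case
    by (auto intro!: continuous_on_compose2[of UNIV "flat_exp j"] continuous_intros)
next
  case (Suc k)
  let ?F = "\<lambda>x::real^'n. flat_exp j (c * x $ i + d)"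
  let ?D = "\<lambda>x::real^'n. flat_exp (j + 2) (c * x $ i + d) + (- real j) * flat_exp (Suc j) (c * x $ i + d)"
  have "((\<lambda>x::real^'n. x $ i) has_derivative (\<lambda>h. h $ i)) (at x)" for x
    by (rule bounded_linear_imp_has_derivative) (rule bounded_linear_vec_nth)
  then have lin: "((\<lambda>x::real^'n. c * x $ i + d) has_derivative (\<lambda>h. c * h $ i)) (at x)" for x
    by (auto intro!: derivative_eq_intros)
  have d: "(?F has_derivative (\<lambda>h. ?D x * (c * h $ i))) (at x)" for x
    using has_derivative_compose[OF lin flat_exp_deriv[unfolded has_field_derivative_def]] by simp
  have "pdiff l ?F = (\<lambda>x. ?D x * (c * axis l 1 $ i))" for l
    using pdiff_has_derivative[OF d] by (simp add: fun_eq_iff)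
  moreover have "Ck k (\<lambda>x. ?D x * (c * axis l 1 $ i))" for l
    by (intro Ck_mult Ck_add Suc Ck_const)
  ultimately show ?case using d by (auto simp: differentiable_def)
qed

text \<open>
  Rises smoothly from \<open>0\<close> at \<open>x \<le> 0\<close> to \<open>1\<close> at \<open>x
  \<ge> 1\<close>.
\<close>

definition smooth_step :: "real \<Rightarrow> real" where
  "smooth_step x = flat_exp 0 x * inverse (flat_exp 0 x + flat_exp 0 (1 - x))"

lemma smooth_step_denominator: "flat_exp 0 x + flat_exp 0 (1 - x) > 0"
  by (auto simp: flat_exp_def add_pos_pos)

lemma smooth_step_bounds: "0 \<le> smooth_step x" "smooth_step x \<le> 1"
  using smooth_step_denominator[of x]
  by (auto simp: smooth_step_def flat_exp_def divide_simps)

lemma smooth_step_eq_0 [simp]: "x \<le> 0 \<Longrightarrow> smooth_step x = 0"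
  by (simp add: smooth_step_def flat_exp_def)

lemma smooth_step_eq_1 [simp]: "x \<ge> 1 \<Longrightarrow> smooth_step x = 1"
  by (simp add: smooth_step_def flat_exp_def)

lemma smooth_step_pos: "x > 0 \<Longrightarrow> smooth_step x > 0"
  using smooth_step_denominator[of x] by (simp add: smooth_step_def flat_exp_def)

lemma Ck_smooth_step: "Ck k (\<lambda>x::real^'n::finite. smooth_step (c * x $ i + d))"
proof -
  have "Ck k (\<lambda>x::real^'n. flat_exp 0 (1 - (c * x $ i + d)))"
    using Ck_flat_exp[of k 0 "- c" i "1 - d"] by (simp add: algebra_simps)
  then show ?thesis
    unfolding smooth_step_def
    by (intro Ck_mult Ck_inverse Ck_add Ck_flat_exp) (use smooth_step_denominator in \<open>auto simp: less_imp_neq[symmetric]\<close>)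
qed

text \<open>
  Positive exactly on the open box and equal to \<open>1\<close> at distance at least
  \<open>1/k\<close> from its faces. As \<open>k\<close> grows it approximates the indicator of
  the box, and for fixed \<open>k\<close> it serves as a bump and as a cut-off.
\<close>

definition smooth_box :: "real \<Rightarrow> real^'n::finite \<Rightarrow> real^'n \<Rightarrow> real^'n \<Rightarrow> real" where
  "smooth_box k a b x =
     (\<Prod>i\<in>UNIV. smooth_step (k * (x $ i - a $ i)) * smooth_step (k * (b $ i - x $ i)))"

lemma smooth_box_bounds: "0 \<le> smooth_box k a b x" "smooth_box k a b x \<le> 1"
  unfolding smooth_box_def
  by (auto intro!: prod_nonneg prod_le_1 mult_le_one smooth_step_bounds mult_nonneg_nonneg)

lemma smooth_box_eq_0: "k > 0 \<Longrightarrow> x \<notin> box a b \<Longrightarrow> smooth_box k a b x = 0"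
  by (auto simp: smooth_box_def mem_box_cart not_less)
     (metis diff_le_0_iff_le less_imp_le mult_nonneg_nonpos smooth_step_eq_0)+

lemma smooth_box_pos: "k > 0 \<Longrightarrow> x \<in> box a b \<Longrightarrow> smooth_box k a b x > 0"
  by (auto simp: smooth_box_def mem_box_cart intro!: prod_pos mult_pos_pos smooth_step_pos)

lemma smooth_box_eq_1:
  assumes "\<And>i. k * (x $ i - a $ i) \<ge> 1" "\<And>i. k * (b $ i - x $ i) \<ge> 1"
  shows "smooth_box k a b x = 1"
  using assms by (simp add: smooth_box_def)

lemma Ck_smooth_box: "Ck l (smooth_box k a b)"
proof -
  have "Ck l (\<lambda>x::real^'n::finite. smooth_step (k * (x $ i - a $ i)))" for k i and a :: "real^'n"
    using Ck_smooth_step[of l k i "- k * a $ i"] by (simp add: algebra_simps)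
  moreover have "Ck l (\<lambda>x::real^'n::finite. smooth_step (k * (b $ i - x $ i)))" for k i and b :: "real^'n"
    using Ck_smooth_step[of l "- k" i "k * b $ i"] by (simp add: algebra_simps)
  ultimately show ?thesis
    unfolding smooth_box_def by (intro Ck_prod Ck_mult) auto
qed

lemma test_functionI:
  assumes "\<And>k. Ck k f" and "\<And>x. x \<notin> S \<Longrightarrow> f x = 0" and "bounded S"
  shows "test_function f"
proof -
  have "{x. f x \<noteq> 0} \<subseteq> S" using assms(2) by auto
  then have "bounded {x. f x \<noteq> 0}" using assms(3) bounded_subset by blast
  then show ?thesis using assms(1) by (auto simp: test_function_def compact_closure)
qed

lemma test_function_smooth_box: "k > 0 \<Longrightarrow> test_function (smooth_box k a b)"
  by (rule test_functionI[where S = "box a b"]) (auto intro: Ck_smooth_box smooth_box_eq_0)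

lemma test_function_Ck: "test_function f \<Longrightarrow> Ck k f"
  by (simp add: test_function_def)

lemma test_function_mult: "test_function f \<Longrightarrow> (\<And>k. Ck k g) \<Longrightarrow> test_function (\<lambda>x. g x * f x)"
  by (rule test_functionI[where S = "closure {x. f x \<noteq> 0}"])
     (use closure_subset[of "{x. f x \<noteq> 0}"] in
       \<open>auto simp: test_function_def intro: Ck_mult compact_imp_bounded\<close>)

lemma test_function_translate: "test_function f \<Longrightarrow> test_function (\<lambda>x. f (x - y))"
proof (rule test_functionI[where S = "(\<lambda>x. y + x) ` closure {x. f x \<noteq> 0}"])
  assume f: "test_function f"
  show "f (x - y) = 0" if "x \<notin> (+) y ` closure {x. f x \<noteq> 0}" for x
    using that closure_subset[of "{x. f x \<noteq> 0}"] by (force simp: image_iff)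
  show "bounded ((+) y ` closure {x. f x \<noteq> 0})"
    using f by (intro bounded_translation compact_imp_bounded) (auto simp: test_function_def)
qed (auto intro: Ck_translate test_function_Ck)

lemma pdiff_eq_0_open:
  assumes "open S" "x \<in> S" "\<And>y. y \<in> S \<Longrightarrow> f y = 0"
  shows "pdiff i f x = 0"
proof -
  have "(f has_derivative (\<lambda>h. 0)) (at x)"
    by (rule has_derivative_transform_within_open[OF has_derivative_const assms(1,2)])
       (use assms in auto)
  then show ?thesis by (simp add: pdiff_has_derivative)
qed

lemma test_function_pdiff: "test_function f \<Longrightarrow> test_function (pdiff i f)"
proof (rule test_functionI[where S = "closure {x. f x \<noteq> 0}"])
  assume f: "test_function f"
  show "Ck k (pdiff i f)" for k using test_function_Ck[OF f, of "Suc k"] by simp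
  show "bounded (closure {x. f x \<noteq> 0})" using f by (auto simp: test_function_def intro: compact_imp_bounded)
  show "pdiff i f x = 0" if "x \<notin> closure {x. f x \<noteq> 0}" for x
    by (rule pdiff_eq_0_open[where S = "- closure {x. f x \<noteq> 0}"])
       (use that closure_subset[of "{x. f x \<noteq> 0}"] in auto)
qed

lemma test_function_vanishes:
  assumes "test_function f"
  obtains B where "B > 0" "\<And>x. norm x > B \<Longrightarrow> f x = 0"
proof -
  have "bounded {x. f x \<noteq> 0}"
    using assms bounded_subset[OF compact_imp_bounded closure_subset] by (auto simp: test_function_def)
  then obtain B where "\<And>x. f x \<noteq> 0 \<Longrightarrow> norm x \<le> B" by (auto simp: bounded_iff)
  then show ?thesis using that[of "\<bar>B\<bar> + 1"] by force
qed

section \<open>Calculus with \<open>C\<^sup>1\<close> functions and weak derivatives\<close>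

text \<open>
  The gradient is kept as a vector next to the function, so that sums, products and limits of
  gradients need no reference to partial derivatives.
\<close>

definition C1_grad :: "(real^'n::finite \<Rightarrow> real) \<Rightarrow> (real^'n \<Rightarrow> real^'n) \<Rightarrow> bool" where
  "C1_grad F G \<longleftrightarrow> (\<forall>x. (F has_derivative (\<lambda>h. G x \<bullet> h)) (at x)) \<and> continuous_on UNIV G"

lemma C1_gradD:
  assumes "C1_grad F G"
  shows "(F has_derivative (\<lambda>h. G x \<bullet> h)) (at x)" "continuous_on UNIV G" "continuous_on UNIV F"
  using assms by (auto simp: C1_grad_def intro!: continuous_at_imp_continuous_on has_derivative_continuous)

lemma C1_grad_pdiff: "C1_grad F G \<Longrightarrow> pdiff i F x = G x $ i"
  using pdiff_has_derivative[OF C1_gradD(1)] by (metis inner_axis inner_real_def mult.right_neutral)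

lemma C1_grad_unique: "C1_grad F G \<Longrightarrow> C1_grad F G' \<Longrightarrow> G = G'"
  by (auto simp: fun_eq_iff vec_eq_iff simp flip: C1_grad_pdiff)

lemma C1_grad_mult:
  assumes "C1_grad F G" "C1_grad F' G'"
  shows "C1_grad (\<lambda>x. F x * F' x) (\<lambda>x. F x *\<^sub>R G' x + F' x *\<^sub>R G x)"
  unfolding C1_grad_def using C1_gradD[OF assms(1)] C1_gradD[OF assms(2)]
  by (auto intro!: derivative_eq_intros continuous_intros simp: inner_simps)

lemma C1_grad_diff:
  assumes "C1_grad F G" "C1_grad F' G'"
  shows "C1_grad (\<lambda>x. F x - F' x) (\<lambda>x. G x - G' x)"
  unfolding C1_grad_def using C1_gradD[OF assms(1)] C1_gradD[OF assms(2)]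
  by (auto intro!: derivative_eq_intros continuous_intros simp: inner_simps)

lemma C1_grad_cmult:
  assumes "C1_grad F G"
  shows "C1_grad (\<lambda>x. c * F x) (\<lambda>x. c *\<^sub>R G x)"
  unfolding C1_grad_def using C1_gradD[OF assms(1)]
  by (auto intro!: derivative_eq_intros continuous_intros simp: inner_simps)

lemma C1_grad_line:
  assumes "C1_grad F G"
  shows "((\<lambda>s. F (x + s *\<^sub>R e)) has_real_derivative G (x + s *\<^sub>R e) \<bullet> e) (at s within S)"
proof -
  have "((\<lambda>s. F (x + s *\<^sub>R e)) has_derivative (\<lambda>h. G (x + s *\<^sub>R e) \<bullet> (h *\<^sub>R e))) (at s within S)"
    by (rule has_derivative_compose[OF _ C1_gradD(1)[OF assms], where f = "\<lambda>s. x + s *\<^sub>R e"])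
       (auto intro!: derivative_eq_intros)
  then show ?thesis unfolding has_field_derivative_def
    by (rule has_derivative_eq_rhs) (auto simp: fun_eq_iff)
qed

lemma C1_grad_lipschitz:
  assumes "C1_grad F G" "\<And>z. norm (G z) \<le> L"
  shows "\<bar>F x - F y\<bar> \<le> L * norm (x - y)"
proof -
  have "norm (F x - F y) \<le> L * norm (x - y)"
  proof (rule differentiable_bound[of UNIV F "\<lambda>x h. G x \<bullet> h"])
    show "(F has_derivative (\<bullet>) (G x)) (at x)" for x using C1_gradD(1)[OF assms(1)] .
    show "onorm ((\<bullet>) (G x)) \<le> L" for x
      by (rule order_trans[OF onorm_le[where b = "norm (G x)"] assms(2)])
         (simp add: Cauchy_Schwarz_ineq2)
  qed auto
  then show ?thesis by simp
qed

lemma frechet_derivative_eq_inner: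
  fixes f :: "real^'n::finite \<Rightarrow> real"
  assumes "f differentiable at x"
  shows "(f has_derivative (\<lambda>h. (\<chi> i. pdiff i f x) \<bullet> h)) (at x)"
proof -
  note d = differentiable_pdiff[OF assms]
  interpret bounded_linear "frechet_derivative f (at x)" by (rule has_derivative_bounded_linear[OF d])
  have "frechet_derivative f (at x) h = (\<chi> i. pdiff i f x) \<bullet> h" for h
  proof -
    have "frechet_derivative f (at x) h = frechet_derivative f (at x) (\<Sum>i\<in>UNIV. h $ i *\<^sub>R axis i 1)"
      by (simp add: basis_expansion flip: scalar_mult_eq_scaleR)
    also have "\<dots> = (\<Sum>i\<in>UNIV. h $ i * frechet_derivative f (at x) (axis i 1))"
      by (simp add: sum scaleR)
    finally show ?thesis by (simp add: pdiff_def inner_vec_def mult.commute)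
  qed
  then have "frechet_derivative f (at x) = (\<lambda>h. (\<chi> i. pdiff i f x) \<bullet> h)" by blast
  then show ?thesis using d by metis
qed

lemma C1_grad_test:
  assumes "Ck (Suc 0) \<phi>" shows "C1_grad \<phi> (\<lambda>x. \<chi> i. pdiff i \<phi> x)"
  using assms unfolding C1_grad_def
  by (auto intro!: frechet_derivative_eq_inner continuous_on_vec_lambda)

lemma norm_le_in_cbox:
  fixes x :: "real^'n::finite"
  assumes "norm x \<le> B" shows "x \<in> cbox (- vec B) (vec B)"
proof -
  have "\<bar>x $ i\<bar> \<le> B" for i using component_le_norm_cart[of x i] assms by linarith
  then show ?thesis by (auto simp: mem_box_cart abs_le_iff minus_le_iff)
qed

lemma integrable_compact_support:
  fixes f :: "real^'n::finite \<Rightarrow> 'b::euclidean_space"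
  assumes "continuous_on UNIV f" "\<And>x. norm x > B \<Longrightarrow> f x = 0"
  shows "integrable lborel f" "integral\<^sup>L lborel f = integral (cbox (- vec B) (vec B)) f"
proof -
  have eq: "f = (\<lambda>x. if x \<in> cbox (- vec B) (vec B) then f x else 0)"
    using norm_le_in_cbox[of _ B] assms(2) by (force simp: fun_eq_iff not_le[symmetric])
  have "integrable lborel (\<lambda>x. indicator (cbox (- vec B) (vec B)) x *\<^sub>R f x)"
    by (rule borel_integrable_compact) (use assms(1) continuous_on_subset in auto)
  moreover have "(\<lambda>x. indicator (cbox (- vec B) (vec B)) x *\<^sub>R f x) = f"
    by (subst (2) eq) (auto simp: indicator_def)
  ultimately show int: "integrable lborel f" by simp
  have "integral\<^sup>L lborel f = integral UNIV f"
    using has_integral_integral_lborel[OF int] by (simp add: integral_unique)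
  also have "\<dots> = integral (cbox (- vec B) (vec B)) f"
    by (subst (1) eq) (rule integral_restrict_UNIV)
  finally show "integral\<^sup>L lborel f = integral (cbox (- vec B) (vec B)) f" .
qed

text \<open>
  The Leibniz rule over a box that contains all supports.
\<close>

lemma derivative_under_integral:
  fixes H :: "real \<Rightarrow> real^'n::finite \<Rightarrow> real"
  assumes deriv: "\<And>s x. s \<in> S \<Longrightarrow> ((\<lambda>s. H s x) has_real_derivative H' s x) (at s within S)"
    and cont': "continuous_on (S \<times> UNIV) (\<lambda>(s, x). H' s x)"
    and cont: "\<And>s. s \<in> S \<Longrightarrow> continuous_on UNIV (H s)"
    and zero: "\<And>s x. s \<in> S \<Longrightarrow> norm x > B \<Longrightarrow> H s x = 0"
    and zero': "\<And>s x. s \<in> S \<Longrightarrow> norm x > B \<Longrightarrow> H' s x = 0"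
    and S: "convex S" "s0 \<in> S"
  shows "((\<lambda>s. LINT x|lborel. H s x) has_real_derivative (LINT x|lborel. H' s0 x)) (at s0 within S)"
proof -
  let ?C = "cbox (- vec B) (vec B) :: (real^'n) set"
  have "((\<lambda>s. integral ?C (H s)) has_real_derivative integral ?C (H' s0)) (at s0 within S)"
    by (rule leibniz_rule_field_derivative)
       (use assms in \<open>auto intro: continuous_on_subset intro!: integrable_continuous\<close>)
  then have *: "((\<lambda>s. LINT x|lborel. H s x) has_real_derivative integral ?C (H' s0)) (at s0 within S)"
    by (rule has_field_derivative_transform_within[OF _ zero_less_one S(2)])
       (simp add: integrable_compact_support(2)[OF cont zero])
  have "continuous_on UNIV (\<lambda>x::real^'n. (s0, x))"
    by (intro continuous_on_Pair continuous_on_const continuous_on_id)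
  then have "continuous_on UNIV (H' s0)"
    using continuous_on_compose2[OF cont', of UNIV "\<lambda>x. (s0, x)"] S(2) by auto
  then show ?thesis
    using * integrable_compact_support(2)[of "H' s0" B] zero'[OF S(2)] by simp
qed

lemma lborel_integral_translate:
  fixes f :: "real^'n::finite \<Rightarrow> real"
  assumes "f \<in> borel_measurable borel"
  shows "(LINT x|lborel. f (x + y)) = (LINT x|lborel. f x)"
proof -
  have "lborel = distr lborel borel (\<lambda>x::real^'n. y + x)"
    using lborel_affine[of 1 y] by (simp add: density_1)
  then have "(LINT x|lborel. f x) = (LINT x|distr lborel borel (\<lambda>x. y + x). f x)" by simp
  also have "\<dots> = (LINT x|lborel. f (y + x))"
    by (rule integral_distr) (use assms in auto)
  finally show ?thesis by (simp add: add.commute)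
qed

text \<open>
  The integral of \<open>h\<close> does not change when \<open>h\<close> is translated along the
  \<open>i\<close>-th axis; differentiate in the translation parameter.
\<close>

lemma integral_gradient_eq_0:
  fixes h :: "real^'n::finite \<Rightarrow> real"
  assumes h: "C1_grad h G" and zero: "\<And>x. norm x > B \<Longrightarrow> h x = 0"
  shows "(LINT x|lborel. G x $ i) = 0"
proof -
  let ?e = "axis i 1 :: real^'n" and ?S = "{-1<..<1::real}"
  have Gz: "G x = 0" if "norm x > B" for x
  proof -
    have "pdiff j h x = 0" for j
      by (rule pdiff_eq_0_open[where S = "{x. norm x > B}"])
         (use that zero in \<open>auto intro!: open_Collect_less continuous_intros\<close>)
    then show ?thesis using C1_grad_pdiff[OF h] by (simp add: vec_eq_iff)
  qed
  have far: "norm (x + s *\<^sub>R ?e) > B" if "norm x > B + 1" "s \<in> ?S" for x s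
    using that norm_triangle_ineq2[of x "- (s *\<^sub>R ?e)"] by auto
  have "((\<lambda>s. LINT x|lborel. h (x + s *\<^sub>R ?e)) has_real_derivative
      (LINT x|lborel. G (x + 0 *\<^sub>R ?e) \<bullet> ?e)) (at 0 within ?S)"
  proof (rule derivative_under_integral[where B = "B + 1"])
    show "continuous_on (?S \<times> UNIV) (\<lambda>(s, x). G (x + s *\<^sub>R ?e) \<bullet> ?e)"
      unfolding case_prod_unfold
      by (intro continuous_intros continuous_on_compose2[OF C1_gradD(2)[OF h]]) auto
    show "continuous_on UNIV (\<lambda>x. h (x + s *\<^sub>R ?e))" for s
      by (intro continuous_intros continuous_on_compose2[OF C1_gradD(3)[OF h]]) auto
  qed (use far zero Gz C1_grad_line[OF h] in auto)
  moreover have "(\<lambda>s. LINT x|lborel. h (x + s *\<^sub>R ?e)) = (\<lambda>s. LINT x|lborel. h x)"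
    using C1_gradD(3)[OF h] by (auto simp: fun_eq_iff intro!: lborel_integral_translate borel_measurable_continuous_onI)
  ultimately have "((\<lambda>s. LINT x|lborel. h x) has_real_derivative (LINT x|lborel. G x $ i)) (at 0)"
    by (simp add: at_within_open[of 0 ?S] inner_axis)
  then show ?thesis using DERIV_unique DERIV_const by blast
qed

lemma integration_by_parts:
  fixes F :: "real^'n::finite \<Rightarrow> real"
  assumes F: "C1_grad F G" and \<phi>: "test_function \<phi>"
  shows "(LINT x|lborel. F x * pdiff i \<phi> x) = - (LINT x|lborel. G x $ i * \<phi> x)"
proof -
  obtain B where B: "\<And>x. norm x > B \<Longrightarrow> \<phi> x = 0" by (rule test_function_vanishes[OF \<phi>]) auto
  obtain B' where B': "\<And>x. norm x > B' \<Longrightarrow> pdiff i \<phi> x = 0"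
    by (rule test_function_vanishes[OF test_function_pdiff[OF \<phi>, of i]]) auto
  note C = C1_grad_test[OF test_function_Ck[OF \<phi>]]
  have c: "continuous_on UNIV \<phi>" "continuous_on UNIV (pdiff i \<phi>)"
    using test_function_Ck[OF \<phi>, of 0] test_function_Ck[OF test_function_pdiff[OF \<phi>, of i], of 0] by auto
  have "integrable lborel (\<lambda>x. F x * pdiff i \<phi> x)"
    using B' c C1_gradD(3)[OF F]
    by (auto intro!: integrable_compact_support(1)[where B = B'] continuous_intros)
  moreover have "integrable lborel (\<lambda>x. G x $ i * \<phi> x)"
    using B c C1_gradD(2)[OF F]
    by (auto intro!: integrable_compact_support(1)[where B = B] continuous_intros)
  ultimately have "(LINT x|lborel. F x * pdiff i \<phi> x) + (LINT x|lborel. G x $ i * \<phi> x)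
      = (LINT x|lborel. (F x *\<^sub>R (\<chi> i. pdiff i \<phi> x) + \<phi> x *\<^sub>R G x) $ i)"
    by (simp add: mult.commute)
  also have "\<dots> = 0"
    by (rule integral_gradient_eq_0[OF C1_grad_mult[OF F C], of B]) (simp add: B)
  finally show ?thesis by simp
qed

text \<open>
  Write the increment of \<open>\<phi>\<close> along axis \<open>i\<close> as the integral of
  \<open>\<partial>\<^sub>i\<phi>\<close>, differentiate under this integral along axis
  \<open>j\<close>, and then differentiate with respect to the length of the increment.
\<close>

lemma pdiff_commute:
  fixes \<phi> :: "real^'n::finite \<Rightarrow> real"
  assumes \<phi>: "test_function \<phi>"
  shows "pdiff i (pdiff j \<phi>) x = pdiff j (pdiff i \<phi>) x"
proof -
  let ?ei = "axis i 1 :: real^'n" and ?ej = "axis j 1 :: real^'n"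
  define A where "A = pdiff j (pdiff i \<phi>)"
  have line: "((\<lambda>s. \<psi> (y + s *\<^sub>R axis k 1)) has_real_derivative pdiff k \<psi> (y + s *\<^sub>R axis k 1)) (at s within S)"
    if "test_function \<psi>" for \<psi> y k s S
    using C1_grad_line[OF C1_grad_test[OF test_function_Ck[OF that]], of y "axis k 1" s S] by (simp add: inner_axis)
  have cont: "continuous_on UNIV \<psi>" if "test_function \<psi>" for \<psi> :: "real^'n \<Rightarrow> real"
    using test_function_Ck[OF that, of 0] by simp
  note t = test_function_pdiff[OF \<phi>] test_function_pdiff[OF test_function_pdiff[OF \<phi>]]
  have cA: "continuous_on UNIV A" unfolding A_def by (rule cont[OF t(2)])
  have ftc: "((\<lambda>\<sigma>. pdiff i \<phi> (y + \<sigma> *\<^sub>R ?ei)) has_integral \<phi> (y + s *\<^sub>R ?ei) - \<phi> y) (cbox 0 s)" if "s \<ge> 0" for s y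
    unfolding cbox_interval
  proof -
    have "((\<lambda>\<sigma>. pdiff i \<phi> (y + \<sigma> *\<^sub>R ?ei)) has_integral \<phi> (y + s *\<^sub>R ?ei) - \<phi> (y + 0 *\<^sub>R ?ei)) {0..s}"
      by (rule fundamental_theorem_of_calculus[OF that])
         (rule line[OF \<phi>, unfolded has_real_derivative_iff_has_vector_derivative])
    then show "((\<lambda>\<sigma>. pdiff i \<phi> (y + \<sigma> *\<^sub>R ?ei)) has_integral \<phi> (y + s *\<^sub>R ?ei) - \<phi> y) {0..s}" by simp
  qed
  have eq: "pdiff j \<phi> (x + s *\<^sub>R ?ei) - pdiff j \<phi> x = integral (cbox 0 s) (\<lambda>\<sigma>. A (x + \<sigma> *\<^sub>R ?ei))" if "s \<ge> 0" for s
  proof -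
    have "((\<lambda>r. integral (cbox 0 s) (\<lambda>\<sigma>. pdiff i \<phi> (x + \<sigma> *\<^sub>R ?ei + r *\<^sub>R ?ej))) has_real_derivative
      integral (cbox 0 s) (\<lambda>\<sigma>. A (x + \<sigma> *\<^sub>R ?ei + 0 *\<^sub>R ?ej))) (at 0 within UNIV)"
      unfolding A_def
    proof (rule leibniz_rule_field_derivative)
      show "(\<lambda>\<sigma>. pdiff i \<phi> (x + \<sigma> *\<^sub>R ?ei + r *\<^sub>R ?ej)) integrable_on cbox 0 s" for r
        by (intro integrable_continuous continuous_on_compose2[OF cont[OF t(1)]] continuous_intros) auto
      show "continuous_on (UNIV \<times> cbox 0 s) (\<lambda>(r, \<sigma>). pdiff j (pdiff i \<phi>) (x + \<sigma> *\<^sub>R ?ei + r *\<^sub>R ?ej))"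
        unfolding case_prod_unfold
        by (intro continuous_on_compose2[OF cont[OF t(2)]] continuous_intros) auto
      show "((\<lambda>r. pdiff i \<phi> (x + \<sigma> *\<^sub>R ?ei + r *\<^sub>R ?ej)) has_real_derivative
          pdiff j (pdiff i \<phi>) (x + \<sigma> *\<^sub>R ?ei + r *\<^sub>R ?ej)) (at r within UNIV)" for r \<sigma>
        by (rule line[OF t(1)])
    qed simp_all
    moreover have "integral (cbox 0 s) (\<lambda>\<sigma>. pdiff i \<phi> (x + \<sigma> *\<^sub>R ?ei + r *\<^sub>R ?ej))
        = \<phi> (x + s *\<^sub>R ?ei + r *\<^sub>R ?ej) - \<phi> (x + r *\<^sub>R ?ej)" for r
      using integral_unique[OF ftc[OF that, of "x + r *\<^sub>R ?ej"]] by (simp add: add_ac)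
    ultimately have 1: "((\<lambda>r. \<phi> (x + s *\<^sub>R ?ei + r *\<^sub>R ?ej) - \<phi> (x + r *\<^sub>R ?ej)) has_real_derivative
        integral (cbox 0 s) (\<lambda>\<sigma>. A (x + \<sigma> *\<^sub>R ?ei))) (at 0)" by simp
    have 2: "((\<lambda>r. \<phi> (x + s *\<^sub>R ?ei + r *\<^sub>R ?ej) - \<phi> (x + r *\<^sub>R ?ej)) has_real_derivative
        pdiff j \<phi> (x + s *\<^sub>R ?ei) - pdiff j \<phi> x) (at 0)"
      using DERIV_diff[OF line[OF \<phi>, of "x + s *\<^sub>R ?ei" j 0 UNIV] line[OF \<phi>, of x j 0 UNIV]] by simp
    show ?thesis by (rule DERIV_unique[OF 2 1])
  qed
  have "((\<lambda>s. integral {0..s} (\<lambda>\<sigma>. A (x + \<sigma> *\<^sub>R ?ei))) has_real_derivative A (x + 0 *\<^sub>R ?ei)) (at 0 within {0..1})"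
    by (rule integral_has_real_derivative)
       (intro continuous_on_compose2[OF cA] continuous_intros | simp)+
  then have 1: "((\<lambda>s. pdiff j \<phi> (x + s *\<^sub>R ?ei) - pdiff j \<phi> x) has_real_derivative A x) (at 0 within {0..1})"
    unfolding scaleR_zero_left add_0_right
    by (rule has_field_derivative_transform_within[OF _ zero_less_one]) (simp_all add: eq)
  have 2: "((\<lambda>s. pdiff j \<phi> (x + s *\<^sub>R ?ei) - pdiff j \<phi> x) has_real_derivative pdiff i (pdiff j \<phi>) x) (at 0 within {0..1})"
    using DERIV_diff[OF line[OF t(1)[of j], of x i 0 "{0..1}"] DERIV_const] by simp
  have "pdiff i (pdiff j \<phi>) x = A x"
    by (rule vector_derivative_unique_within_closed_interval[of 0 1 0])
       (use 1 2 in \<open>simp_all add: has_real_derivative_iff_has_vector_derivative\<close>)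
  then show ?thesis by (simp add: A_def)
qed

definition bump :: "real \<Rightarrow> real^'n::finite \<Rightarrow> real" where
  "bump \<delta> = smooth_box 1 (- vec \<delta>) (vec \<delta>)"

lemma test_function_bump: "test_function (bump \<delta>)"
  by (simp add: bump_def test_function_smooth_box)

lemma bump_nonneg: "bump \<delta> x \<ge> 0"
  by (simp add: bump_def smooth_box_bounds)

lemma bump_at_0: "\<delta> > 0 \<Longrightarrow> bump \<delta> 0 > 0"
  by (simp add: bump_def smooth_box_pos mem_box_cart)

lemma bump_eq_0:
  fixes x :: "real^'n::finite"
  assumes "norm x \<ge> real CARD('n) * \<delta>"
  shows "bump \<delta> x = 0"
  unfolding bump_def
proof (rule smooth_box_eq_0)
  show "x \<notin> box (- vec \<delta>) (vec \<delta>)"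
  proof
    assume "x \<in> box (- vec \<delta>) (vec \<delta>)"
    then have "\<bar>x $ i\<bar> < \<delta>" for i by (auto simp: mem_box_cart abs_less_iff minus_less_iff)
    then have "(\<Sum>i\<in>UNIV. \<bar>x $ i\<bar>) < (\<Sum>i\<in>(UNIV::'n set). \<delta>)" by (intro sum_strict_mono) auto
    then show False using norm_le_l1_cart[of x] assms by simp
  qed
qed simp

text \<open>
  The set where two continuous functions differ is open, and a nonempty open set is not a null
  set.
\<close>

lemma AE_eq_continuous:
  fixes f g :: "real^'n::finite \<Rightarrow> 'b::euclidean_space"
  assumes "AE x in lborel. f x = g x" "continuous_on UNIV f" "continuous_on UNIV g"
  shows "f = g"
proof -
  let ?S = "{x. f x \<noteq> g x}"
  have "open ?S" using assms by (intro open_Collect_neq) auto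
  moreover have "emeasure lborel ?S = 0"
    using assms(1) \<open>open ?S\<close> by (subst (asm) AE_iff_measurable[OF _ refl]) auto
  then have "negligible ?S"
    using \<open>open ?S\<close> by (simp add: negligible_iff_emeasure0)
  ultimately have "?S = {}" using open_not_negligible by blast
  then show ?thesis by auto
qed

text \<open>
  If \<open>f 0 \<noteq> 0\<close> then \<open>f\<close> has constant sign on the support of a
  small bump, and its integral against the bump cannot vanish.
\<close>

lemma continuous_eq_0_bump:
  fixes f :: "real^'n::finite \<Rightarrow> real"
  assumes f: "continuous_on UNIV f" and \<epsilon>: "\<epsilon> > 0"
    and int: "\<And>\<delta>. 0 < \<delta> \<Longrightarrow> \<delta> < \<epsilon> \<Longrightarrow> (LINT x|lborel. f x * bump \<delta> x) = 0"
  shows "f 0 = 0"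
proof (rule ccontr)
  assume nz: "f 0 \<noteq> 0"
  define g where "g x = sgn (f 0) * f x" for x
  have "g 0 > 0" using nz by (simp add: g_def sgn_if)
  have g: "continuous_on UNIV g" unfolding g_def by (intro continuous_on_mult continuous_on_const f)
  obtain r where r: "r > 0" "\<And>x. norm x < r \<Longrightarrow> g x > 0"
  proof -
    have "open {x. 0 < g x}" by (intro open_Collect_less continuous_on_const g)
    moreover have "0 \<in> {x. 0 < g x}" using \<open>g 0 > 0\<close> by simp
    ultimately obtain r where "r > 0" "ball 0 r \<subseteq> {x. 0 < g x}" by (rule openE)
    then show ?thesis by (intro that[of r]) (auto simp: subset_iff)
  qed
  define \<delta> where "\<delta> = min (\<epsilon> / 2) (r / real CARD('n))"
  have \<delta>: "0 < \<delta>" "\<delta> < \<epsilon>"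
    using \<epsilon> r(1) by (auto simp: \<delta>_def)
  have "real CARD('n) * \<delta> \<le> real CARD('n) * (r / real CARD('n))"
    unfolding \<delta>_def by (intro mult_left_mono) auto
  then have \<delta>r: "real CARD('n) * \<delta> \<le> r" by simp
  have b: "continuous_on UNIV (bump \<delta> :: real^'n \<Rightarrow> real)"
    using test_function_Ck[OF test_function_bump, of 0] by simp
  have c: "continuous_on UNIV (\<lambda>x. g x * bump \<delta> x)" by (intro continuous_on_mult g b)
  have z: "g x * bump \<delta> x = 0" if "norm x > r" for x using bump_eq_0[of \<delta> x] \<delta>r that by simp
  have nn: "g x * bump \<delta> x \<ge> 0" for x
  proof (cases "norm x < r")
    case True
    then show ?thesis using r(2)[of x] bump_nonneg[of \<delta> x] by simp
  next
    case False
    then show ?thesis using bump_eq_0[of \<delta> x] \<delta>r by simp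
  qed
  have "(LINT x|lborel. g x * bump \<delta> x) = 0"
    unfolding g_def mult.assoc integral_mult_right_zero int[OF \<delta>] by simp
  then have "AE x in lborel. g x * bump \<delta> x = 0"
    using integral_nonneg_eq_0_iff_AE[OF integrable_compact_support(1)[OF c z] AE_I2[OF nn]] by blast
  then have eq: "(\<lambda>x. g x * bump \<delta> x) = (\<lambda>x. 0)"
    by (rule AE_eq_continuous[OF _ c continuous_on_const])
  have "g 0 * bump \<delta> (0::real^'n) = 0" using fun_cong[OF eq, of 0] by simp
  moreover have "bump \<delta> (0::real^'n) > 0" by (rule bump_at_0[OF \<delta>(1)])
  ultimately show False using \<open>g 0 > 0\<close> by simp
qed

lemma weakly_zero_imp_zero:
  fixes f :: "real^'n::finite \<Rightarrow> real"
  assumes f: "continuous_on UNIV f"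
    and int: "\<And>\<phi>. test_function \<phi> \<Longrightarrow> (LINT x|lborel. f x * \<phi> x) = 0"
  shows "f y = 0"
proof -
  have "(\<lambda>x. f (x + y)) 0 = 0"
  proof (rule continuous_eq_0_bump[OF _ zero_less_one])
    show c: "continuous_on UNIV (\<lambda>x. f (x + y))"
      by (intro continuous_on_compose2[OF f] continuous_intros) auto
    fix \<delta> :: real
    have t: "test_function (\<lambda>x. bump \<delta> (x - y))" by (rule test_function_translate[OF test_function_bump])
    have "(LINT x|lborel. f (x + y) * bump \<delta> (x + y - y)) = (LINT x|lborel. f x * bump \<delta> (x - y))"
      using f test_function_Ck[OF t, of 0]
      by (intro lborel_integral_translate borel_measurable_continuous_onI) (auto intro: continuous_intros)
    then show "(LINT x|lborel. f (x + y) * bump \<delta> x) = 0" using int[OF t] by simp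
  qed
  then show ?thesis by simp
qed

lemma has_real_derivative_test_line:
  fixes \<phi> :: "real^'n::finite \<Rightarrow> real"
  assumes "test_function \<phi>"
  shows "((\<lambda>s. \<phi> (x - (y + s *\<^sub>R axis i 1))) has_real_derivative - pdiff i \<phi> (x - (y + s *\<^sub>R axis i 1)))
    (at s within S)"
  using C1_grad_line[OF C1_grad_test[OF test_function_Ck[OF assms]], of "x - y" "- axis i 1" s S]
  by (simp add: inner_axis algebra_simps)

lemma pdiff_bump_eq_0:
  fixes x :: "real^'n::finite"
  assumes "norm x > real CARD('n) * \<delta>"
  shows "pdiff i (bump \<delta>) x = 0"
proof (rule pdiff_eq_0_open)
  show "open {x::real^'n. real CARD('n) * \<delta> < norm x}"
    by (intro open_Collect_less continuous_intros)
  show "bump \<delta> y = 0" if "y \<in> {x. real CARD('n) * \<delta> < norm x}" for y :: "real^'n"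
    using that bump_eq_0[of \<delta> y] by simp
qed (use assms in simp)

text \<open>
  The lemma of du Bois-Reymond along an axis. The average of \<open>d\<close> against a small bump
  moving along the segment has derivative zero by assumption; so the averages at the two ends
  agree, and shrinking the bump gives the values.
\<close>

lemma constant_on_segment_if_weak_derivative_zero:
  fixes d :: "real^'n::finite \<Rightarrow> real"
  assumes d: "continuous_on UNIV d"
    and weak: "\<And>\<phi>. test_function \<phi> \<Longrightarrow> (\<And>x. x \<notin> S \<Longrightarrow> \<phi> x = 0) \<Longrightarrow> (LINT x|lborel. d x * pdiff i \<phi> x) = 0"
    and S: "open S" and seg: "\<And>\<sigma>. 0 \<le> \<sigma> \<Longrightarrow> \<sigma> \<le> s \<Longrightarrow> x0 + \<sigma> *\<^sub>R axis i 1 \<in> S" and s: "s \<ge> 0"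
  shows "d (x0 + s *\<^sub>R axis i 1) = d x0"
proof -
  let ?e = "axis i 1 :: real^'n" and ?K = "(\<lambda>\<sigma>. x0 + \<sigma> *\<^sub>R axis i 1) ` {0..s}"
  have "compact ?K" by (intro compact_continuous_image continuous_intros compact_Icc)
  moreover have "?K \<subseteq> S" using seg by auto
  ultimately obtain \<epsilon> where \<epsilon>: "\<epsilon> > 0" "(\<Union>x\<in>?K. ball x \<epsilon>) \<subseteq> S"
    using compact_subset_open_imp_ball_epsilon_subset[OF _ S] by metis
  define f where "f x = d (x + (x0 + s *\<^sub>R ?e)) - d (x + x0)" for x
  have cd: "continuous_on UNIV (\<lambda>x. d (x + y))" for y
    by (intro continuous_on_compose2[OF d] continuous_intros) auto
  have "f 0 = 0"
  proof (rule continuous_eq_0_bump)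
    show "continuous_on UNIV f" unfolding f_def by (intro continuous_on_diff cd)
    show "\<epsilon> / real CARD('n) > 0" using \<epsilon> by simp
    fix \<delta> assume \<delta>: "0 < \<delta>" "\<delta> < \<epsilon> / real CARD('n)"
    then have n\<delta>: "real CARD('n) * \<delta> < \<epsilon>" by (simp add: field_simps)
    let ?b = "bump \<delta> :: real^'n \<Rightarrow> real"
    define g where "g \<sigma> = (LINT x|lborel. d x * ?b (x - (x0 + \<sigma> *\<^sub>R ?e)))" for \<sigma>
    have cb: "continuous_on UNIV ?b" "continuous_on UNIV (pdiff i ?b)"
      using test_function_Ck[OF test_function_bump, of 0]
        test_function_Ck[OF test_function_pdiff[OF test_function_bump], of 0] by auto
    have far: "norm (x - (x0 + \<sigma> *\<^sub>R ?e)) > real CARD('n) * \<delta>"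
      if "norm x > norm x0 + s + \<epsilon>" "\<sigma> \<in> {0..s}" for x \<sigma>
    proof -
      have "norm (x0 + \<sigma> *\<^sub>R ?e) \<le> norm x0 + s"
        using norm_triangle_ineq[of x0 "\<sigma> *\<^sub>R ?e"] that by simp
      then show ?thesis using norm_triangle_ineq2[of x "x0 + \<sigma> *\<^sub>R ?e"] that n\<delta> by linarith
    qed
    have "(g has_real_derivative 0) (at \<sigma> within {0..s})" if \<sigma>: "\<sigma> \<in> {0..s}" for \<sigma>
    proof -
      have "(g has_real_derivative (LINT x|lborel. d x * - pdiff i ?b (x - (x0 + \<sigma> *\<^sub>R ?e)))) (at \<sigma> within {0..s})"
        unfolding g_def
      proof (rule derivative_under_integral[where B = "norm x0 + s + \<epsilon>"])
        show "((\<lambda>\<sigma>. d x * ?b (x - (x0 + \<sigma> *\<^sub>R ?e))) has_real_derivative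
            d x * - pdiff i ?b (x - (x0 + \<sigma> *\<^sub>R ?e))) (at \<sigma> within {0..s})" for \<sigma> x
          by (intro DERIV_cmult has_real_derivative_test_line test_function_bump)
        show "continuous_on ({0..s} \<times> UNIV) (\<lambda>(\<sigma>, x). d x * - pdiff i ?b (x - (x0 + \<sigma> *\<^sub>R ?e)))"
          unfolding case_prod_unfold
          by (intro continuous_on_mult continuous_on_minus continuous_on_compose2[OF d]
              continuous_on_compose2[OF cb(2)] continuous_intros) auto
        show "continuous_on UNIV (\<lambda>x. d x * ?b (x - (x0 + \<sigma> *\<^sub>R ?e)))" for \<sigma>
          by (intro continuous_on_mult d continuous_on_compose2[OF cb(1)] continuous_intros) auto
        show "d x * ?b (x - (x0 + \<sigma> *\<^sub>R ?e)) = 0" if "\<sigma> \<in> {0..s}" "norm x > norm x0 + s + \<epsilon>" for \<sigma> x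
          using bump_eq_0[OF less_imp_le[OF far[OF that(2,1)]]] by simp
        show "d x * - pdiff i ?b (x - (x0 + \<sigma> *\<^sub>R ?e)) = 0" if "\<sigma> \<in> {0..s}" "norm x > norm x0 + s + \<epsilon>" for \<sigma> x
          using pdiff_bump_eq_0[OF far[OF that(2,1)]] by simp
      qed (use \<sigma> in auto)
      moreover have "(LINT x|lborel. d x * pdiff i (\<lambda>x. ?b (x - (x0 + \<sigma> *\<^sub>R ?e))) x) = 0"
      proof (rule weak[OF test_function_translate[OF test_function_bump]])
        fix x assume "x \<notin> S"
        moreover have "ball (x0 + \<sigma> *\<^sub>R ?e) \<epsilon> \<subseteq> S" using \<epsilon>(2) \<sigma> by blast
        ultimately have "\<epsilon> \<le> norm (x - (x0 + \<sigma> *\<^sub>R ?e))"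
          by (auto simp: ball_def dist_norm norm_minus_commute subset_iff not_less[symmetric])
        then show "?b (x - (x0 + \<sigma> *\<^sub>R ?e)) = 0" using n\<delta> by (intro bump_eq_0) linarith
      qed
      moreover have "pdiff i (\<lambda>x. ?b (x - (x0 + \<sigma> *\<^sub>R ?e))) x = pdiff i ?b (x - (x0 + \<sigma> *\<^sub>R ?e))" for x
        by (intro pdiff_translate Ck_differentiable[OF test_function_Ck[OF test_function_bump]])
      ultimately show ?thesis by simp
    qed
    then obtain c where "\<And>\<sigma>. \<sigma> \<in> {0..s} \<Longrightarrow> g \<sigma> = c"
      using has_field_derivative_zero_constant[of "{0..s}" g] by auto
    then have "g s = g 0" using s by simp
    moreover have "g \<sigma> = (LINT x|lborel. d (x + (x0 + \<sigma> *\<^sub>R ?e)) * ?b x)" for \<sigma>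
    proof -
      have "(LINT x|lborel. d (x + (x0 + \<sigma> *\<^sub>R ?e)) * ?b (x + (x0 + \<sigma> *\<^sub>R ?e) - (x0 + \<sigma> *\<^sub>R ?e))) = g \<sigma>"
        unfolding g_def
        by (intro lborel_integral_translate borel_measurable_continuous_onI continuous_on_mult d
            continuous_on_compose2[OF cb(1)] continuous_intros) auto
      then show ?thesis by simp
    qed
    ultimately have "(LINT x|lborel. d (x + (x0 + s *\<^sub>R ?e)) * ?b x) = (LINT x|lborel. d (x + x0) * ?b x)"
      by simp
    moreover have "integrable lborel (\<lambda>x. d (x + y) * ?b x)" for y
      by (rule integrable_compact_support(1)[where B = "real CARD('n) * \<delta>"])
         (auto intro!: continuous_on_mult cd cb simp: bump_eq_0)
    ultimately show "(LINT x|lborel. f x * ?b x) = 0"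
      by (simp add: f_def left_diff_distrib)
  qed
  then show ?thesis by (simp add: f_def)
qed

lemma smooth_box_tendsto_indicator:
  "(\<lambda>k. smooth_box (real (Suc k)) a b x) \<longlonglongrightarrow> indicator (box a b) (x::real^'n::finite)"
proof (cases "x \<in> box a b")
  case True
  have "eventually (\<lambda>k. real (Suc k) * c \<ge> 1) sequentially" if "c > 0" for c :: real
    using that by real_asymp
  then have "eventually (\<lambda>k. \<forall>i. real (Suc k) * (x $ i - a $ i) \<ge> 1 \<and> real (Suc k) * (b $ i - x $ i) \<ge> 1) sequentially"
    using True by (intro eventually_all_finite eventually_conj) (auto simp: mem_box_cart)
  then have "eventually (\<lambda>k. 1 = smooth_box (real (Suc k)) a b x) sequentially"
    by (rule eventually_mono) (simp add: smooth_box_eq_1)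
  then have "(\<lambda>k. smooth_box (real (Suc k)) a b x) \<longlonglongrightarrow> 1"
    by (rule Lim_transform_eventually[OF tendsto_const])
  then show ?thesis using True by simp
next
  case False
  then show ?thesis by (simp add: smooth_box_eq_0)
qed

text \<open>
  Smooth boxes converge boundedly to indicators of boxes, so \<open>f\<close> has integral zero
  over every box, and over every Borel set because boxes are a generator stable under
  intersection.
\<close>

lemma weakly_zero_imp_AE_zero:
  fixes f :: "real^'n::finite \<Rightarrow> real"
  assumes loc: "\<And>a b. integrable lborel (\<lambda>x. indicator (box a b) x *\<^sub>R f x)"
    and weak: "\<And>\<phi>. test_function \<phi> \<Longrightarrow> (LINT x|lborel. f x * \<phi> x) = 0"
  shows "AE x in lborel. f x = 0"
proof -
  have box0: "(LINT x|lborel. indicator (box a b) x *\<^sub>R f x) = 0" for a b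
  proof -
    have "(\<lambda>k. LINT x|lborel. smooth_box (real (Suc k)) a b x * (indicator (box a b) x *\<^sub>R f x))
      \<longlonglongrightarrow> (LINT x|lborel. indicator (box a b) x * (indicator (box a b) x *\<^sub>R f x))"
    proof (rule integral_dominated_convergence[where w = "\<lambda>x. norm (indicator (box a b) x *\<^sub>R f x)"])
      have [measurable]: "(\<lambda>x. indicator (box a b) x *\<^sub>R f x) \<in> borel_measurable lborel"
        using loc by blast
      have [measurable]: "smooth_box k a b \<in> borel_measurable borel" for k
        using Ck_smooth_box[of 0 k a b] by (intro borel_measurable_continuous_onI) simp
      show "(\<lambda>x. smooth_box (real (Suc k)) a b x * (indicator (box a b) x *\<^sub>R f x)) \<in> borel_measurable lborel" for k
        by measurable
      show "(\<lambda>x. indicator (box a b) x * (indicator (box a b) x *\<^sub>R f x)) \<in> borel_measurable lborel"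
        by measurable
      show "integrable lborel (\<lambda>x. norm (indicator (box a b) x *\<^sub>R f x))"
        by (intro integrable_norm loc)
      show "AE x in lborel. (\<lambda>k. smooth_box (real (Suc k)) a b x * (indicator (box a b) x *\<^sub>R f x))
          \<longlonglongrightarrow> indicator (box a b) x * (indicator (box a b) x *\<^sub>R f x)"
        by (intro AE_I2 tendsto_mult smooth_box_tendsto_indicator tendsto_const)
      show "AE x in lborel. norm (smooth_box (real (Suc k)) a b x * (indicator (box a b) x *\<^sub>R f x))
          \<le> norm (indicator (box a b) x *\<^sub>R f x)" for k
        using smooth_box_bounds[of "real (Suc k)" a b]
        unfolding norm_mult by (intro AE_I2 mult_left_le_one_le) auto
    qed
    moreover have "(\<lambda>x. smooth_box (real (Suc k)) a b x * (indicator (box a b) x *\<^sub>R f x))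
        = (\<lambda>x. f x * smooth_box (real (Suc k)) a b x)" for k
    proof
      show "smooth_box (real (Suc k)) a b x * (indicator (box a b) x *\<^sub>R f x) = f x * smooth_box (real (Suc k)) a b x" for x
        using smooth_box_eq_0[of "real (Suc k)" x a b] by (cases "x \<in> box a b") auto
    qed
    moreover have "(\<lambda>x. indicator (box a b) x * (indicator (box a b) x *\<^sub>R f x)) = (\<lambda>x. indicator (box a b) x *\<^sub>R f x)"
      by (auto simp: indicator_def)
    moreover have "(LINT x|lborel. f x * smooth_box (real (Suc k)) a b x) = 0" for k
      by (rule weak[OF test_function_smooth_box]) simp
    ultimately have "(\<lambda>k. 0) \<longlonglongrightarrow> (LINT x|lborel. indicator (box a b) x *\<^sub>R f x)"
      by (simp only:)
    then show ?thesis using LIMSEQ_unique[OF tendsto_const] by metis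
  qed
  have "AE x in lborel. indicator (box a b) x *\<^sub>R f x = 0" for a b
  proof (rule sigma_finite_measure.density_zero[OF lborel.sigma_finite_measure_axioms loc])
    fix A :: "(real^'n) set" assume "A \<in> sets lborel"
    then have A: "A \<in> sigma_sets UNIV (range (\<lambda>(a, b). box a b))"
      by (simp add: borel_eq_box sets_measure_of)
    have st: "Int_stable (range (\<lambda>(a, b). box a b :: (real^'n) set))"
      by (auto simp: Int_stable_def box_Int_box)
    have "range (\<lambda>(a, b). box a b :: (real^'n) set) \<subseteq> Pow UNIV" by simp
    from st this A show "set_lebesgue_integral lborel A (\<lambda>x. indicator (box a b) x *\<^sub>R f x) = 0"
    proof (induction rule: sigma_sets_induct_disjoint)
      case (basic A)
      then obtain c d where "A = box c d" by auto
      then obtain c' d' where A: "A \<inter> box a b = box c' d'" using box_Int_box by blast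
      have "(\<lambda>x. indicator A x *\<^sub>R indicator (box a b) x *\<^sub>R f x) = (\<lambda>x. indicator (box c' d') x *\<^sub>R f x)"
        unfolding A[symmetric] by (auto simp: indicator_def)
      then show ?case unfolding set_lebesgue_integral_def by (simp only: box0)
    next
      case empty
      then show ?case by (simp add: set_lebesgue_integral_def)
    next
      case (compl A)
      have "A \<in> sets borel" using compl(1) by (simp add: borel_eq_box sets_measure_of)
      then have iA: "integrable lborel (\<lambda>x. indicator A x *\<^sub>R (indicator (box a b) x *\<^sub>R f x))"
        by (intro integrable_mult_indicator loc) simp
      have "(LINT x|lborel. indicator (UNIV - A) x *\<^sub>R indicator (box a b) x *\<^sub>R f x)
          = (LINT x|lborel. indicator (box a b) x *\<^sub>R f x - indicator A x *\<^sub>R indicator (box a b) x *\<^sub>R f x)"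
        by (intro Bochner_Integration.integral_cong) (auto simp: indicator_def)
      also have "\<dots> = 0"
        using compl(2) unfolding Bochner_Integration.integral_diff[OF loc iA] box0 set_lebesgue_integral_def by simp
      finally show ?case unfolding set_lebesgue_integral_def .
    next
      case (union A)
      have A: "A i \<in> sets borel" for i using union(2) by (auto simp: borel_eq_box sets_measure_of)
      have "set_lebesgue_integral lborel (\<Union>i. A i) (\<lambda>x. indicator (box a b) x *\<^sub>R f x)
          = (\<Sum>i. set_lebesgue_integral lborel (A i) (\<lambda>x. indicator (box a b) x *\<^sub>R f x))"
      proof (rule lebesgue_integral_countable_add)
        show "set_integrable lborel (\<Union>i. A i) (\<lambda>x. indicator (box a b) x *\<^sub>R f x)"
          unfolding set_integrable_def by (intro integrable_mult_indicator loc) (use A in auto)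
        show "A i \<in> sets lborel" for i using A by simp
        show "i \<noteq> j \<Longrightarrow> A i \<inter> A j = {}" for i j
          using disjoint_family_onD[OF union(1)] by blast
      qed
      then show ?case unfolding union(3) by simp
    qed
  qed
  then have "AE x in lborel. \<forall>k::nat. indicator (box (- vec (real k)) (vec (real k))) x *\<^sub>R f x = 0"
    unfolding AE_all_countable by blast
  then show ?thesis
  proof (rule AE_mp, intro AE_I2 impI)
    fix x :: "real^'n" assume *: "\<forall>k::nat. indicator (box (- vec (real k)) (vec (real k))) x *\<^sub>R f x = 0"
    obtain k :: nat where "norm x < real k" using reals_Archimedean2 by blast
    then have "\<bar>x $ i\<bar> < real k" for i using component_le_norm_cart[of x i] by linarith
    then have "x \<in> box (- vec (real k)) (vec (real k))" by (auto simp: mem_box_cart abs_less_iff minus_less_iff)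
    then show "f x = 0" using * by (auto dest!: spec[of _ k])
  qed
qed

section \<open>Sobolev embedding into \<open>C\<^sup>1\<close>\<close>

text \<open>
  Dyadic decomposition: on the shell \<open>2\<^sup>k \<le> |\<xi>| < 2\<^bsup>k+1\<^esup>\<close>
  the weight is at most \<open>4\<^bsup>k(1-m)\<^esup>\<close>, and for \<open>n \<le> 2\<close>
  the shell has volume \<open>O(4\<^sup>k)\<close>, so that the contributions are bounded by a
  geometric series with ratio \<open>4\<^bsup>2-m\<^esup> < 1\<close>.
\<close>

lemma integrable_sobolev_weight:
  assumes n: "CARD('n::finite) \<le> 2" and m: "m > 2"
  shows "integrable lborel (\<lambda>\<xi>::real^'n. (1 + (norm \<xi>)\<^sup>2) powr (1 - m))"
proof -
  define p where "p = (4::real) powr (1 - m)"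
  define V where "V = unit_ball_vol (real CARD('n))"
  define f where "f k \<xi> = p ^ k * indicator (ball 0 (2 ^ Suc k)) \<xi>" for k and \<xi> :: "real^'n"
  have p: "0 < p" "p < 1" using m by (auto simp: p_def intro: powr_less_one)
  have p4: "4 * p < 1"
    using powr_less_one[of 4 "2 - m"] m powr_add[of 4 1 "1 - m"] by (simp add: p_def)
  have V: "V \<ge> 0" by (simp add: V_def)
  have f_le: "norm (f k \<xi>) \<le> p ^ k" for k \<xi> using p by (auto simp: f_def indicator_def)
  have f_nn: "f k \<xi> \<ge> 0" for k \<xi> using p by (auto simp: f_def)
  have sf: "summable (\<lambda>k. norm (f k \<xi>))" for \<xi>
    using p by (intro summable_comparison_test[OF _ summable_geometric[of p]] exI[of _ 0]) (auto intro: f_le[unfolded real_norm_def])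
  have int: "integrable lborel (f k)" for k
    unfolding f_def by (intro integrable_mult_right integrable_real_indicator[OF _ emeasure_lborel_ball_finite]) simp
  have f_int: "(LINT \<xi>|lborel. norm (f k \<xi>)) \<le> 4 * V * (4 * p) ^ k" for k
  proof -
    have eq: "(LINT \<xi>|lborel. norm (f k \<xi>)) = p ^ k * (V * (2 ^ Suc k) ^ CARD('n))"
      using f_nn by (simp add: f_def V_def content_ball)
    have "(2 ^ Suc k) ^ CARD('n) \<le> ((2::real) ^ Suc k)\<^sup>2"
      by (intro power_increasing n one_le_power) simp
    also have "((2::real) ^ Suc k)\<^sup>2 = (2\<^sup>2) ^ Suc k"
      unfolding power_mult[symmetric] by (simp only: mult.commute)
    also have "\<dots> = 4 * 4 ^ k" by simp
    finally have "p ^ k * (V * (2 ^ Suc k) ^ CARD('n)) \<le> p ^ k * (V * (4 * 4 ^ k))"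
      using p V by (intro mult_left_mono) auto
    also have "\<dots> = 4 * V * (4 * p) ^ k"
      by (simp add: power_mult_distrib)
    finally show ?thesis unfolding eq .
  qed
  have "norm (4 * p) < 1" using p p4 by simp
  then have sum: "summable (\<lambda>k. 4 * V * (4 * p) ^ k)"
    by (intro summable_mult summable_geometric)
  have "summable (\<lambda>k. LINT \<xi>|lborel. norm (f k \<xi>))"
  proof (rule summable_comparison_test'[OF sum])
    fix k
    have abs_le: "norm x \<le> y" if "0 \<le> x" "x \<le> y" for x y :: real using that by simp
    show "norm (LINT \<xi>|lborel. norm (f k \<xi>)) \<le> 4 * V * (4 * p) ^ k"
      by (rule abs_le[OF _ f_int]) (intro integral_nonneg_AE AE_I2 norm_ge_zero)
  qed
  then have "integrable lborel (\<lambda>\<xi>. \<Sum>k. f k \<xi>)"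
    by (intro integrable_suminf int AE_I2 sf)
  moreover have "(1 + (norm \<xi>)\<^sup>2) powr (1 - m) \<le> (\<Sum>k. f k \<xi>)" for \<xi> :: "real^'n"
  proof -
    define r where "r = max 1 (norm \<xi>)"
    define k where "k = (LEAST k. r < 2 ^ Suc k)"
    have "\<exists>k. r < 2 ^ Suc k"
      using real_arch_pow[of 2 r] by (metis le_less_trans less_le_not_le lessI one_less_numeral_iff power_strict_increasing_iff semiring_norm(76) less_trans)
    then have k: "r < 2 ^ Suc k" unfolding k_def by (rule LeastI_ex)
    have k': "2 ^ k \<le> r"
    proof (cases k)
      case 0 then show ?thesis by (simp add: r_def)
    next
      case (Suc l)
      then have "\<not> r < 2 ^ Suc l" using not_less_Least[of l "\<lambda>k. r < 2 ^ Suc k"] by (simp add: k_def)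
      then show ?thesis using Suc by simp
    qed
    have "(4::real) ^ k = (2 ^ k)\<^sup>2" by (simp add: power2_eq_square flip: power_mult_distrib)
    also have "\<dots> \<le> r\<^sup>2" using k' by (intro power_mono) auto
    also have "\<dots> \<le> 1 + (norm \<xi>)\<^sup>2" by (auto simp: r_def max_def)
    finally have "(1 + (norm \<xi>)\<^sup>2) powr (1 - m) \<le> (4 ^ k) powr (1 - m)"
      using m by (intro powr_mono2') auto
    also have "\<dots> = p ^ k"
      by (simp add: p_def powr_powr powr_realpow[symmetric] mult.commute flip: powr_realpow)
    also have "\<dots> = f k \<xi>" using k by (simp add: f_def r_def)
    also have "f k \<xi> \<le> (\<Sum>k. f k \<xi>)"
      using sum_le_suminf[of "\<lambda>k. f k \<xi>" "{k}"] summable_norm_cancel[OF sf] f_nn by simp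
    finally show ?thesis .
  qed
  ultimately have intS: "integrable lborel (\<lambda>\<xi>. \<Sum>k. f k \<xi>)"
    and le: "\<And>\<xi>. (1 + (norm \<xi>)\<^sup>2) powr (1 - m) \<le> (\<Sum>k. f k \<xi>)" by blast+
  show ?thesis
  proof (rule Bochner_Integration.integrable_bound[OF intS])
    show "AE \<xi> in lborel. norm ((1 + (norm \<xi>)\<^sup>2) powr (1 - m)) \<le> norm (\<Sum>k. f k \<xi>)"
    proof (rule AE_I2)
      fix \<xi> :: "real^'n"
      show "norm ((1 + (norm \<xi>)\<^sup>2) powr (1 - m)) \<le> norm (\<Sum>k. f k \<xi>)"
        using le[of \<xi>] powr_ge_zero[of "1 + (norm \<xi>)\<^sup>2" "1 - m"] unfolding real_norm_def by linarith
    qed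
  qed measurable
qed

text \<open>
  The Cauchy-Schwarz inequality up to a constant factor, obtained by splitting the product
  pointwise with a parameter \<open>\<epsilon>\<close> and choosing \<open>\<epsilon>\<close>
  afterwards. Control of \<open>(1 + |\<xi>|) |g|\<close> in \<open>L\<^sup>1\<close> is exactly
  what makes the inverse transform \<open>C\<^sup>1\<close>.
\<close>

lemma weighted_L1_bound:
  fixes g :: "real^'n::finite \<Rightarrow> complex"
    and m :: real
  defines "W \<equiv> (LINT \<xi>::real^'n|lborel. (1 + (norm \<xi>)\<^sup>2) powr (1 - m))"
    and "A \<equiv> (LINT \<xi>|lborel. (1 + (norm \<xi>)\<^sup>2) powr m * (cmod (g \<xi>))\<^sup>2)"
  assumes n: "CARD('n) \<le> 2" and m: "m > 2"
    and [measurable]: "g \<in> borel_measurable lborel"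
    and int: "integrable lborel (\<lambda>\<xi>. (1 + (norm \<xi>)\<^sup>2) powr m * (cmod (g \<xi>))\<^sup>2)"
  shows "integrable lborel (\<lambda>\<xi>. (1 + norm \<xi>) * cmod (g \<xi>))"
    and "(LINT \<xi>|lborel. (1 + norm \<xi>) * cmod (g \<xi>)) \<le> (1 + W) * sqrt A"
proof -
  let ?w = "\<lambda>\<xi>::real^'n. 1 + (norm \<xi>)\<^sup>2"
  let ?B = "\<lambda>\<epsilon> \<xi>. \<epsilon> / 2 * (?w \<xi> powr m * (cmod (g \<xi>))\<^sup>2) + 1 / \<epsilon> * ?w \<xi> powr (1 - m)"
  note W = integrable_sobolev_weight[OF n m]
  have bound: "(1 + norm \<xi>) * cmod (g \<xi>) \<le> ?B \<epsilon> \<xi>" if \<epsilon>: "\<epsilon> > 0" for \<epsilon> and \<xi> :: "real^'n"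
  proof -
    have w: "?w \<xi> > 0" by (simp add: add_pos_nonneg)
    \<comment> \<open>Chosen so that the square below, divided by \<open>2 b\<close>, puts the weight of the Sobolev norm on \<open>|g|\<^sup>2\<close> and leaves an integrable weight.\<close>
    define b where "b = \<epsilon> * ?w \<xi> powr m"
    have b: "b > 0" using \<epsilon> w by (simp add: b_def add_nonneg_eq_0_iff)
    let ?x = "cmod (g \<xi>)" and ?y = "1 + norm \<xi>"
    have "0 \<le> (b * ?x - ?y)\<^sup>2" by simp
    then have "2 * b * (?y * ?x) \<le> b\<^sup>2 * ?x\<^sup>2 + ?y\<^sup>2" by (simp add: power2_eq_square algebra_simps)
    also have "\<dots> \<le> b\<^sup>2 * ?x\<^sup>2 + 2 * ?w \<xi>"
      using sum_squares_bound[of 1 "norm \<xi>"] by (simp add: power2_eq_square algebra_simps)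
    finally have "?y * ?x \<le> (b\<^sup>2 * ?x\<^sup>2 + 2 * ?w \<xi>) / (2 * b)"
      using b by (simp add: pos_le_divide_eq mult.commute)
    also have "\<dots> = b / 2 * ?x\<^sup>2 + ?w \<xi> / b" using b by (simp add: power2_eq_square add_divide_distrib)
    also have "?w \<xi> / b = 1 / \<epsilon> * ?w \<xi> powr (1 - m)"
      using w by (simp add: b_def powr_diff)
    finally show ?thesis by (simp add: b_def)
  qed
  have intB: "integrable lborel (?B \<epsilon>)" for \<epsilon>
    by (intro Bochner_Integration.integrable_add integrable_mult_right int W)
  show i: "integrable lborel (\<lambda>\<xi>. (1 + norm \<xi>) * cmod (g \<xi>))"
  proof (rule Bochner_Integration.integrable_bound[OF intB[of 1]])
    show "AE \<xi> in lborel. norm ((1 + norm \<xi>) * cmod (g \<xi>)) \<le> norm (?B 1 \<xi>)"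
      using bound[of 1] by (intro AE_I2) (auto intro: order_trans[OF _ abs_ge_self])
  qed simp
  have le: "(LINT \<xi>|lborel. (1 + norm \<xi>) * cmod (g \<xi>)) \<le> \<epsilon> / 2 * A + 1 / \<epsilon> * W" (is "?I \<le> _") if "\<epsilon> > 0" for \<epsilon>
  proof -
    have "?I \<le> integral\<^sup>L lborel (?B \<epsilon>)"
      by (rule integral_mono[OF i intB bound[OF that]])
    also have "\<dots> = \<epsilon> / 2 * A + 1 / \<epsilon> * W"
      unfolding A_def W_def using int W
      by (subst Bochner_Integration.integral_add) auto
    finally show ?thesis .
  qed
  have A: "A \<ge> 0" unfolding A_def by (intro integral_nonneg_AE AE_I2) simp
  have W: "W \<ge> 0" unfolding W_def by (intro integral_nonneg_AE AE_I2) simp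
  show "?I \<le> (1 + W) * sqrt A"
  proof (cases "A = 0")
    case True
    \<comment> \<open>The Sobolev norm vanishes, so large \<open>\<epsilon>\<close> make the bound arbitrarily small.\<close>
    have "?I \<le> \<delta>" if "\<delta> > 0" for \<delta>
    proof -
      have "?I \<le> \<delta> * (W / (W + 1))"
        using le[of "(W + 1) / \<delta>"] that W by (simp add: True)
      also have "\<dots> \<le> \<delta> * 1" using that W by (intro mult_left_mono) auto
      finally show ?thesis by simp
    qed
    then have "?I \<le> 0" by (rule field_le_epsilon[of _ 0, simplified])
    then show ?thesis by (simp add: True)
  next
    case False
    then have "sqrt A > 0" using A by simp
    then have "?I \<le> sqrt A / 2 + sqrt A * W"
      using le[of "1 / sqrt A"] A real_div_sqrt[of A] by (simp add: algebra_simps)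
    also have "\<dots> \<le> (1 + W) * sqrt A" using A by (simp add: algebra_simps)
    finally show ?thesis .
  qed
qed

text \<open>
  Dominated convergence for the difference quotients, which are bounded by \<open>2 w\<close> by
  the mean value theorem.
\<close>

lemma C1_grad_integral:
  fixes f :: "'x \<Rightarrow> real^'n::finite \<Rightarrow> real" and G :: "'x \<Rightarrow> real^'n \<Rightarrow> real^'n"
  assumes C1: "\<And>\<xi>. C1_grad (f \<xi>) (G \<xi>)"
    and int: "\<And>x. integrable M (\<lambda>\<xi>. f \<xi> x)"
    and meas: "\<And>x. (\<lambda>\<xi>. G \<xi> x) \<in> borel_measurable M"
    and bound: "\<And>\<xi> x. norm (G \<xi> x) \<le> w \<xi>"
    and w: "integrable M w"
  shows "C1_grad (\<lambda>x. LINT \<xi>|M. f \<xi> x) (\<lambda>x. LINT \<xi>|M. G \<xi> x)"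
proof -
  have intG: "integrable M (\<lambda>\<xi>. G \<xi> x)" for x
    by (rule Bochner_Integration.integrable_bound[OF w meas])
       (auto intro!: AE_I2 order_trans[OF bound])
  have "continuous_on UNIV (\<lambda>x. LINT \<xi>|M. G \<xi> x)"
  proof (rule continuous_on_sequentiallyI)
    fix u :: "nat \<Rightarrow> real^'n" and a assume u: "u \<longlonglongrightarrow> a"
    show "(\<lambda>n. LINT \<xi>|M. G \<xi> (u n)) \<longlonglongrightarrow> (LINT \<xi>|M. G \<xi> a)"
    proof (rule integral_dominated_convergence[where w = w])
      show "AE \<xi> in M. (\<lambda>n. G \<xi> (u n)) \<longlonglongrightarrow> G \<xi> a"
        using C1_gradD(2)[OF C1] u
        by (intro AE_I2) (auto intro: continuous_on_tendsto_compose[where s = UNIV and l = a])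
    qed (use meas w bound in auto)
  qed
  moreover have "((\<lambda>x. LINT \<xi>|M. f \<xi> x) has_derivative (\<lambda>h. (LINT \<xi>|M. G \<xi> x) \<bullet> h)) (at x)" for x
    unfolding has_derivative_iff_norm
  proof (intro conjI bounded_linear_inner_right, subst tendsto_at_iff_sequentially, intro allI impI)
    fix X :: "nat \<Rightarrow> real^'n" assume X: "\<forall>i. X i \<in> UNIV - {x}" "X \<longlonglongrightarrow> x"
    let ?q = "\<lambda>n \<xi>. norm (f \<xi> (X n) - f \<xi> x - G \<xi> x \<bullet> (X n - x)) / norm (X n - x)"
    have "(\<lambda>n. LINT \<xi>|M. ?q n \<xi>) \<longlonglongrightarrow> (LINT \<xi>|M. (0::real))"
    proof (rule integral_dominated_convergence[where w = "\<lambda>\<xi>. 2 * w \<xi>"])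
      show "(\<lambda>\<xi>. ?q n \<xi>) \<in> borel_measurable M" for n
        using int[THEN borel_measurable_integrable] meas by measurable
      show "AE \<xi> in M. (\<lambda>n. ?q n \<xi>) \<longlonglongrightarrow> 0"
      proof (rule AE_I2)
        fix \<xi>
        have "((\<lambda>y. norm (f \<xi> y - f \<xi> x - G \<xi> x \<bullet> (y - x)) / norm (y - x)) \<longlongrightarrow> 0) (at x)"
          using C1_gradD(1)[OF C1[of \<xi>], of x] unfolding has_derivative_iff_norm by blast
        then show "(\<lambda>n. ?q n \<xi>) \<longlonglongrightarrow> 0"
          using X unfolding tendsto_at_iff_sequentially by (auto simp: o_def)
      qed
      show "AE \<xi> in M. norm (?q n \<xi>) \<le> 2 * w \<xi>" for n
      proof (rule AE_I2)
        fix \<xi>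
        have nz: "norm (X n - x) > 0" using X(1) by auto
        have "\<bar>f \<xi> (X n) - f \<xi> x\<bar> \<le> w \<xi> * norm (X n - x)"
          by (rule C1_grad_lipschitz[OF C1 bound])
        moreover have "\<bar>G \<xi> x \<bullet> (X n - x)\<bar> \<le> w \<xi> * norm (X n - x)"
          using Cauchy_Schwarz_ineq2[of "G \<xi> x" "X n - x"] mult_right_mono[OF bound[of \<xi> x] norm_ge_zero[of "X n - x"]]
          by linarith
        ultimately have "\<bar>f \<xi> (X n) - f \<xi> x - G \<xi> x \<bullet> (X n - x)\<bar> \<le> 2 * w \<xi> * norm (X n - x)"
          by linarith
        then show "norm (?q n \<xi>) \<le> 2 * w \<xi>"
          using nz by (simp add: pos_divide_le_eq)
      qed
    qed (use w in auto)
    then have lim: "(\<lambda>n. LINT \<xi>|M. ?q n \<xi>) \<longlonglongrightarrow> 0" by simp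
    have le: "norm ((LINT \<xi>|M. f \<xi> (X n)) - (LINT \<xi>|M. f \<xi> x) - (LINT \<xi>|M. G \<xi> x) \<bullet> (X n - x)) / norm (X n - x)
      \<le> (LINT \<xi>|M. ?q n \<xi>)" for n
    proof -
      have i: "integrable M (\<lambda>\<xi>. f \<xi> (X n) - f \<xi> x - G \<xi> x \<bullet> (X n - x))"
        by (intro Bochner_Integration.integrable_diff int integrable_inner_left intG)
      have "(LINT \<xi>|M. f \<xi> (X n)) - (LINT \<xi>|M. f \<xi> x) - (LINT \<xi>|M. G \<xi> x) \<bullet> (X n - x)
        = (LINT \<xi>|M. f \<xi> (X n) - f \<xi> x - G \<xi> x \<bullet> (X n - x))"
        using int intG by simp
      also have "norm \<dots> \<le> (LINT \<xi>|M. norm (f \<xi> (X n) - f \<xi> x - G \<xi> x \<bullet> (X n - x)))"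
        by (rule integral_norm_bound)
      finally show ?thesis by (simp add: divide_right_mono)
    qed
    show "((\<lambda>y. norm ((LINT \<xi>|M. f \<xi> y) - (LINT \<xi>|M. f \<xi> x) - (LINT \<xi>|M. G \<xi> x) \<bullet> (y - x)) / norm (y - x)) \<circ> X) \<longlonglongrightarrow> 0"
      unfolding o_def
      by (rule tendsto_sandwich[OF _ always_eventually[OF allI[OF le]] tendsto_const lim]) simp
  qed
  ultimately show ?thesis unfolding C1_grad_def by blast
qed

text \<open>
  The contribution of frequency \<open>\<xi>\<close> to the inverse Fourier transform; the real
  part suffices because the functions to be represented are real.
\<close>

definition fourier_mode :: "(real^'n::finite \<Rightarrow> complex) \<Rightarrow> real^'n \<Rightarrow> real^'n \<Rightarrow> real" where
  "fourier_mode g \<xi> x = 1 / (2 * pi) ^ CARD('n) * Re (g \<xi> * cis (\<xi> \<bullet> x))"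

definition fourier_mode_grad :: "(real^'n::finite \<Rightarrow> complex) \<Rightarrow> real^'n \<Rightarrow> real^'n \<Rightarrow> real^'n" where
  "fourier_mode_grad g \<xi> x = (1 / (2 * pi) ^ CARD('n) * Re (g \<xi> * \<i> * cis (\<xi> \<bullet> x))) *\<^sub>R \<xi>"

lemma C1_grad_fourier_mode: "C1_grad (fourier_mode g \<xi>) (fourier_mode_grad g \<xi>)"
proof -
  have "((\<lambda>x. Re (g \<xi> * cis (\<xi> \<bullet> x))) has_derivative (\<lambda>h. (Re (g \<xi> * \<i> * cis (\<xi> \<bullet> x)) *\<^sub>R \<xi>) \<bullet> h)) (at x)" for x
    by (auto intro!: derivative_eq_intros simp: algebra_simps)
  then show ?thesis
    unfolding C1_grad_def fourier_mode_def fourier_mode_grad_def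
    by (auto intro!: derivative_eq_intros continuous_intros simp: algebra_simps)
qed

lemma two_pi_power_ge_1: "1 / (2 * pi) ^ n \<le> 1" "1 / (2 * pi) ^ n > 0"
  using one_le_power[of "2 * pi" n] pi_ge_two by (auto simp: divide_simps)

lemma norm_fourier_mode_le: "norm (fourier_mode g \<xi> x) \<le> cmod (g \<xi>)"
proof -
  have "\<bar>Re (g \<xi> * cis (\<xi> \<bullet> x))\<bar> \<le> cmod (g \<xi>)"
    using abs_Re_le_cmod[of "g \<xi> * cis (\<xi> \<bullet> x)"] by (simp add: norm_mult)
  then show ?thesis
    using mult_mono[of "1 / (2 * pi) ^ CARD('a)" 1 "\<bar>Re (g \<xi> * cis (\<xi> \<bullet> x))\<bar>"] two_pi_power_ge_1
    by (simp add: fourier_mode_def abs_mult)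
qed

lemma norm_fourier_mode_grad_le: "norm (fourier_mode_grad g \<xi> x) \<le> cmod (g \<xi>) * norm \<xi>"
proof -
  have "\<bar>Re (g \<xi> * \<i> * cis (\<xi> \<bullet> x))\<bar> \<le> cmod (g \<xi>)"
    using abs_Re_le_cmod[of "g \<xi> * \<i> * cis (\<xi> \<bullet> x)"] by (simp add: norm_mult)
  then have "\<bar>1 / (2 * pi) ^ CARD('a) * Re (g \<xi> * \<i> * cis (\<xi> \<bullet> x))\<bar> \<le> cmod (g \<xi>)"
    using mult_mono[of "1 / (2 * pi) ^ CARD('a)" 1 "\<bar>Re (g \<xi> * \<i> * cis (\<xi> \<bullet> x))\<bar>"] two_pi_power_ge_1
    by (simp add: abs_mult)
  then show ?thesis unfolding fourier_mode_grad_def norm_scaleR by (intro mult_right_mono) auto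
qed

lemma borel_measurable_cis [measurable]: "cis \<in> borel_measurable borel"
  by (intro borel_measurable_continuous_onI continuous_intros)

definition fourier_inversion :: "(real^'n::finite \<Rightarrow> complex) \<Rightarrow> real^'n \<Rightarrow> real" where
  "fourier_inversion g x = (LINT \<xi>|lborel. fourier_mode g \<xi> x)"

definition fourier_inversion_grad :: "(real^'n::finite \<Rightarrow> complex) \<Rightarrow> real^'n \<Rightarrow> real^'n" where
  "fourier_inversion_grad g x = (LINT \<xi>|lborel. fourier_mode_grad g \<xi> x)"

lemma fourier_inversion_C1:
  fixes g :: "real^'n::finite \<Rightarrow> complex"
  assumes [measurable]: "g \<in> borel_measurable lborel"
    and int: "integrable lborel (\<lambda>\<xi>. (1 + norm \<xi>) * cmod (g \<xi>))"
  shows "C1_grad (fourier_inversion g) (fourier_inversion_grad g)"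
    and "\<bar>fourier_inversion g x\<bar> \<le> (LINT \<xi>|lborel. (1 + norm \<xi>) * cmod (g \<xi>))"
    and "norm (fourier_inversion_grad g x) \<le> (LINT \<xi>|lborel. (1 + norm \<xi>) * cmod (g \<xi>))"
    and "integrable lborel (\<lambda>\<xi>. cmod (g \<xi>))"
proof -
  let ?w = "\<lambda>\<xi>. (1 + norm \<xi>) * cmod (g \<xi>)"
  have b1: "norm (fourier_mode g \<xi> x) \<le> ?w \<xi>" for \<xi> x
    using norm_fourier_mode_le[of g \<xi> x] by (simp add: algebra_simps add_increasing2)
  have b2: "norm (fourier_mode_grad g \<xi> x) \<le> ?w \<xi>" for \<xi> x
    using norm_fourier_mode_grad_le[of g \<xi> x] norm_ge_zero[of "g \<xi>"] unfolding distrib_right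
    by (simp add: mult.commute add_increasing)
  have m1: "(\<lambda>\<xi>. fourier_mode g \<xi> x) \<in> borel_measurable lborel" for x
    unfolding fourier_mode_def by measurable
  have m2: "(\<lambda>\<xi>. fourier_mode_grad g \<xi> x) \<in> borel_measurable lborel" for x
    unfolding fourier_mode_grad_def by measurable
  have i1: "integrable lborel (\<lambda>\<xi>. fourier_mode g \<xi> x)" for x
    by (rule Bochner_Integration.integrable_bound[OF int m1]) (auto intro!: AE_I2 order_trans[OF b1[unfolded real_norm_def]])
  have i2: "integrable lborel (\<lambda>\<xi>. fourier_mode_grad g \<xi> x)" for x
    by (rule Bochner_Integration.integrable_bound[OF int m2]) (auto intro!: AE_I2 order_trans[OF b2])
  show "C1_grad (fourier_inversion g) (fourier_inversion_grad g)"
    unfolding fourier_inversion_def fourier_inversion_grad_def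
    by (rule C1_grad_integral[OF C1_grad_fourier_mode i1 m2 b2 int])
  show "\<bar>fourier_inversion g x\<bar> \<le> integral\<^sup>L lborel ?w"
    unfolding fourier_inversion_def real_norm_def[symmetric]
    by (rule order_trans[OF integral_norm_bound integral_mono[OF integrable_norm[OF i1] int b1]])
  show "norm (fourier_inversion_grad g x) \<le> integral\<^sup>L lborel ?w"
    unfolding fourier_inversion_grad_def
    by (rule order_trans[OF integral_norm_bound integral_mono[OF integrable_norm[OF i2] int b2]])
  show "integrable lborel (\<lambda>\<xi>. cmod (g \<xi>))"
    by (rule Bochner_Integration.integrable_bound[OF int]) (auto intro!: AE_I2 simp: algebra_simps)
qed

lemma test_function_integrable:
  assumes "test_function \<phi>" shows "integrable lborel \<phi>" "continuous_on UNIV \<phi>"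
proof -
  show c: "continuous_on UNIV \<phi>" using test_function_Ck[OF assms, of 0] by simp
  obtain B where "\<And>x. norm x > B \<Longrightarrow> \<phi> x = 0" by (rule test_function_vanishes[OF assms]) auto
  then show "integrable lborel \<phi>" by (rule integrable_compact_support(1)[OF c])
qed

lemma inv_fourier_bound:
  fixes \<phi> :: "real^'n::finite \<Rightarrow> real"
  assumes "test_function \<phi>"
  shows "cmod (inv_fourier \<phi> \<xi>) \<le> (LINT x|lborel. \<bar>\<phi> x\<bar>)"
proof -
  have "cmod (LINT x|lborel. cis (\<xi> \<bullet> x) * of_real (\<phi> x)) \<le> (LINT x|lborel. \<bar>\<phi> x\<bar>)"
    by (rule order_trans[OF integral_norm_bound]) (simp add: norm_mult)
  then show ?thesis
    using mult_mono[of "1 / (2 * pi) ^ CARD('n)" 1 "cmod (LINT x|lborel. cis (\<xi> \<bullet> x) * of_real (\<phi> x))"] two_pi_power_ge_1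
    by (simp add: inv_fourier_def norm_mult norm_power norm_divide)
qed

lemma integrable_mult_inv_fourier:
  fixes g :: "real^'n::finite \<Rightarrow> complex"
  assumes [measurable]: "g \<in> borel_measurable lborel" and int: "integrable lborel (\<lambda>\<xi>. cmod (g \<xi>))"
    and \<phi>: "test_function \<phi>"
  shows "integrable lborel (\<lambda>\<xi>. g \<xi> * inv_fourier \<phi> \<xi>)"
proof (rule Bochner_Integration.integrable_bound)
  have [measurable]: "\<phi> \<in> borel_measurable borel"
    using test_function_integrable(2)[OF \<phi>] by (rule borel_measurable_continuous_onI)
  show "integrable lborel (\<lambda>\<xi>. cmod (g \<xi>) * (LINT x|lborel. \<bar>\<phi> x\<bar>))" using int by simp
  have "inv_fourier \<phi> \<in> borel_measurable borel"
    unfolding inv_fourier_def by measurable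
  then show "(\<lambda>\<xi>. g \<xi> * inv_fourier \<phi> \<xi>) \<in> borel_measurable lborel" by measurable
  show "AE \<xi> in lborel. norm (g \<xi> * inv_fourier \<phi> \<xi>) \<le> norm (cmod (g \<xi>) * (LINT x|lborel. \<bar>\<phi> x\<bar>))"
    using inv_fourier_bound[OF \<phi>] by (intro AE_I2) (auto simp: norm_mult intro!: mult_left_mono order_trans[OF _ abs_ge_self])
qed

text \<open>
  Fubini's theorem, applicable because \<open>g\<close> and \<open>\<phi>\<close> are integrable
  and the kernel is bounded.
\<close>

lemma fourier_inversion_duality:
  fixes g :: "real^'n::finite \<Rightarrow> complex"
  assumes [measurable]: "g \<in> borel_measurable lborel" and int: "integrable lborel (\<lambda>\<xi>. cmod (g \<xi>))"
    and \<phi>: "test_function \<phi>"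
  shows "(LINT x|lborel. fourier_inversion g x * \<phi> x) = Re (LINT \<xi>|lborel. g \<xi> * inv_fourier \<phi> \<xi>)"
proof -
  note i\<phi> = test_function_integrable(1)[OF \<phi>]
  have [measurable]: "\<phi> \<in> borel_measurable borel"
    using test_function_integrable(2)[OF \<phi>] by (rule borel_measurable_continuous_onI)
  let ?K = "\<lambda>\<xi> x. fourier_mode g \<xi> x * \<phi> x"
  have mK: "case_prod ?K \<in> borel_measurable (lborel \<Otimes>\<^sub>M lborel)"
    unfolding fourier_mode_def by measurable
  have i: "integrable lborel (\<lambda>x. cis (\<xi> \<bullet> x) * of_real (\<phi> x))" for \<xi>
    by (rule Bochner_Integration.integrable_bound[OF i\<phi>]) (auto simp: norm_mult)
  have iK: "integrable lborel (?K \<xi>)" for \<xi>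
  proof (rule Bochner_Integration.integrable_bound[of lborel "\<lambda>x. cmod (g \<xi>) * \<phi> x"])
    show "?K \<xi> \<in> borel_measurable lborel" unfolding fourier_mode_def by measurable
    show "AE x in lborel. norm (?K \<xi> x) \<le> norm (cmod (g \<xi>) * \<phi> x)"
      using norm_fourier_mode_le[of g \<xi>] unfolding norm_mult by (intro AE_I2 mult_right_mono) auto
  qed (use i\<phi> in auto)
  have iP: "integrable (lborel \<Otimes>\<^sub>M lborel) (case_prod ?K)"
  proof (rule lborel_pair.Fubini_integrable[OF mK])
    show "AE \<xi> in lborel. integrable lborel (\<lambda>x. case_prod ?K (\<xi>, x))"
      unfolding prod.case by (intro AE_I2 iK)
    show "integrable lborel (\<lambda>\<xi>. LINT x|lborel. norm (case_prod ?K (\<xi>, x)))"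
    proof (rule Bochner_Integration.integrable_bound[of lborel "\<lambda>\<xi>. cmod (g \<xi>) * (LINT x|lborel. \<bar>\<phi> x\<bar>)"])
      show "(\<lambda>\<xi>. LINT x|lborel. norm (case_prod ?K (\<xi>, x))) \<in> borel_measurable lborel"
        using mK by measurable
      have "(LINT x|lborel. norm (?K \<xi> x)) \<le> (LINT x|lborel. cmod (g \<xi>) * \<bar>\<phi> x\<bar>)" for \<xi>
      proof (rule integral_mono[OF integrable_norm[OF iK]])
        show "integrable lborel (\<lambda>x. cmod (g \<xi>) * \<bar>\<phi> x\<bar>)" using i\<phi> by simp
        show "norm (?K \<xi> x) \<le> cmod (g \<xi>) * \<bar>\<phi> x\<bar>" for x
          using norm_fourier_mode_le[of g \<xi>] unfolding norm_mult real_norm_def abs_mult by (intro mult_right_mono) auto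
      qed
      then show "AE \<xi> in lborel. norm (LINT x|lborel. norm (case_prod ?K (\<xi>, x))) \<le> norm (cmod (g \<xi>) * (LINT x|lborel. \<bar>\<phi> x\<bar>))"
        by (intro AE_I2) (auto simp: abs_mult)
    qed (use int in auto)
  qed
  have pointwise: "(LINT x|lborel. ?K \<xi> x) = Re (g \<xi> * inv_fourier \<phi> \<xi>)" for \<xi>
  proof -
    have "g \<xi> * inv_fourier \<phi> \<xi> = of_real (1 / (2 * pi) ^ CARD('n)) * (LINT x|lborel. g \<xi> * (cis (\<xi> \<bullet> x) * of_real (\<phi> x)))"
      unfolding inv_fourier_def integral_mult_right_zero by (rule mult.left_commute)
    moreover have Re_mult: "Re (of_real c * z) = c * Re z" for c z by simp
    ultimately have "Re (g \<xi> * inv_fourier \<phi> \<xi>) = 1 / (2 * pi) ^ CARD('n) * Re (LINT x|lborel. g \<xi> * (cis (\<xi> \<bullet> x) * of_real (\<phi> x)))"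
      by (simp only: Re_mult)
    also have "Re (LINT x|lborel. g \<xi> * (cis (\<xi> \<bullet> x) * of_real (\<phi> x))) = (LINT x|lborel. Re (g \<xi> * (cis (\<xi> \<bullet> x) * of_real (\<phi> x))))"
      by (rule integral_Re[symmetric]) (intro integrable_mult_right i)
    also have "1 / (2 * pi) ^ CARD('n) * \<dots> = (LINT x|lborel. 1 / (2 * pi) ^ CARD('n) * Re (g \<xi> * (cis (\<xi> \<bullet> x) * of_real (\<phi> x))))"
      by (rule integral_mult_right_zero[symmetric])
    also have "\<dots> = (LINT x|lborel. ?K \<xi> x)"
    proof (rule Bochner_Integration.integral_cong[OF refl])
      have Re_mult': "Re (z * of_real c) = Re z * c" for c z by simp
      have "Re (g \<xi> * (cis (\<xi> \<bullet> x) * of_real (\<phi> x))) = Re (g \<xi> * cis (\<xi> \<bullet> x)) * \<phi> x" for x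
        unfolding mult.assoc[symmetric] by (rule Re_mult')
      then show "1 / (2 * pi) ^ CARD('n) * Re (g \<xi> * (cis (\<xi> \<bullet> x) * of_real (\<phi> x))) = ?K \<xi> x" for x
        by (simp only: fourier_mode_def mult.assoc)
    qed
    finally show ?thesis by (rule sym)
  qed
  from lborel_pair.Fubini_integral[OF iP]
  have "(LINT x|lborel. LINT \<xi>|lborel. ?K \<xi> x) = (LINT \<xi>|lborel. LINT x|lborel. ?K \<xi> x)" .
  moreover have "(LINT x|lborel. LINT \<xi>|lborel. ?K \<xi> x) = (LINT x|lborel. fourier_inversion g x * \<phi> x)"
    by (simp add: fourier_inversion_def)
  ultimately have "(LINT x|lborel. fourier_inversion g x * \<phi> x) = (LINT \<xi>|lborel. LINT x|lborel. ?K \<xi> x)" by simp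
  also have "(LINT \<xi>|lborel. LINT x|lborel. ?K \<xi> x) = (LINT \<xi>|lborel. Re (g \<xi> * inv_fourier \<phi> \<xi>))"
    by (simp only: pointwise)
  also have "(LINT \<xi>|lborel. Re (g \<xi> * inv_fourier \<phi> \<xi>)) = Re (LINT \<xi>|lborel. g \<xi> * inv_fourier \<phi> \<xi>)"
    by (rule integral_Re) (rule integrable_mult_inv_fourier[OF assms])
  finally show ?thesis .
qed

lemma L2_function_times_test:
  assumes f: "L2_function f" and \<phi>: "test_function \<phi>"
  shows "integrable lborel (\<lambda>x. f x * \<phi> x)"
proof (rule Bochner_Integration.integrable_bound)
  have "test_function (\<lambda>x. \<phi> x * \<phi> x)" by (rule test_function_mult[OF \<phi>]) (rule test_function_Ck[OF \<phi>])
  then show "integrable lborel (\<lambda>x. (f x)\<^sup>2 + \<phi> x * \<phi> x)"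
    using f test_function_integrable(1) unfolding L2_function_def
    by (intro Bochner_Integration.integrable_add) blast+
  have "\<phi> \<in> borel_measurable borel"
    using test_function_integrable(2)[OF \<phi>] by (rule borel_measurable_continuous_onI)
  moreover have "f \<in> borel_measurable borel" using f by (simp add: L2_function_def)
  ultimately show "(\<lambda>x. f x * \<phi> x) \<in> borel_measurable lborel" by measurable
  have "\<bar>a * b\<bar> \<le> \<bar>a\<^sup>2 + b * b\<bar>" for a b :: real
    using sum_squares_bound[of a b] sum_squares_bound[of a "-b"] by (simp add: power2_eq_square abs_le_iff)
  then show "AE x in lborel. norm (f x * \<phi> x) \<le> norm ((f x)\<^sup>2 + \<phi> x * \<phi> x)" by simp
qed

lemma sobolev_transform_imp_AE_eq:
  fixes f :: "real^'n::finite \<Rightarrow> real"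
  assumes n: "CARD('n) \<le> 2" and m: "m > 2" and f: "L2_function f" and g: "sobolev_transform m f g"
  shows "AE x in lborel. f x = fourier_inversion g x"
proof -
  have mg: "g \<in> borel_measurable lborel" and ig: "integrable lborel (\<lambda>\<xi>. (1 + (norm \<xi>)\<^sup>2) powr m * (cmod (g \<xi>))\<^sup>2)"
    using g by (auto simp: sobolev_transform_def)
  note C = fourier_inversion_C1[OF mg weighted_L1_bound(1)[OF n m mg ig]]
  let ?F = "fourier_inversion g"
  have mf: "f \<in> borel_measurable borel" using f by (simp add: L2_function_def)
  have mF: "?F \<in> borel_measurable borel" by (intro borel_measurable_continuous_onI C1_gradD(3)[OF C(1)])
  have "AE x in lborel. f x - ?F x = 0"
  proof (rule weakly_zero_imp_AE_zero)
    fix a b :: "real^'n"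
    have ib: "integrable lborel (indicat_real (box a b))"
      by (rule integrable_real_indicator[OF _ emeasure_lborel_box_finite]) simp
    have "integrable lborel (\<lambda>x. indicator (box a b) x *\<^sub>R f x)"
    proof (rule Bochner_Integration.integrable_bound)
      show "integrable lborel (\<lambda>x. indicat_real (box a b) x + (f x)\<^sup>2)"
        using ib f by (auto simp: L2_function_def)
      have "\<bar>y\<bar> \<le> 1 + y\<^sup>2" for y :: real
        using sum_squares_bound[of 1 "\<bar>y\<bar>"] by simp
      then show "AE x in lborel. norm (indicator (box a b) x *\<^sub>R f x) \<le> norm (indicat_real (box a b) x + (f x)\<^sup>2)"
        by (intro AE_I2) (auto simp: indicator_def)
    qed (use mf in auto)
    moreover have "integrable lborel (\<lambda>x. indicator (box a b) x *\<^sub>R ?F x)"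
    proof (rule Bochner_Integration.integrable_bound)
      let ?N = "LINT \<xi>|lborel. (1 + norm \<xi>) * cmod (g \<xi>)"
      show "integrable lborel (\<lambda>x. ?N * indicat_real (box a b) x)" using ib by simp
      show "AE x in lborel. norm (indicator (box a b) x *\<^sub>R ?F x) \<le> norm (?N * indicat_real (box a b) x)"
        using C(2) by (intro AE_I2) (auto simp: indicator_def intro: order_trans[OF _ abs_ge_self])
    qed (use mF in auto)
    ultimately show "integrable lborel (\<lambda>x. indicator (box a b) x *\<^sub>R (f x - ?F x))"
      by (simp add: right_diff_distrib)
  next
    fix \<phi> :: "real^'n \<Rightarrow> real" assume \<phi>: "test_function \<phi>"
    obtain B where B: "\<And>x. norm x > B \<Longrightarrow> \<phi> x = 0" by (rule test_function_vanishes[OF \<phi>]) auto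
    have "integrable lborel (\<lambda>x. ?F x * \<phi> x)"
      by (rule integrable_compact_support(1)[where B = B])
         (auto intro!: continuous_on_mult C1_gradD(3)[OF C(1)] test_function_integrable(2)[OF \<phi>] simp: B)
    moreover have "(LINT x|lborel. f x * \<phi> x) = Re (LINT \<xi>|lborel. g \<xi> * inv_fourier \<phi> \<xi>)"
      using g \<phi> unfolding sobolev_transform_def by (metis Re_complex_of_real)
    ultimately show "(LINT x|lborel. (f x - ?F x) * \<phi> x) = 0"
      using L2_function_times_test[OF f \<phi>] fourier_inversion_duality[OF mg C(4) \<phi>]
      by (simp add: left_diff_distrib)
  qed
  then show ?thesis by simp
qed

text \<open>
  Differences and difference quotients of a curve in \<open>H\<^sup>m\<close> stay in
  \<open>H\<^sup>m\<close>, which makes the norms in the definition of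
  \<^const>\<open>C1_sobolev\<close> meaningful.
\<close>

lemma sobolev_linear:
  fixes f1 f2 :: "real^'n::finite \<Rightarrow> real"
  assumes n: "CARD('n) \<le> 2" and m: "m > 2" and f1: "sobolev m f1" and f2: "sobolev m f2"
  shows "sobolev m (\<lambda>x. a * f1 x + b * f2 x)"
proof -
  have sq: "(x + y)\<^sup>2 \<le> 2 * x\<^sup>2 + 2 * y\<^sup>2" for x y :: real
    using sum_squares_bound[of x y] by (simp add: power2_sum)
  have L2: "L2_function f1" "L2_function f2" using f1 f2 by (auto simp: sobolev_def)
  then have mf[measurable]: "f1 \<in> borel_measurable borel" "f2 \<in> borel_measurable borel"
    and if12: "integrable lborel (\<lambda>x. (f1 x)\<^sup>2)" "integrable lborel (\<lambda>x. (f2 x)\<^sup>2)"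
    by (auto simp: L2_function_def)
  have "integrable lborel (\<lambda>x. (a * f1 x + b * f2 x)\<^sup>2)"
  proof (rule Bochner_Integration.integrable_bound)
    show "integrable lborel (\<lambda>x. 2 * (a\<^sup>2 * (f1 x)\<^sup>2) + 2 * (b\<^sup>2 * (f2 x)\<^sup>2))" using if12 by simp
    show "AE x in lborel. norm ((a * f1 x + b * f2 x)\<^sup>2) \<le> norm (2 * (a\<^sup>2 * (f1 x)\<^sup>2) + 2 * (b\<^sup>2 * (f2 x)\<^sup>2))"
      using sq by (intro AE_I2) (simp add: power_mult_distrib[symmetric])
  qed measurable
  then have "L2_function (\<lambda>x. a * f1 x + b * f2 x)" by (auto simp: L2_function_def)
  moreover
  obtain g1 g2 where g: "sobolev_transform m f1 g1" "sobolev_transform m f2 g2"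
    using f1 f2 by (auto simp: sobolev_def)
  then have mg[measurable]: "g1 \<in> borel_measurable lborel" "g2 \<in> borel_measurable lborel"
    and ig: "integrable lborel (\<lambda>\<xi>. (1 + (norm \<xi>)\<^sup>2) powr m * (cmod (g1 \<xi>))\<^sup>2)"
      "integrable lborel (\<lambda>\<xi>. (1 + (norm \<xi>)\<^sup>2) powr m * (cmod (g2 \<xi>))\<^sup>2)"
    by (auto simp: sobolev_transform_def)
  note L1 = fourier_inversion_C1(4)[OF mg(1) weighted_L1_bound(1)[OF n m mg(1) ig(1)]]
    fourier_inversion_C1(4)[OF mg(2) weighted_L1_bound(1)[OF n m mg(2) ig(2)]]
  let ?g = "\<lambda>\<xi>. of_real a * g1 \<xi> + of_real b * g2 \<xi>"
  have "sobolev_transform m (\<lambda>x. a * f1 x + b * f2 x) ?g"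
    unfolding sobolev_transform_def
  proof (intro conjI allI impI)
    show "?g \<in> borel_measurable lborel" by measurable
    show "integrable lborel (\<lambda>\<xi>. (1 + (norm \<xi>)\<^sup>2) powr m * (cmod (?g \<xi>))\<^sup>2)"
    proof (rule Bochner_Integration.integrable_bound)
      show "integrable lborel (\<lambda>\<xi>. 2 * a\<^sup>2 * ((1 + (norm \<xi>)\<^sup>2) powr m * (cmod (g1 \<xi>))\<^sup>2)
          + 2 * b\<^sup>2 * ((1 + (norm \<xi>)\<^sup>2) powr m * (cmod (g2 \<xi>))\<^sup>2))" using ig by simp
      have "(cmod (?g \<xi>))\<^sup>2 \<le> 2 * a\<^sup>2 * (cmod (g1 \<xi>))\<^sup>2 + 2 * b\<^sup>2 * (cmod (g2 \<xi>))\<^sup>2" for \<xi>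
      proof -
        have "cmod (?g \<xi>) \<le> \<bar>a\<bar> * cmod (g1 \<xi>) + \<bar>b\<bar> * cmod (g2 \<xi>)"
          using norm_triangle_ineq[of "of_real a * g1 \<xi>" "of_real b * g2 \<xi>"] by (simp add: norm_mult)
        then have "(cmod (?g \<xi>))\<^sup>2 \<le> (\<bar>a\<bar> * cmod (g1 \<xi>) + \<bar>b\<bar> * cmod (g2 \<xi>))\<^sup>2"
          by (intro power_mono) auto
        also have "\<dots> \<le> 2 * (\<bar>a\<bar> * cmod (g1 \<xi>))\<^sup>2 + 2 * (\<bar>b\<bar> * cmod (g2 \<xi>))\<^sup>2" by (rule sq)
        finally show ?thesis by (simp add: power_mult_distrib)
      qed
      then have "(1 + (norm \<xi>)\<^sup>2) powr m * (cmod (?g \<xi>))\<^sup>2 \<le>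
        2 * a\<^sup>2 * ((1 + (norm \<xi>)\<^sup>2) powr m * (cmod (g1 \<xi>))\<^sup>2) + 2 * b\<^sup>2 * ((1 + (norm \<xi>)\<^sup>2) powr m * (cmod (g2 \<xi>))\<^sup>2)" for \<xi>
        using mult_left_mono[of "(cmod (?g \<xi>))\<^sup>2" "2 * a\<^sup>2 * (cmod (g1 \<xi>))\<^sup>2 + 2 * b\<^sup>2 * (cmod (g2 \<xi>))\<^sup>2" "(1 + (norm \<xi>)\<^sup>2) powr m"]
        by (simp add: algebra_simps)
      then show "AE \<xi> in lborel. norm ((1 + (norm \<xi>)\<^sup>2) powr m * (cmod (?g \<xi>))\<^sup>2)
        \<le> norm (2 * a\<^sup>2 * ((1 + (norm \<xi>)\<^sup>2) powr m * (cmod (g1 \<xi>))\<^sup>2) + 2 * b\<^sup>2 * ((1 + (norm \<xi>)\<^sup>2) powr m * (cmod (g2 \<xi>))\<^sup>2))"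
        by (intro AE_I2) simp
    qed measurable
    fix \<phi> :: "real^'n \<Rightarrow> real" assume \<phi>: "test_function \<phi>"
    have "(LINT x|lborel. (a * f1 x + b * f2 x) * \<phi> x) = a * (LINT x|lborel. f1 x * \<phi> x) + b * (LINT x|lborel. f2 x * \<phi> x)"
      using L2_function_times_test[OF L2(1) \<phi>] L2_function_times_test[OF L2(2) \<phi>]
      by (simp add: distrib_right mult.assoc)
    moreover have "(LINT \<xi>|lborel. ?g \<xi> * inv_fourier \<phi> \<xi>)
        = of_real a * (LINT \<xi>|lborel. g1 \<xi> * inv_fourier \<phi> \<xi>) + of_real b * (LINT \<xi>|lborel. g2 \<xi> * inv_fourier \<phi> \<xi>)"
      using integrable_mult_inv_fourier[OF mg(1) L1(1) \<phi>] integrable_mult_inv_fourier[OF mg(2) L1(2) \<phi>]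
      by (simp add: distrib_right mult.assoc)
    ultimately show "of_real (LINT x|lborel. (a * f1 x + b * f2 x) * \<phi> x) = (LINT \<xi>|lborel. ?g \<xi> * inv_fourier \<phi> \<xi>)"
      using g \<phi> unfolding sobolev_transform_def by simp
  qed
  ultimately show ?thesis by (auto simp: sobolev_def)
qed

text \<open>
  The bound is stated with the Sobolev norm because convergence in \<open>H\<^sup>m\<close> has to
  be turned into uniform convergence of functions and gradients.
\<close>

theorem sobolev_embedding_C1:
  assumes n: "CARD('n::finite) \<le> 2" and m: "m > 2"
  shows "\<exists>C>0. \<forall>f :: real^'n \<Rightarrow> real. sobolev m f \<longrightarrow>
    (\<exists>F G. C1_grad F G \<and> (AE x in lborel. f x = F x) \<and>
      (\<forall>x. \<bar>F x\<bar> \<le> C * sobolev_norm m f \<and> norm (G x) \<le> C * sobolev_norm m f))"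
proof (rule exI, intro conjI allI impI)
  let ?W = "LINT \<xi>::real^'n|lborel. (1 + (norm \<xi>)\<^sup>2) powr (1 - m)"
  have "?W \<ge> 0" by (intro integral_nonneg_AE AE_I2) simp
  then show "1 + ?W > 0" by linarith
  fix f :: "real^'n \<Rightarrow> real" assume f: "sobolev m f"
  define g where "g = (SOME g. sobolev_transform m f g)"
  have "\<exists>g. sobolev_transform m f g" using f by (simp add: sobolev_def)
  then have g: "sobolev_transform m f g" unfolding g_def by (rule someI_ex)
  have N: "sobolev_norm m f = sqrt (LINT \<xi>|lborel. (1 + (norm \<xi>)\<^sup>2) powr m * (cmod (g \<xi>))\<^sup>2)"
    by (simp add: sobolev_norm_def g_def)
  have mg: "g \<in> borel_measurable lborel" and ig: "integrable lborel (\<lambda>\<xi>. (1 + (norm \<xi>)\<^sup>2) powr m * (cmod (g \<xi>))\<^sup>2)"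
    using g by (auto simp: sobolev_transform_def)
  note w = weighted_L1_bound[OF n m mg ig]
  note C = fourier_inversion_C1[OF mg w(1)]
  have f2: "L2_function f" using f by (simp add: sobolev_def)
  show "\<exists>F G. C1_grad F G \<and> (AE x in lborel. f x = F x) \<and>
      (\<forall>x. \<bar>F x\<bar> \<le> (1 + ?W) * sobolev_norm m f \<and> norm (G x) \<le> (1 + ?W) * sobolev_norm m f)"
    unfolding N
    using C(1) sobolev_transform_imp_AE_eq[OF n m f2 g] order_trans[OF C(2) w(2)] order_trans[OF C(3) w(2)]
    by blast
qed

section \<open>Classical regularity in space and time\<close>

text \<open>
  The classical content of \<open>F \<in> C\<^sup>1([0,T], H\<^sup>m)\<close>: \<open>DF\<close>
  is the spatial gradient and \<open>F'\<close> the time derivative, one-sided at \<open>0\<close>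
  and \<open>T\<close>; everything is jointly continuous, and \<open>F\<close> and
  \<open>DF\<close> are bounded.
\<close>

definition classical_field ::
  "real \<Rightarrow> (real \<Rightarrow> real^'n::finite \<Rightarrow> real) \<Rightarrow> (real \<Rightarrow> real^'n \<Rightarrow> real^'n) \<Rightarrow> (real \<Rightarrow> real^'n \<Rightarrow> real) \<Rightarrow> bool"
where
  "classical_field T F DF F' \<longleftrightarrow>
     (\<forall>t\<in>{0..T}. C1_grad (F t) (DF t)) \<and>
     (\<forall>t\<in>{0..T}. \<forall>x. ((\<lambda>s. F s x) has_real_derivative F' t x) (at t within {0..T})) \<and>
     continuous_on ({0..T} \<times> UNIV) (\<lambda>(t, x). F t x) \<and>
     continuous_on ({0..T} \<times> UNIV) (\<lambda>(t, x). DF t x) \<and>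
     continuous_on ({0..T} \<times> UNIV) (\<lambda>(t, x). F' t x) \<and>
     (\<exists>K. \<forall>t\<in>{0..T}. \<forall>x. \<bar>F t x\<bar> \<le> K \<and> norm (DF t x) \<le> K)"

text \<open>
  Continuity in time is uniform in space, so it combines with continuity in space.
\<close>

lemma jointly_continuous_if_uniform:
  fixes A :: "real \<Rightarrow> 'a::metric_space \<Rightarrow> 'b::real_normed_vector"
  assumes cont: "\<And>t. t \<in> S \<Longrightarrow> continuous_on UNIV (A t)"
    and lim: "\<And>t. t \<in> S \<Longrightarrow> ((N t) \<longlongrightarrow> 0) (at t within S)"
    and bound: "\<And>s t x. s \<in> S \<Longrightarrow> t \<in> S \<Longrightarrow> s \<noteq> t \<Longrightarrow> norm (A s x - A t x) \<le> (N t s :: real)"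
  shows "continuous_on (S \<times> UNIV) (\<lambda>(t, x). A t x)"
  unfolding continuous_on_iff
proof safe
  fix t :: real and x :: 'a and e :: real assume t: "t \<in> S" and e: "e > 0"
  have "eventually (\<lambda>s. dist (N t s) 0 < e / 2) (at t within S)"
    using lim[OF t] e by (intro tendstoD) auto
  then obtain d1 where d1: "d1 > 0" "\<And>s. s \<in> S \<Longrightarrow> s \<noteq> t \<Longrightarrow> dist s t < d1 \<Longrightarrow> \<bar>N t s\<bar> < e / 2"
    unfolding eventually_at by (auto simp: dist_real_def)
  obtain d2 where d2: "d2 > 0" "\<And>y. dist y x < d2 \<Longrightarrow> dist (A t y) (A t x) < e / 2"
  proof -
    have "e / 2 > 0" using e by simp
    then show ?thesis using cont[OF t] that unfolding continuous_on_iff by blast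
  qed
  have "dist (A s y) (A t x) < e" if "s \<in> S" "dist (s, y) (t, x) < min d1 d2" for s y
  proof -
    have "dist s t < d1" "dist y x < d2"
      using that dist_fst_le[of "(s, y)" "(t, x)"] dist_snd_le[of "(s, y)" "(t, x)"] by auto
    moreover have "norm (A s y - A t y) < e / 2"
    proof (cases "s = t")
      case False
      have "\<bar>N t s\<bar> < e / 2" using d1(2)[OF that(1) False] \<open>dist s t < d1\<close> by blast
      then show ?thesis using bound[OF that(1) t False, of y] by linarith
    qed (use e in simp)
    ultimately show ?thesis
      using d2(2)[of y] dist_triangle[of "A s y" "A t x" "A t y"] by (simp add: dist_norm)
  qed
  then show "\<exists>d>0. \<forall>x'\<in>S \<times> UNIV. dist x' (t, x) < d \<longrightarrow>
      dist (case x' of (t, x) \<Rightarrow> A t x) (A t x) < e"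
    using d1(1) d2(1) by (intro exI[of _ "min d1 d2"]) auto
qed

text \<open>
  Each time has a neighbourhood on which the bound grows by at most one; compactness of the
  interval does the rest.
\<close>

lemma uniformly_bounded_on_interval:
  fixes A :: "real \<Rightarrow> 'a \<Rightarrow> 'b::real_normed_vector"
  assumes ab: "a \<le> b"
    and bdd: "\<And>t. t \<in> {a..b} \<Longrightarrow> \<exists>K. \<forall>x. norm (A t x) \<le> K"
    and lim: "\<And>t. t \<in> {a..b} \<Longrightarrow> ((N t) \<longlongrightarrow> 0) (at t within {a..b})"
    and bound: "\<And>s t x. s \<in> {a..b} \<Longrightarrow> t \<in> {a..b} \<Longrightarrow> s \<noteq> t \<Longrightarrow> norm (A s x - A t x) \<le> (N t s :: real)"
  shows "\<exists>K. \<forall>t\<in>{a..b}. \<forall>x. norm (A t x) \<le> K"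
proof -
  have "\<exists>K. \<forall>t\<in>{a..b} \<inter> {a..b}. \<forall>x. norm (A t x) \<le> K"
  proof (rule Bolzano[OF ab, where P = "\<lambda>c d. \<exists>K. \<forall>t\<in>{c..d} \<inter> {a..b}. \<forall>x. norm (A t x) \<le> K"])
    fix p q r
    assume "\<exists>K. \<forall>t\<in>{p..q} \<inter> {a..b}. \<forall>x. norm (A t x) \<le> K" "\<exists>K. \<forall>t\<in>{q..r} \<inter> {a..b}. \<forall>x. norm (A t x) \<le> K"
    then obtain K L where "\<forall>t\<in>{p..q} \<inter> {a..b}. \<forall>x. norm (A t x) \<le> K" "\<forall>t\<in>{q..r} \<inter> {a..b}. \<forall>x. norm (A t x) \<le> L"
      by blast
    then have "\<forall>t\<in>{p..r} \<inter> {a..b}. \<forall>x. norm (A t x) \<le> max K L"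
      by (auto simp: le_max_iff_disj Ball_def) (use linear in blast)
    then show "\<exists>K. \<forall>t\<in>{p..r} \<inter> {a..b}. \<forall>x. norm (A t x) \<le> K" by blast
  next
    fix t assume "a \<le> t" "t \<le> b"
    then have t: "t \<in> {a..b}" by simp
    obtain K where K: "\<And>x. norm (A t x) \<le> K" using bdd[OF t] by blast
    have "eventually (\<lambda>s. dist (N t s) 0 < 1) (at t within {a..b})"
      using lim[OF t] by (intro tendstoD) auto
    then obtain d where d: "d > 0" "\<And>s. s \<in> {a..b} \<Longrightarrow> s \<noteq> t \<Longrightarrow> dist s t < d \<Longrightarrow> \<bar>N t s\<bar> < 1"
      unfolding eventually_at by (auto simp: dist_real_def)
    have "norm (A s x) \<le> K + 1" if "s \<in> {a..b}" "dist s t < d" for s x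
    proof (cases "s = t")
      case True then show ?thesis using K[of x] by simp
    next
      case False
      have "\<bar>N t s\<bar> < 1" using d(2)[OF that(1) False that(2)] .
      then have "norm (A s x - A t x) \<le> 1" using bound[OF that(1) t False, of x] by linarith
      then show ?thesis using K[of x] norm_triangle_sub[of "A s x" "A t x"] by linarith
    qed
    then have "\<forall>p q. p \<le> t \<and> t \<le> q \<and> q - p < d \<longrightarrow> (\<exists>K. \<forall>s\<in>{p..q} \<inter> {a..b}. \<forall>x. norm (A s x) \<le> K)"
      by (intro allI impI exI[of _ "K + 1"]) (auto simp: dist_real_def abs_less_iff)
    then show "\<exists>d>0. \<forall>p q. p \<le> t \<and> t \<le> q \<and> q - p < d \<longrightarrow> (\<exists>K. \<forall>s\<in>{p..q} \<inter> {a..b}. \<forall>x. norm (A s x) \<le> K)"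
      using d(1) by blast
  qed
  then show ?thesis by simp
qed

lemma choose2:
  assumes "\<forall>t\<in>S. \<exists>x y. P t x y"
  obtains f g where "\<And>t. t \<in> S \<Longrightarrow> P t (f t) (g t)"
proof -
  have "\<exists>f. \<forall>t\<in>S. \<exists>y. P t (f t) y" using assms by (rule bchoice)
  then obtain f where "\<forall>t\<in>S. \<exists>y. P t (f t) y" ..
  then have "\<exists>g. \<forall>t\<in>S. P t (f t) (g t)" by (rule bchoice)
  then show ?thesis using that by blast
qed

text \<open>
  The embedding is applied to \<open>f t\<close>, to the time derivative, and to the errors of the
  difference quotients. A continuous representative is unique, so the representative of a linear
  combination is the combination of the representatives; the embedding constants thus bound the
  errors uniformly in space.
\<close>

theorem C1_sobolev_imp_classical_field:
  fixes f :: "real \<Rightarrow> real^'n::finite \<Rightarrow> real"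
  assumes n: "CARD('n) \<le> 2" and m: "m > 2" and T: "T > 0" and f: "C1_sobolev m T f"
  shows "\<exists>F DF F'. classical_field T F DF F' \<and> (\<forall>t\<in>{0..T}. AE x in lborel. f t x = F t x)"
proof -
  let ?S = "{0..T}"
  obtain C where C: "C > 0" "\<And>f :: real^'n \<Rightarrow> real. sobolev m f \<Longrightarrow>
    (\<exists>F G. C1_grad F G \<and> (AE x in lborel. f x = F x) \<and>
      (\<forall>x. \<bar>F x\<bar> \<le> C * sobolev_norm m f \<and> norm (G x) \<le> C * sobolev_norm m f))"
    using sobolev_embedding_C1[OF n m] by blast
  obtain f' where f': "\<And>t. t \<in> ?S \<Longrightarrow> sobolev m (f t)" "\<And>t. t \<in> ?S \<Longrightarrow> sobolev m (f' t)"
    "\<And>t. t \<in> ?S \<Longrightarrow> ((\<lambda>s. sobolev_norm m (\<lambda>x. (f s x - f t x) / (s - t) - f' t x)) \<longlongrightarrow> 0) (at t within ?S)"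
    "\<And>t. t \<in> ?S \<Longrightarrow> ((\<lambda>s. sobolev_norm m (\<lambda>x. f' s x - f' t x)) \<longlongrightarrow> 0) (at t within ?S)"
    using f unfolding C1_sobolev_def by blast
  have "\<forall>t\<in>?S. \<exists>F G. C1_grad F G \<and> (AE x in lborel. f t x = F x) \<and>
      (\<forall>x. \<bar>F x\<bar> \<le> C * sobolev_norm m (f t) \<and> norm (G x) \<le> C * sobolev_norm m (f t))"
    using C(2) f'(1) by blast
  then obtain F DF where F: "\<And>t. t \<in> ?S \<Longrightarrow> C1_grad (F t) (DF t)" "\<And>t. t \<in> ?S \<Longrightarrow> AE x in lborel. f t x = F t x"
    "\<And>t x. t \<in> ?S \<Longrightarrow> \<bar>F t x\<bar> \<le> C * sobolev_norm m (f t)" "\<And>t x. t \<in> ?S \<Longrightarrow> norm (DF t x) \<le> C * sobolev_norm m (f t)"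
    by (rule choose2) blast
  have "\<forall>t\<in>?S. \<exists>F G. C1_grad F G \<and> (AE x in lborel. f' t x = F x) \<and>
      (\<forall>x. \<bar>F x\<bar> \<le> C * sobolev_norm m (f' t) \<and> norm (G x) \<le> C * sobolev_norm m (f' t))"
    using C(2) f'(2) by blast
  then obtain F' DF' where F': "\<And>t. t \<in> ?S \<Longrightarrow> C1_grad (F' t) (DF' t)" "\<And>t. t \<in> ?S \<Longrightarrow> AE x in lborel. f' t x = F' t x"
    "\<And>t x. t \<in> ?S \<Longrightarrow> \<bar>F' t x\<bar> \<le> C * sobolev_norm m (f' t)" "\<And>t x. t \<in> ?S \<Longrightarrow> norm (DF' t x) \<le> C * sobolev_norm m (f' t)"
    by (rule choose2) blast
  define N where "N t s = C * sobolev_norm m (\<lambda>x. (f s x - f t x) / (s - t) - f' t x)" for t s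
  define N' where "N' t s = C * sobolev_norm m (\<lambda>x. f' s x - f' t x)" for t s
  have N: "((N t) \<longlongrightarrow> 0) (at t within ?S)" and N': "((N' t) \<longlongrightarrow> 0) (at t within ?S)" if "t \<in> ?S" for t
    unfolding N_def N'_def using tendsto_mult_right_zero[OF f'(3)[OF that]] tendsto_mult_right_zero[OF f'(4)[OF that]]
    by blast+
  have q: "\<bar>(F s x - F t x) / (s - t) - F' t x\<bar> \<le> N t s"
      "norm ((1 / (s - t)) *\<^sub>R (DF s x - DF t x) - DF' t x) \<le> N t s"
    if s: "s \<in> ?S" and t: "t \<in> ?S" and "s \<noteq> t" for s t x
  proof -
    let ?h = "\<lambda>x. (f s x - f t x) / (s - t) - f' t x"
    have "sobolev m (\<lambda>x. 1 * (1 / (s - t) * f s x + (- 1 / (s - t)) * f t x) + (- 1) * f' t x)"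
      by (intro sobolev_linear[OF n m] f'(1,2) s t)
    moreover have "(\<lambda>x. 1 * (1 / (s - t) * f s x + (- 1 / (s - t)) * f t x) + (- 1) * f' t x) = ?h"
      by (auto simp: diff_divide_distrib)
    ultimately have "sobolev m ?h" by simp
    then obtain H DH where H: "C1_grad H DH" "AE x in lborel. ?h x = H x"
      "\<And>x. \<bar>H x\<bar> \<le> N t s" "\<And>x. norm (DH x) \<le> N t s"
      using C(2)[of ?h] unfolding N_def by blast
    let ?H = "\<lambda>x. 1 / (s - t) * (F s x - F t x) - F' t x"
    have G: "C1_grad ?H (\<lambda>x. (1 / (s - t)) *\<^sub>R (DF s x - DF t x) - DF' t x)"
      by (intro C1_grad_diff C1_grad_cmult F(1) F'(1) s t)
    have "AE x in lborel. H x = ?H x"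
      using H(2) F(2)[OF s] F(2)[OF t] F'(2)[OF t] by eventually_elim simp
    then have eq: "H = ?H"
      by (rule AE_eq_continuous[OF _ C1_gradD(3)[OF H(1)] C1_gradD(3)[OF G]])
    then show "\<bar>(F s x - F t x) / (s - t) - F' t x\<bar> \<le> N t s" using H(3)[of x] by simp
    have "DH = (\<lambda>x. (1 / (s - t)) *\<^sub>R (DF s x - DF t x) - DF' t x)"
      using C1_grad_unique[OF H(1)[unfolded eq] G] .
    then show "norm ((1 / (s - t)) *\<^sub>R (DF s x - DF t x) - DF' t x) \<le> N t s" using H(4)[of x] by simp
  qed
  have q': "norm (F' s x - F' t x) \<le> N' t s" if s: "s \<in> ?S" and t: "t \<in> ?S" and "s \<noteq> t" for s t x
  proof -
    let ?h = "\<lambda>x. f' s x - f' t x"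
    have "sobolev m (\<lambda>x. 1 * f' s x + (-1) * f' t x)" by (intro sobolev_linear[OF n m] f'(1,2) s t)
    then have "sobolev m ?h" by simp
    then obtain H DH where H: "C1_grad H DH" "AE x in lborel. ?h x = H x" "\<And>x. \<bar>H x\<bar> \<le> N' t s"
      using C(2)[of ?h] unfolding N'_def by blast
    have "AE x in lborel. H x = F' s x - F' t x"
      using H(2) F'(2)[OF s] F'(2)[OF t] by eventually_elim simp
    then have "H = (\<lambda>x. F' s x - F' t x)"
      by (rule AE_eq_continuous[OF _ C1_gradD(3)[OF H(1)]])
         (intro continuous_on_diff C1_gradD(3)[OF F'(1)] s t)
    then show ?thesis using H(3)[of x] by simp
  qed
  \<comment> \<open>The difference quotients are bounded near \<open>t\<close>, so increments are small of first order.\<close>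
  define M where "M t s = \<bar>s - t\<bar> * (N t s + C * sobolev_norm m (f' t))" for t s
  have M: "((M t) \<longlongrightarrow> 0) (at t within ?S)" if "t \<in> ?S" for t
  proof -
    have "((\<lambda>s. \<bar>s - t\<bar>) \<longlongrightarrow> 0) (at t within ?S)"
      by (rule tendsto_eq_intros | simp)+
    then have "(M t \<longlongrightarrow> 0 * (0 + C * sobolev_norm m (f' t))) (at t within ?S)"
      unfolding M_def by (intro tendsto_intros N[OF that])
    then show ?thesis by simp
  qed
  have bF: "norm (F s x - F t x) \<le> M t s" and bDF: "norm (DF s x - DF t x) \<le> M t s"
    if s: "s \<in> ?S" and t: "t \<in> ?S" and st: "s \<noteq> t" for s t x
  proof -
    have eq: "F s x - F t x = (s - t) * (((F s x - F t x) / (s - t) - F' t x) + F' t x)" using st by simp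
    have "norm (F s x - F t x) = \<bar>s - t\<bar> * \<bar>((F s x - F t x) / (s - t) - F' t x) + F' t x\<bar>"
      by (subst (1) eq) (simp only: real_norm_def abs_mult)
    also have "\<dots> \<le> M t s"
      unfolding M_def using q(1)[OF that, of x] F'(3)[OF t, of x] by (intro mult_left_mono abs_ge_zero) linarith
    finally show "norm (F s x - F t x) \<le> M t s" .
    have eq': "DF s x - DF t x = (s - t) *\<^sub>R (((1 / (s - t)) *\<^sub>R (DF s x - DF t x) - DF' t x) + DF' t x)" using st by simp
    have "norm (DF s x - DF t x) = \<bar>s - t\<bar> * norm (((1 / (s - t)) *\<^sub>R (DF s x - DF t x) - DF' t x) + DF' t x)"
      by (subst (1) eq') (simp only: norm_scaleR)
    also have "\<dots> \<le> M t s"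
      unfolding M_def using q(2)[OF that, of x] F'(4)[OF t, of x]
        norm_triangle_ineq[of "(1 / (s - t)) *\<^sub>R (DF s x - DF t x) - DF' t x" "DF' t x"]
      by (intro mult_left_mono) linarith+
    finally show "norm (DF s x - DF t x) \<le> M t s" .
  qed
  have c1: "continuous_on (?S \<times> UNIV) (\<lambda>(t, x). F t x)"
    by (rule jointly_continuous_if_uniform[OF C1_gradD(3)[OF F(1)] M bF])
  have c2: "continuous_on (?S \<times> UNIV) (\<lambda>(t, x). DF t x)"
    by (rule jointly_continuous_if_uniform[OF C1_gradD(2)[OF F(1)] M bDF])
  have c3: "continuous_on (?S \<times> UNIV) (\<lambda>(t, x). F' t x)"
    by (rule jointly_continuous_if_uniform[OF C1_gradD(3)[OF F'(1)] N' q'])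
  have "\<exists>K. \<forall>t\<in>?S. \<forall>x. norm (F t x) \<le> K"
    by (rule uniformly_bounded_on_interval[OF less_imp_le[OF T] _ M bF]) (use F(3) in auto)
  moreover have "\<exists>K. \<forall>t\<in>?S. \<forall>x. norm (DF t x) \<le> K"
    by (rule uniformly_bounded_on_interval[OF less_imp_le[OF T] _ M bDF]) (use F(4) in auto)
  ultimately obtain K L where KL: "\<forall>t\<in>?S. \<forall>x. norm (F t x) \<le> K" "\<forall>t\<in>?S. \<forall>x. norm (DF t x) \<le> L"
    by blast
  have d: "((\<lambda>s. F s x) has_real_derivative F' t x) (at t within ?S)" if t: "t \<in> ?S" for t x
  proof -
    have "((\<lambda>s. (F s x - F t x) / (s - t) - F' t x) \<longlongrightarrow> 0) (at t within ?S)"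
      by (rule Lim_null_comparison[OF _ N[OF t]])
         (use q(1)[OF _ t] in \<open>auto simp: eventually_at intro!: exI[of _ 1]\<close>)
    then show ?thesis by (simp add: has_field_derivative_iff LIM_zero_iff)
  qed
  have "\<exists>K. \<forall>t\<in>?S. \<forall>x. \<bar>F t x\<bar> \<le> K \<and> norm (DF t x) \<le> K"
    using KL by (intro exI[of _ "max K L"]) (auto simp: le_max_iff_disj)
  then have "classical_field T F DF F'"
    unfolding classical_field_def using c1 c2 c3 d F(1) by blast
  then show ?thesis using F(2) by blast
qed

section \<open>A maximum principle for the transport equation\<close>

text \<open>
  Multiply \<open>R\<close> by a weight \<open>q\<close> that is positive inside a ball around
  \<open>x0\<close> whose radius shrinks with speed \<open>V\<close>, and by \<open>exp (- (L + 1)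
  t)\<close>. As \<open>V\<close> dominates the speed of the flow, \<open>q\<close> does not
  increase along the flow, and the exponential dominates the divergence term. At a negative
  minimum over the space-time cone the spatial gradient vanishes, the time derivative is
  nonpositive, and the equation makes it positive.
\<close>

lemma transport_nonneg:
  fixes R :: "real \<Rightarrow> real^'n::finite \<Rightarrow> real"
  assumes time: "\<And>t x. t \<in> {0..T} \<Longrightarrow> ((\<lambda>s. R s x) has_real_derivative R' t x) (at t within {0..T})"
    and space: "\<And>t. t \<in> {0..T} \<Longrightarrow> C1_grad (R t) (DR t)"
    and cont: "continuous_on ({0..T} \<times> UNIV) (\<lambda>(t, x). R t x)"
    and eq: "\<And>t x. t \<in> {0..T} \<Longrightarrow> R' t x + DR t x \<bullet> U t x + R t x * D t x = 0"
    and D: "\<And>t x. t \<in> {0..T} \<Longrightarrow> \<bar>D t x\<bar> \<le> L"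
    and t12: "0 \<le> t1" "t1 \<le> t2" "t2 \<le> T" and \<eta>: "\<eta> > 0" and V: "V \<ge> 0"
    and speed: "\<And>t x. t1 \<le> t \<Longrightarrow> t \<le> t2 \<Longrightarrow> norm (x - x0) \<le> \<eta> + V * (t2 - t) \<Longrightarrow> norm (U t x) \<le> V"
    and init: "\<And>x. norm (x - x0) \<le> \<eta> + V * (t2 - t1) \<Longrightarrow> R t1 x \<ge> 0"
  shows "R t2 x0 \<ge> 0"
proof (rule ccontr)
  assume neg: "\<not> R t2 x0 \<ge> 0"
  define r where "r t = \<eta> + V * (t2 - t)" for t
  define q where "q t x = (r t)\<^sup>2 - (x - x0) \<bullet> (x - x0)" for t x
  define G where "G t x = exp (- (L + 1) * t) * (R t x * q t x)" for t x
  define K where "K = ({t1..t2} \<times> cball x0 (r t1)) \<inter> {p. norm (snd p - x0) \<le> r (fst p)}"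
  have r_pos: "r t > 0" if "t \<le> t2" for t using that \<eta> V by (simp add: r_def add_pos_nonneg)
  have r_mono: "r t \<le> r s" if "s \<le> t" for s t using that V by (simp add: r_def mult_left_mono)
  have KI: "(t, x) \<in> K" if "t1 \<le> t" "t \<le> t2" "norm (x - x0) \<le> r t" for t x
    using that r_mono[of t1 t] by (auto simp: K_def dist_norm norm_minus_commute)
  have q_pos: "q t x > 0 \<longleftrightarrow> norm (x - x0) < r t" if "t \<le> t2" for t x
  proof -
    have "q t x > 0 \<longleftrightarrow> (norm (x - x0))\<^sup>2 < (r t)\<^sup>2" by (simp add: q_def power2_norm_eq_inner)
    also have "\<dots> \<longleftrightarrow> norm (x - x0) < r t"
      using r_pos[OF that] by (metis norm_ge_zero power_mono_iff less_le_not_le linorder_not_le power_strict_mono zero_less_numeral)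
    finally show ?thesis .
  qed
  have "compact K"
    unfolding K_def r_def
    by (intro compact_Int_closed compact_Times compact_Icc compact_cball closed_Collect_le continuous_intros)
  moreover have "(t2, x0) \<in> K" using t12 \<eta> by (intro KI) (auto simp: r_def)
  moreover have "continuous_on K (\<lambda>p. G (fst p) (snd p))"
  proof -
    have "continuous_on K (\<lambda>p. R (fst p) (snd p))"
      using continuous_on_subset[OF cont, of K] t12 by (force simp: K_def case_prod_unfold)
    then show ?thesis unfolding G_def q_def r_def by (intro continuous_intros)
  qed
  ultimately obtain p where p: "p \<in> K" "\<And>p'. p' \<in> K \<Longrightarrow> G (fst p) (snd p) \<le> G (fst p') (snd p')"
    using continuous_attains_inf[of K "\<lambda>p. G (fst p) (snd p)"] by blast
  obtain t x where tx: "p = (t, x)" by (cases p)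
  have t: "t1 \<le> t" "t \<le> t2" "norm (x - x0) \<le> r t" using p(1) by (auto simp: K_def tx)
  have min: "G t x \<le> G s y" if "t1 \<le> s" "s \<le> t2" "norm (y - x0) \<le> r s" for s y
    using p(2)[OF KI[OF that]] by (simp add: tx)
  have "q t2 x0 > 0" by (subst q_pos) (use r_pos[of t2] in auto)
  then have "R t2 x0 * q t2 x0 < 0" using neg by (simp add: mult_neg_pos)
  then have "G t2 x0 < 0" unfolding G_def by (simp add: mult_pos_neg)
  moreover have "G t x \<le> G t2 x0" using t12 r_pos[of t2] by (intro min) auto
  ultimately have "exp (- (L + 1) * t) * (R t x * q t x) < 0" by (simp add: G_def)
  then have Rq: "R t x * q t x < 0" by (simp add: mult_less_0_iff)
  have "q t x \<ge> 0" using t(3) r_pos[OF t(2)] by (auto simp: q_def power2_norm_eq_inner[symmetric] intro: power_mono)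
  then have R: "R t x < 0" and q: "q t x > 0" using Rq by (auto simp: mult_less_0_iff)
  have x_int: "norm (x - x0) < r t" using q q_pos[OF t(2)] by blast
  have "t \<noteq> t1" using init[of x] t(3) R by (auto simp: r_def)
  then have t1: "t1 < t" using t by simp
  have tT: "t \<in> {0..T}" using t t12 by auto
  have "((\<lambda>y. G t y) has_derivative (\<lambda>h. exp (- (L + 1) * t) * (DR t x \<bullet> h * q t x - 2 * R t x * ((x - x0) \<bullet> h)))) (at x)"
    unfolding G_def q_def
    by (rule has_derivative_eq_rhs, (rule derivative_intros C1_gradD(1)[OF space[OF tT]])+)
       (auto simp: fun_eq_iff algebra_simps inner_commute)
  moreover have "open (ball x0 (r t))" "x \<in> ball x0 (r t)"
    using x_int by (auto simp: dist_norm norm_minus_commute)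
  moreover have "\<forall>y\<in>ball x0 (r t). G t x \<le> G t y"
    using t by (auto intro!: min simp: dist_norm norm_minus_commute)
  ultimately have "(\<lambda>h. exp (- (L + 1) * t) * (DR t x \<bullet> h * q t x - 2 * R t x * ((x - x0) \<bullet> h))) = (\<lambda>h. 0)"
    by (intro differential_zero_maxmin[of x "ball x0 (r t)"]) auto
  from fun_cong[OF this, of "U t x"]
  \<comment> \<open>The gradient vanishes at the minimum, in particular in the direction of the flow.\<close>
  have crit: "DR t x \<bullet> U t x * q t x = 2 * R t x * ((x - x0) \<bullet> U t x)" by simp
  define G' where "G' = exp (- (L + 1) * t) * (- (L + 1) * (R t x * q t x) + (R' t x * q t x - 2 * R t x * V * r t))"
  have "((\<lambda>s. R s x) has_real_derivative R' t x) (at t within {t1..t})"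
    by (rule DERIV_subset[OF time[OF tT]]) (use t t12 in auto)
  then have "((\<lambda>s. G s x) has_real_derivative G') (at t within {t1..t})"
    unfolding G_def q_def r_def G'_def
    by (auto intro!: derivative_eq_intros simp: algebra_simps power2_eq_square)
  then have lim: "((\<lambda>s. (G s x - G t x) / (s - t)) \<longlongrightarrow> G') (at_left t)"
    by (simp add: has_field_derivative_iff at_within_Icc_at_left[OF t1])
  have "eventually (\<lambda>s. (G s x - G t x) / (s - t) \<le> 0) (at_left t)"
  proof (rule eventually_mono[OF eventually_at_left_real[OF t1]])
    fix s assume s: "s \<in> {t1<..<t}"
    then have "G t x \<le> G s x" using t r_mono[of s t] by (intro min) auto
    then show "(G s x - G t x) / (s - t) \<le> 0" using s by (simp add: divide_nonneg_neg)
  qed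
  then have "G' \<le> 0" by (rule tendsto_upperbound[OF lim]) simp
  then have "- (L + 1) * (R t x * q t x) + (R' t x * q t x - 2 * R t x * V * r t) \<le> 0"
    by (simp add: G'_def mult_le_0_iff)
  moreover have "R' t x = - (DR t x \<bullet> U t x) - R t x * D t x" using eq[OF tT, of x] by linarith
  ultimately have "(- R t x) * ((L + 1 + D t x) * q t x + 2 * ((x - x0) \<bullet> U t x + V * r t)) \<le> 0"
    using crit by (simp add: algebra_simps)
  then have "(L + 1 + D t x) * q t x + 2 * ((x - x0) \<bullet> U t x + V * r t) \<le> 0"
    using R unfolding mult_le_0_iff by auto
  moreover have "(L + 1 + D t x) * q t x > 0"
    using D[OF tT, of x] q by (intro mult_pos_pos) auto
  moreover have "(x - x0) \<bullet> U t x + V * r t \<ge> 0"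
  proof -
    have "\<bar>(x - x0) \<bullet> U t x\<bar> \<le> norm (x - x0) * norm (U t x)" by (rule Cauchy_Schwarz_ineq2)
    also have "\<dots> \<le> r t * V"
      using t r_pos[OF t(2)] speed[OF t(1,2), of x] by (intro mult_mono) (auto simp: r_def)
    finally show ?thesis by (simp add: mult.commute)
  qed
  ultimately show False
    by (meson add_pos_nonneg mult_nonneg_nonneg not_le zero_le_numeral)
qed

text \<open>
  Apply the sign statement to \<open>R\<close> and to \<open>- R\<close>.
\<close>

lemma transport_zero:
  fixes R :: "real \<Rightarrow> real^'n::finite \<Rightarrow> real"
  assumes time: "\<And>t x. t \<in> {0..T} \<Longrightarrow> ((\<lambda>s. R s x) has_real_derivative R' t x) (at t within {0..T})"
    and space: "\<And>t. t \<in> {0..T} \<Longrightarrow> C1_grad (R t) (DR t)"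
    and cont: "continuous_on ({0..T} \<times> UNIV) (\<lambda>(t, x). R t x)"
    and eq: "\<And>t x. t \<in> {0..T} \<Longrightarrow> R' t x + DR t x \<bullet> U t x + R t x * D t x = 0"
    and D: "\<And>t x. t \<in> {0..T} \<Longrightarrow> \<bar>D t x\<bar> \<le> L"
    and t12: "0 \<le> t1" "t1 \<le> t2" "t2 \<le> T" and \<eta>: "\<eta> > 0" and V: "V \<ge> 0"
    and speed: "\<And>t x. t1 \<le> t \<Longrightarrow> t \<le> t2 \<Longrightarrow> norm (x - x0) \<le> \<eta> + V * (t2 - t) \<Longrightarrow> norm (U t x) \<le> V"
    and init: "\<And>x. norm (x - x0) \<le> \<eta> + V * (t2 - t1) \<Longrightarrow> R t1 x = 0"
  shows "R t2 x0 = 0"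
proof -
  have "R t2 x0 \<ge> 0"
    by (rule transport_nonneg[OF time space cont eq D t12 \<eta> V speed]) (simp_all add: init)
  moreover have "- R t2 x0 \<ge> 0"
  proof (rule transport_nonneg[where R = "\<lambda>t x. - R t x", OF _ _ _ _ D t12 \<eta> V speed])
    show "((\<lambda>s. - R s x) has_real_derivative - R' t x) (at t within {0..T})" if "t \<in> {0..T}" for t x
      using time[OF that] by (rule DERIV_minus)
    show "C1_grad (\<lambda>x. - R t x) (\<lambda>x. - DR t x)" if "t \<in> {0..T}" for t
      using C1_grad_cmult[OF space[OF that], of "-1"] by simp
    show "continuous_on ({0..T} \<times> UNIV) (\<lambda>(t, x). - R t x)"
      using continuous_on_minus[OF cont] by (simp add: case_prod_unfold)
    show "- R' t x + - DR t x \<bullet> U t x + - R t x * D t x = 0" if "t \<in> {0..T}" for t x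
      using eq[OF that, of x] by simp
  qed (simp_all add: init)
  ultimately show ?thesis by linarith
qed

section \<open>Behaviour near infinity and at the boundary of a ball\<close>

text \<open>
  The annulus of radii \<open>k\<close> and \<open>2 k\<close> contributes at least
  \<open>\<kappa> V / 2\<^sup>n\<close> to the integral, where \<open>V\<close> is the volume of
  the unit ball, whereas the integral over the exterior of the ball of radius \<open>k\<close>
  tends to zero.
\<close>

lemma not_integrable_inverse_power:
  fixes h :: "real^'n::finite \<Rightarrow> real"
  assumes h: "integrable lborel h" and nonneg: "\<And>x. h x \<ge> 0"
    and lower: "\<And>x. norm x \<ge> S \<Longrightarrow> h x \<ge> \<kappa> / norm x ^ CARD('n)" and \<kappa>: "\<kappa> > 0"
  shows False
proof -
  define n where "n = CARD('n)"
  define V where "V = unit_ball_vol (real n)"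
  have V: "V > 0" by (simp add: V_def)
  have n: "n \<ge> 1" by (simp add: n_def Suc_leI)
  have "(\<lambda>k. LINT x|lborel. indicator (- ball 0 (real k)) x * h x) \<longlonglongrightarrow> (LINT x::real^'n|lborel. (0::real))"
  proof (rule integral_dominated_convergence[where w = h and f = "\<lambda>x. 0" and s = "\<lambda>k x. indicator (- ball 0 (real k)) x * h x"])
    show "(\<lambda>x. indicator (- ball 0 (real k)) x * h x) \<in> borel_measurable lborel" for k
      using h by measurable
    show "AE x in lborel. (\<lambda>k. indicator (- ball 0 (real k)) x * h x) \<longlonglongrightarrow> 0"
    proof (rule AE_I2)
      fix x :: "real^'n"
      obtain N :: nat where N: "norm x < real N" using reals_Archimedean2 by blast
      have "eventually (\<lambda>k. 0 = indicator (- ball 0 (real k)) x * h x) sequentially"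
        using eventually_ge_at_top[of N] by eventually_elim (use N in auto)
      then show "(\<lambda>k. indicator (- ball 0 (real k)) x * h x) \<longlonglongrightarrow> 0"
        by (rule Lim_transform_eventually[OF tendsto_const])
    qed
    show "AE x in lborel. norm (indicator (- ball 0 (real k)) x * h x) \<le> h x" for k
      using nonneg by (intro AE_I2) (auto simp: indicator_def)
  qed (use h in auto)
  then have lim: "(\<lambda>k. LINT x|lborel. indicator (- ball 0 (real k)) x * h x) \<longlonglongrightarrow> 0" by simp
  have ge: "\<kappa> * V / 2 ^ n \<le> (LINT x|lborel. indicator (- ball 0 (real k)) x * h x)" if k: "real k \<ge> max S 1" for k
  proof -
    let ?c = "\<kappa> / (2 * real k) ^ n"
    let ?g = "\<lambda>x::real^'n. ?c * (indicator (ball 0 (2 * real k)) x - indicator (ball 0 (real k)) x)"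
    have kp: "real k > 0" using k by simp
    have ib: "integrable lborel (indicat_real (ball (0::real^'n) r))" for r
      by (rule integrable_real_indicator[OF _ emeasure_lborel_ball_finite]) simp
    have vol: "(LINT x|lborel. indicat_real (ball (0::real^'n) r) x) = V * r ^ n" if "r > 0" for r
      using that by (simp add: content_ball V_def n_def)
    have "(LINT x|lborel. ?g x) = ?c * (V * (2 * real k) ^ n - V * real k ^ n)"
      unfolding integral_mult_right_zero Bochner_Integration.integral_diff[OF ib ib] using kp by (simp only: vol)
    also have "\<dots> = \<kappa> * V * (2 ^ n - 1) / 2 ^ n"
      using kp by (simp add: power_mult_distrib field_simps)
    finally have eq: "(LINT x|lborel. ?g x) = \<kappa> * V * (2 ^ n - 1) / 2 ^ n" .
    have "(2::real) ^ 1 \<le> 2 ^ n" using n by (intro power_increasing) auto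
    then have "\<kappa> * V * 1 \<le> \<kappa> * V * (2 ^ n - 1)" using \<kappa> V by (intro mult_left_mono) auto
    then have "\<kappa> * V / 2 ^ n \<le> (LINT x|lborel. ?g x)" unfolding eq by (intro divide_right_mono) auto
    also have "\<dots> \<le> (LINT x|lborel. indicator (- ball 0 (real k)) x * h x)"
    proof (rule integral_mono)
      show "integrable lborel ?g" by (intro integrable_mult_right Bochner_Integration.integrable_diff ib)
      show "integrable lborel (\<lambda>x. indicator (- ball 0 (real k)) x * h x)"
        by (rule Bochner_Integration.integrable_bound[OF h]) (use h in \<open>auto simp: indicator_def\<close>)
      fix x :: "real^'n"
      show "?g x \<le> indicator (- ball 0 (real k)) x * h x"
      proof (cases "real k \<le> norm x \<and> norm x < 2 * real k")
        case True
        have "?c \<le> \<kappa> / norm x ^ n"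
          using True kp \<kappa> by (intro divide_left_mono power_mono mult_pos_pos zero_less_power) auto
        also have "\<dots> \<le> h x" using lower[of x] True k by (simp add: n_def)
        finally show ?thesis using True by (simp add: indicator_def)
      next
        case False
        then have eq0: "?g x = 0" using kp by (auto simp: indicator_def)
        show ?thesis unfolding eq0 by (intro mult_nonneg_nonneg nonneg) simp
      qed
    qed
    finally show ?thesis .
  qed
  have "eventually (\<lambda>k. \<kappa> * V / 2 ^ n \<le> (LINT x|lborel. indicator (- ball 0 (real k)) x * h x)) sequentially"
    using filterlim_real_sequentially[unfolded filterlim_at_top, rule_format, of "max S 1"]
    by (rule eventually_mono) (rule ge)
  then have "\<kappa> * V / 2 ^ n \<le> 0" by (rule tendsto_lowerbound[OF lim]) simp
  moreover have "\<kappa> * V / 2 ^ n > 0" using \<kappa> V by (intro divide_pos_pos mult_pos_pos) auto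
  ultimately show False by linarith
qed

lemma affine_power_bounded_below:
  fixes A B :: real
  assumes "n \<ge> 1" "\<not> (A = 0 \<and> B = 0)"
  obtains \<delta> S where "\<delta> > 0" "S \<ge> 1" "\<And>s. s \<ge> S \<Longrightarrow> \<bar>A + B * s ^ n\<bar> \<ge> \<delta>"
proof (cases "B = 0")
  case True
  then show ?thesis using assms that[of "\<bar>A\<bar>" 1] by simp
next
  case False
  define S where "S = max 1 ((\<bar>A\<bar> + 1) / \<bar>B\<bar>)"
  have "\<bar>A + B * s ^ n\<bar> \<ge> 1" if s: "s \<ge> S" for s
  proof -
    have "s ^ 1 \<le> s ^ n" using s assms(1) by (intro power_increasing) (auto simp: S_def)
    then have "(\<bar>A\<bar> + 1) / \<bar>B\<bar> \<le> s ^ n" using s by (simp add: S_def)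
    then have "\<bar>A\<bar> + 1 \<le> \<bar>B\<bar> * s ^ n" using False by (simp add: pos_divide_le_eq mult.commute)
    also have "\<dots> = \<bar>B * s ^ n\<bar>" using s by (simp add: abs_mult S_def)
    finally show ?thesis by linarith
  qed
  then show ?thesis using that[of 1 S] by (simp add: S_def)
qed

lemma zero_on_sphere_if_zero_outside:
  fixes f :: "real^'n::finite \<Rightarrow> 'b::real_normed_vector"
  assumes f: "continuous_on UNIV f" and zero: "\<And>x. norm x > r \<Longrightarrow> f x = 0" and r: "r > 0" and x: "norm x \<ge> r"
  shows "f x = 0"
proof -
  let ?y = "\<lambda>k. (1 + 1 / real (Suc k)) *\<^sub>R x"
  have "(\<lambda>k. 1 + 1 / real (Suc k)) \<longlonglongrightarrow> 1 + 0"
    by (intro tendsto_add tendsto_const LIMSEQ_inverse_real_of_nat[unfolded inverse_eq_divide])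
  then have "?y \<longlonglongrightarrow> 1 *\<^sub>R x" by (intro tendsto_scaleR tendsto_const) simp
  then have "(\<lambda>k. f (?y k)) \<longlonglongrightarrow> f (1 *\<^sub>R x)"
    by (rule continuous_on_tendsto_compose[OF f]) auto
  moreover have "f (?y k) = 0" for k
  proof (rule zero)
    have "norm x * 1 < norm x * (1 + 1 / real (Suc k))" using r x by (intro mult_strict_left_mono) auto
    then show "norm (?y k) > r" using x by (simp add: mult.commute)
  qed
  ultimately have "(\<lambda>k::nat. 0) \<longlonglongrightarrow> f x" by simp
  then show ?thesis using LIMSEQ_unique[OF tendsto_const, of 0 "f x"] by simp
qed

section \<open>Radial fields in the plane\<close>

text \<open>
  A linear map sends null sets to null sets.
\<close>

lemma AE_lborel_linear:
  fixes Q Q' :: "real^'n::finite \<Rightarrow> real^'n"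
  assumes P: "AE x in lborel. P x" and lin: "linear Q'" and inv: "\<And>x. Q' (Q x) = x"
  shows "AE x in lborel. P (Q x)"
proof -
  obtain N where N: "{x. \<not> P x} \<subseteq> N" "N \<in> null_sets lborel"
    using P by (auto elim!: AE_E simp: null_sets_def)
  then have "negligible N" using null_sets_completionI[OF N(2)] by (simp add: negligible_iff_null_sets)
  then have neg: "negligible (Q' ` N)"
    by (rule negligible_differentiable_image_negligible[OF order_refl])
       (rule linear_imp_differentiable_on[OF lin])
  have "{x. \<not> P (Q x)} \<subseteq> Q' ` N"
  proof
    fix x assume "x \<in> {x. \<not> P (Q x)}"
    then have "Q' (Q x) \<in> Q' ` N" using N(1) by blast
    then show "x \<in> Q' ` N" by (simp only: inv)
  qed
  then have "negligible {x. \<not> P (Q x)}" using neg negligible_subset by blast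
  then have "AE x in lebesgue. P (Q x)"
    by (intro AE_I'[of "{x. \<not> P (Q x)}"]) (auto simp: negligible_iff_null_sets)
  then show ?thesis by (simp add: AE_completion_iff)
qed

text \<open>
  Rotation of the plane spanned by the axes \<open>i\<close> and \<open>j\<close>, to be used when
  these are the only two indices: every index other than \<open>i\<close> is treated as
  \<open>j\<close>.
\<close>

definition rotate_plane :: "'n::finite \<Rightarrow> 'n \<Rightarrow> real \<Rightarrow> real^'n \<Rightarrow> real^'n" where
  "rotate_plane i j \<theta> x =
     (\<chi> k. if k = i then cos \<theta> * x $ i - sin \<theta> * x $ j else sin \<theta> * x $ i + cos \<theta> * x $ j)"

lemma norm_plane:
  fixes x :: "real^'n::finite"
  assumes "UNIV = {i, j}" "i \<noteq> j"
  shows "(norm x)\<^sup>2 = (x $ i)\<^sup>2 + (x $ j)\<^sup>2" "x \<bullet> y = x $ i * y $ i + x $ j * y $ j"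
proof -
  show *: "x \<bullet> y = x $ i * y $ i + x $ j * y $ j" for y
    unfolding inner_vec_def assms(1) using assms(2) by simp
  show "(norm x)\<^sup>2 = (x $ i)\<^sup>2 + (x $ j)\<^sup>2"
    unfolding power2_norm_eq_inner * by (simp add: power2_eq_square)
qed

lemma rotate_plane_props:
  fixes x :: "real^'n::finite"
  assumes ij: "UNIV = {i, j}" "i \<noteq> j"
  shows "norm (rotate_plane i j \<theta> x) = norm x"
    and "linear (rotate_plane i j \<theta>)"
    and "rotate_plane i j (- \<theta>) (rotate_plane i j \<theta> x) = x"
proof -
  have i: "rotate_plane i j \<theta> x $ i = cos \<theta> * x $ i - sin \<theta> * x $ j" for \<theta> x by (simp add: rotate_plane_def)
  have j: "rotate_plane i j \<theta> x $ j = sin \<theta> * x $ i + cos \<theta> * x $ j" for \<theta> x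
    using ij by (simp add: rotate_plane_def)
  have all: "(\<forall>k. P k) \<longleftrightarrow> P i \<and> P j" for P using ij(1) by (metis UNIV_I insert_iff singletonD)
  have sc: "sin \<theta> * sin \<theta> + cos \<theta> * cos \<theta> = 1" using sin_cos_squared_add[of \<theta>] by (simp add: power2_eq_square)
  have "(norm (rotate_plane i j \<theta> x))\<^sup>2 = (sin \<theta> * sin \<theta> + cos \<theta> * cos \<theta>) * ((x $ i)\<^sup>2 + (x $ j)\<^sup>2)"
  proof -
    have "(c * a - s * b)\<^sup>2 + (s * a + c * b)\<^sup>2 = (s * s + c * c) * (a\<^sup>2 + b\<^sup>2)" for a b c s :: real
      by (simp add: power2_eq_square algebra_simps)
    then show ?thesis unfolding norm_plane(1)[OF ij] i j .
  qed
  also have "\<dots> = (norm x)\<^sup>2" by (simp add: sc norm_plane(1)[OF ij])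
  finally show "norm (rotate_plane i j \<theta> x) = norm x" by simp
  show "linear (rotate_plane i j \<theta>)"
    by (rule linearI) (simp_all add: vec_eq_iff all i j algebra_simps)
  have alg: "c * (c * a - s * b) + s * (s * a + c * b) = (s * s + c * c) * a"
    "- s * (c * a - s * b) + c * (s * a + c * b) = (s * s + c * c) * b" for a b c s :: real
    by (simp_all add: algebra_simps)
  have "cos \<theta> * (cos \<theta> * x $ i - sin \<theta> * x $ j) + sin \<theta> * (sin \<theta> * x $ i + cos \<theta> * x $ j)
    = (sin \<theta> * sin \<theta> + cos \<theta> * cos \<theta>) * x $ i" by (rule alg)
  moreover have "- sin \<theta> * (cos \<theta> * x $ i - sin \<theta> * x $ j) + cos \<theta> * (sin \<theta> * x $ i + cos \<theta> * x $ j)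
    = (sin \<theta> * sin \<theta> + cos \<theta> * cos \<theta>) * x $ j" by (rule alg)
  ultimately show "rotate_plane i j (- \<theta>) (rotate_plane i j \<theta> x) = x"
    by (simp add: vec_eq_iff all i j sc)
qed

text \<open>
  A radial representation that holds almost everywhere says nothing about a single point, but its
  two consequences, no tangential component and invariance of the radial component under
  rotations, are equations between continuous functions.
\<close>

lemma radial_field_plane:
  fixes W :: "real^'n::finite \<Rightarrow> real^'n"
  assumes ij: "UNIV = {i, j}" "i \<noteq> j"
    and cont: "continuous_on UNIV W"
    and radial: "AE x in lborel. W x = w (norm x) *\<^sub>R (x /\<^sub>R norm x)"
  shows "W x $ i * x $ j = W x $ j * x $ i"
    and "W (rotate_plane i j \<theta> x) \<bullet> rotate_plane i j \<theta> x = W x \<bullet> x"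
proof -
  have "(\<lambda>x. W x $ i * x $ j) = (\<lambda>x. W x $ j * x $ i)"
    by (rule AE_eq_continuous) (use radial in \<open>auto intro!: continuous_intros cont\<close>)
  then show "W x $ i * x $ j = W x $ j * x $ i" by (rule fun_cong)
  let ?Q = "rotate_plane i j \<theta>"
  have "AE x in lborel. W (?Q x) = w (norm (?Q x)) *\<^sub>R (?Q x /\<^sub>R norm (?Q x))"
    by (rule AE_lborel_linear[OF radial rotate_plane_props(2)[OF ij, of "- \<theta>"]]) (rule rotate_plane_props(3)[OF ij])
  with radial have "AE x in lborel. W (?Q x) \<bullet> ?Q x = W x \<bullet> x"
  proof eventually_elim
    case (elim x)
    show ?case unfolding elim rotate_plane_props(1)[OF ij]
      by (simp add: dot_square_norm rotate_plane_props(1)[OF ij])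
  qed
  moreover have cQ: "continuous_on UNIV ?Q"
    using rotate_plane_props(2)[OF ij] by (rule linear_continuous_on_compose[OF continuous_on_id])
  have "continuous_on UNIV (\<lambda>x. W (?Q x))" by (rule continuous_on_compose2[OF cont cQ]) simp
  ultimately have "(\<lambda>x. W (?Q x) \<bullet> ?Q x) = (\<lambda>x. W x \<bullet> x)"
    by (intro AE_eq_continuous continuous_on_inner cQ cont continuous_on_id)
  then show "W (?Q x) \<bullet> ?Q x = W x \<bullet> x" by (rule fun_cong)
qed

text \<open>
  Differentiate the two pointwise equations: \<open>W\<^sub>i x\<^sub>j = W\<^sub>j
  x\<^sub>i\<close> in both coordinates, and the rotation invariance of \<open>W \<cdot> x\<close>
  in the angle. The three relations combine linearly to \<open>|x|\<^sup>2 curl W = 0\<close>.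
\<close>

lemma radial_field_curl_free:
  fixes W :: "real^'n::finite \<Rightarrow> real^'n"
  assumes ij: "UNIV = {i, j}" "i \<noteq> j"
    and C1: "\<And>k. C1_grad (\<lambda>x. W x $ k) (DW k)"
    and radial: "AE x in lborel. W x = w (norm x) *\<^sub>R (x /\<^sub>R norm x)"
  shows "x \<noteq> 0 \<Longrightarrow> DW i x $ j = DW j x $ i"
    and "x $ j = 0 \<Longrightarrow> x $ i * DW j x $ j = W x $ i"
proof -
  have "continuous_on UNIV (\<lambda>x. \<chi> k. W x $ k)" by (intro continuous_on_vec_lambda C1_gradD(3)[OF C1])
  then have cont: "continuous_on UNIV W" by simp
  note rad = radial_field_plane[OF ij cont radial]
  have coord: "C1_grad (\<lambda>x::real^'n. x $ k) (\<lambda>x. axis k 1)" for k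
  proof -
    have "((\<lambda>x::real^'n. x $ k) has_derivative (\<lambda>h. axis k 1 \<bullet> h)) (at x)" for x
      unfolding inner_axis' inner_real_def mult_1
      by (intro bounded_linear_imp_has_derivative bounded_linear_vec_nth)
    then show ?thesis by (simp add: C1_grad_def)
  qed
  have comp: "axis k 1 $ l = (if k = l then 1 else (0::real))" for k l :: 'n by (simp add: axis_def)
  have g0: "C1_grad (\<lambda>x. W x $ i * x $ j - W x $ j * x $ i)
     (\<lambda>x. (W x $ i *\<^sub>R axis j 1 + x $ j *\<^sub>R DW i x) - (W x $ j *\<^sub>R axis i 1 + x $ i *\<^sub>R DW j x))"
    by (intro C1_grad_diff C1_grad_mult C1 coord)
  have zero: "(\<lambda>x. W x $ i * x $ j - W x $ j * x $ i) = (\<lambda>x. 0)"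
    using rad(1) by (simp only: diff_self)
  have "C1_grad (\<lambda>x::real^'n. 0) (\<lambda>x. 0)" by (simp add: C1_grad_def)
  from C1_grad_unique[OF g0[unfolded zero] this] have "(\<lambda>x. (W x $ i *\<^sub>R axis j 1 + x $ j *\<^sub>R DW i x) - (W x $ j *\<^sub>R axis i 1 + x $ i *\<^sub>R DW j x)) = (\<lambda>x. 0)" .
  from fun_cong[OF this, of x]
  have vec0: "(W x $ i *\<^sub>R axis j 1 + x $ j *\<^sub>R DW i x) - (W x $ j *\<^sub>R axis i 1 + x $ i *\<^sub>R DW j x) = 0" .
  have a: "x $ j * DW i x $ i - W x $ j - x $ i * DW j x $ i = 0"
    using arg_cong[OF vec0, of "\<lambda>v. v $ i"] ij(2) by (simp add: comp)
  have b: "W x $ i + x $ j * DW i x $ j - x $ i * DW j x $ j = 0"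
    using arg_cong[OF vec0, of "\<lambda>v. v $ j"] ij(2) by (simp add: comp)
  show "x $ j = 0 \<Longrightarrow> x $ i * DW j x $ j = W x $ i" using b by simp
  \<comment> \<open>The function \<open>p\<close> is \<open>W \<cdot> x\<close>, which is invariant under rotations.\<close>
  define p where "p x = W x $ i * x $ i + W x $ j * x $ j" for x
  define Dp where "Dp x = (W x $ i *\<^sub>R axis i 1 + x $ i *\<^sub>R DW i x) + (W x $ j *\<^sub>R axis j 1 + x $ j *\<^sub>R DW j x)" for x
  have dp: "(p has_derivative (\<lambda>h. Dp x \<bullet> h)) (at x)" for x
    unfolding p_def Dp_def inner_add_left
    by (intro has_derivative_add C1_gradD(1)[OF C1_grad_mult[OF C1 coord], unfolded inner_add_left])
  have path: "((\<lambda>\<theta>. rotate_plane i j \<theta> x) has_derivative (\<lambda>h. h *\<^sub>R (\<chi> k. if k = i then - x $ j else x $ i))) (at 0)"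
  proof (rule iffD2[OF has_derivative_componentwise_within], rule ballI)
    fix b :: "real^'n" assume "b \<in> Basis"
    then obtain k where b: "b = axis k 1" by (auto simp: Basis_vec_def)
    show "((\<lambda>\<theta>. rotate_plane i j \<theta> x \<bullet> b) has_derivative (\<lambda>h. (h *\<^sub>R (\<chi> k. if k = i then - x $ j else x $ i)) \<bullet> b)) (at 0)"
    proof (cases "k = i")
      case True
      have 1: "rotate_plane i j \<theta> x \<bullet> b = cos \<theta> * x $ i - sin \<theta> * x $ j" for \<theta>
        using True by (simp add: b inner_axis rotate_plane_def)
      have 2: "(h *\<^sub>R (\<chi> k. if k = i then - x $ j else x $ i)) \<bullet> b = (- x $ j) * h" for h
        using True by (simp add: b inner_axis)
      have "((\<lambda>\<theta>. cos \<theta> * x $ i - sin \<theta> * x $ j) has_real_derivative (- x $ j)) (at 0)"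
        by (rule derivative_eq_intros refl | simp)+
      then show ?thesis unfolding 1 2 has_field_derivative_def .
    next
      case False
      have 1: "rotate_plane i j \<theta> x \<bullet> b = sin \<theta> * x $ i + cos \<theta> * x $ j" for \<theta>
        using False by (simp add: b inner_axis rotate_plane_def)
      have 2: "(h *\<^sub>R (\<chi> k. if k = i then - x $ j else x $ i)) \<bullet> b = x $ i * h" for h
        using False by (simp add: b inner_axis)
      have "((\<lambda>\<theta>. sin \<theta> * x $ i + cos \<theta> * x $ j) has_real_derivative x $ i) (at 0)"
        by (rule derivative_eq_intros refl | simp)+
      then show ?thesis unfolding 1 2 has_field_derivative_def .
    qed
  qed
  have "((\<lambda>\<theta>. p (rotate_plane i j \<theta> x)) has_derivative (\<lambda>h. Dp (rotate_plane i j 0 x) \<bullet> (h *\<^sub>R (\<chi> k. if k = i then - x $ j else x $ i)))) (at 0)"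
    by (rule has_derivative_compose[OF path dp])
  moreover have "rotate_plane i j 0 x = x"
    using ij(1) by (auto simp: vec_eq_iff rotate_plane_def)
  moreover have "p (rotate_plane i j \<theta> x) = p x" for \<theta>
    using rad(2)[of \<theta> x] unfolding norm_plane(2)[OF ij] p_def .
  ultimately have der: "((\<lambda>\<theta>::real. p x) has_derivative (\<lambda>h. Dp x \<bullet> (h *\<^sub>R (\<chi> k. if k = i then - x $ j else x $ i)))) (at 0)"
    by (simp only:)
  then have "(\<lambda>h::real. Dp x \<bullet> (h *\<^sub>R (\<chi> k. if k = i then - x $ j else x $ i))) = (\<lambda>h. 0)"
    by (rule has_derivative_unique[OF _ has_derivative_const])
  from fun_cong[OF this, of 1]
  have "Dp x $ i * (- x $ j) + Dp x $ j * x $ i = 0"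
    using ij(2) by (simp add: norm_plane(2)[OF ij])
  moreover have "Dp x $ i = W x $ i + x $ i * DW i x $ i + x $ j * DW j x $ i"
    "Dp x $ j = W x $ j + x $ i * DW i x $ j + x $ j * DW j x $ j"
    using ij(2) by (simp_all add: Dp_def comp)
  ultimately have c: "(W x $ i + x $ i * DW i x $ i + x $ j * DW j x $ i) * (- x $ j)
      + (W x $ j + x $ i * DW i x $ j + x $ j * DW j x $ j) * x $ i = 0"
    by (simp only:)
  have "((x $ i)\<^sup>2 + (x $ j)\<^sup>2) * (DW i x $ j - DW j x $ i) = 0"
  proof -
    have "(wi + xi * dii + xj * dji) * (- xj) + (wj + xi * dij + xj * djj) * xi
        + xi * (xj * dii - wj - xi * dji) + xj * (wi + xj * dij - xi * djj)
      = (xi\<^sup>2 + xj\<^sup>2) * (dij - dji)" for wi wj xi xj dii dij dji djj :: real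
      by (simp add: power2_eq_square algebra_simps)
    from this[of "W x $ i" "x $ i" "DW i x $ i" "x $ j" "DW j x $ i" "W x $ j" "DW i x $ j" "DW j x $ j"]
    show ?thesis unfolding a b c by simp
  qed
  then have "(norm x)\<^sup>2 * (DW i x $ j - DW j x $ i) = 0" unfolding norm_plane(1)[OF ij] .
  then show "x \<noteq> 0 \<Longrightarrow> DW i x $ j = DW j x $ i" by simp
qed

section \<open>The flow in terms of classical fields\<close>

lemma integrable_continuous_times_test:
  assumes "continuous_on UNIV f" "test_function \<phi>"
  shows "integrable lborel (\<lambda>x. f x * \<phi> x)"
proof -
  obtain B where B: "\<And>x. norm x > B \<Longrightarrow> \<phi> x = 0" by (rule test_function_vanishes[OF assms(2)]) auto
  show ?thesis
    by (rule integrable_compact_support(1)[where B = B])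
       (auto intro!: continuous_on_mult assms(1) test_function_integrable(2)[OF assms(2)] simp: B)
qed

lemma classical_fieldD:
  assumes "classical_field T F DF F'"
  shows "t \<in> {0..T} \<Longrightarrow> C1_grad (F t) (DF t)"
    and "t \<in> {0..T} \<Longrightarrow> ((\<lambda>s. F s x) has_real_derivative F' t x) (at t within {0..T})"
    and "continuous_on ({0..T} \<times> UNIV) (\<lambda>(t, x). F t x)"
    and "continuous_on ({0..T} \<times> UNIV) (\<lambda>(t, x). DF t x)"
    and "continuous_on ({0..T} \<times> UNIV) (\<lambda>(t, x). F' t x)"
    and "t \<in> {0..T} \<Longrightarrow> continuous_on UNIV (F' t)"
proof -
  show 5: "continuous_on ({0..T} \<times> UNIV) (\<lambda>(t, x). F' t x)"
    using assms unfolding classical_field_def by blast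
  show "continuous_on UNIV (F' t)" if "t \<in> {0..T}"
  proof -
    have "continuous_on UNIV (\<lambda>x::real^'n. (t, x))"
      by (intro continuous_on_Pair continuous_on_const continuous_on_id)
    moreover have "(\<lambda>x::real^'n. (t, x)) ` UNIV \<subseteq> {0..T} \<times> UNIV" using that by auto
    ultimately have "continuous_on UNIV (\<lambda>x. case (t, x) of (t, x) \<Rightarrow> F' t x)"
      by (rule continuous_on_compose2[OF 5])
    then show ?thesis by simp
  qed
qed (use assms in \<open>unfold classical_field_def, blast+\<close>)

text \<open>
  A solution on \<open>[0,T]\<close> in terms of its classical representatives: density
  \<open>R\<close> and velocity \<open>U\<close> with their gradients \<open>DR\<close>,
  \<open>DU\<close> and time derivatives \<open>R'\<close>, \<open>U'\<close>. The equations are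
  those of \<^const>\<open>mass_equation\<close> and \<^const>\<open>momentum_equation\<close>
  with the time derivative taken inside the integral. The second derivatives of \<open>u\<close>
  remain on the test functions, because \<open>u\<close> is only \<open>C\<^sup>1\<close>.
\<close>

locale ns_flow =
  fixes T a \<mu> lam :: real
    and R :: "real \<Rightarrow> real^'n::finite \<Rightarrow> real" and DR :: "real \<Rightarrow> real^'n \<Rightarrow> real^'n" and R' :: "real \<Rightarrow> real^'n \<Rightarrow> real"
    and U :: "real \<Rightarrow> real^'n \<Rightarrow> real^'n" and DU :: "'n \<Rightarrow> real \<Rightarrow> real^'n \<Rightarrow> real^'n" and U' :: "'n \<Rightarrow> real \<Rightarrow> real^'n \<Rightarrow> real"
  assumes T_pos: "T > 0" and visc: "lam + 2 * \<mu> > 0" and dim: "CARD('n) = 1 \<or> CARD('n) = 2"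
    and R_field: "classical_field T R DR R'"
    and U_field: "\<And>i. classical_field T (\<lambda>t x. U t x $ i) (DU i) (U' i)"
    and U_L2: "\<And>t i. t \<in> {0..T} \<Longrightarrow> integrable lborel (\<lambda>x. (U t x $ i)\<^sup>2)"
    and mass: "\<And>t \<phi>. t \<in> {0..T} \<Longrightarrow> test_function \<phi> \<Longrightarrow>
      (LINT x|lborel. R' t x * \<phi> x) = (\<Sum>j\<in>UNIV. LINT x|lborel. R t x * U t x $ j * pdiff j \<phi> x)"
    and momentum: "\<And>t i \<phi>. t \<in> {0..T} \<Longrightarrow> test_function \<phi> \<Longrightarrow>
      (LINT x|lborel. (R' t x * U t x $ i + R t x * U' i t x) * \<phi> x) =
        (\<Sum>j\<in>UNIV. LINT x|lborel. R t x * U t x $ i * U t x $ j * pdiff j \<phi> x)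
        + \<mu> * (\<Sum>j\<in>UNIV. LINT x|lborel. U t x $ i * pdiff j (pdiff j \<phi>) x)
        + (lam + \<mu>) * (\<Sum>j\<in>UNIV. LINT x|lborel. U t x $ j * pdiff j (pdiff i \<phi>) x)
        + a * (LINT x|lborel. R t x * pdiff i \<phi> x)"
    and radial: "\<And>t. CARD('n) = 2 \<Longrightarrow> t \<in> {0..T} \<Longrightarrow>
      \<exists>w. AE x in lborel. U t x = w (norm x) *\<^sub>R (x /\<^sub>R norm x)"
begin

definition divU :: "real \<Rightarrow> real^'n \<Rightarrow> real" where
  "divU t x = (\<Sum>j\<in>UNIV. DU j t x $ j)"

lemmas R_C1 = classical_fieldD(1)[OF R_field]
lemmas U_C1 = classical_fieldD(1)[OF U_field]

lemma continuous_U: "t \<in> {0..T} \<Longrightarrow> continuous_on UNIV (U t)"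
proof -
  assume "t \<in> {0..T}"
  then have "continuous_on UNIV (\<lambda>x. \<chi> i. U t x $ i)" by (intro continuous_on_vec_lambda C1_gradD(3)[OF U_C1])
  then show ?thesis by simp
qed

lemma continuous_divU: "t \<in> {0..T} \<Longrightarrow> continuous_on UNIV (divU t)"
  unfolding divU_def by (intro continuous_on_sum continuous_on_component C1_gradD(2)[OF U_C1])

text \<open>
  Integration by parts moves the derivative onto the flux, and a continuous function that vanishes
  weakly is zero.
\<close>

lemma mass_pointwise:
  assumes t: "t \<in> {0..T}"
  shows "R' t x + DR t x \<bullet> U t x + R t x * divU t x = 0"
proof -
  define f where "f j x = R t x * DU j t x $ j + U t x $ j * DR t x $ j" for j x
  have cf: "continuous_on UNIV (f j)" for j
    unfolding f_def
    by (intro continuous_on_add continuous_on_mult continuous_on_component C1_gradD(2,3)[OF R_C1[OF t]]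
        C1_gradD(2)[OF U_C1[OF t]] continuous_U[OF t])
  have cR': "continuous_on UNIV (R' t)" by (rule classical_fieldD(6)[OF R_field t])
  have A: "R' t y + (\<Sum>j\<in>UNIV. f j y) = 0" for y
  proof (rule weakly_zero_imp_zero)
    show "continuous_on UNIV (\<lambda>y. R' t y + (\<Sum>j\<in>UNIV. f j y))"
      by (intro continuous_on_add cR' continuous_on_sum cf)
    fix \<phi> :: "real^'n \<Rightarrow> real" assume \<phi>: "test_function \<phi>"
    have "(LINT x|lborel. R t x * U t x $ j * pdiff j \<phi> x) = - (LINT x|lborel. f j x * \<phi> x)" for j
      using integration_by_parts[OF C1_grad_mult[OF R_C1[OF t] U_C1[OF t, of j]] \<phi>, of j]
      by (simp add: f_def)
    then have "(LINT x|lborel. R' t x * \<phi> x) = - (\<Sum>j\<in>UNIV. LINT x|lborel. f j x * \<phi> x)"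
      using mass[OF t \<phi>] by (simp add: sum_negf)
    moreover have "(LINT x|lborel. (R' t x + (\<Sum>j\<in>UNIV. f j x)) * \<phi> x)
      = (LINT x|lborel. R' t x * \<phi> x) + (\<Sum>j\<in>UNIV. LINT x|lborel. f j x * \<phi> x)"
      unfolding distrib_right sum_distrib_right
      using integrable_continuous_times_test[OF cR' \<phi>] integrable_continuous_times_test[OF cf \<phi>]
      by (subst Bochner_Integration.integral_add) (auto intro!: Bochner_Integration.integrable_sum Bochner_Integration.integral_sum)
    ultimately show "(LINT x|lborel. (R' t x + (\<Sum>j\<in>UNIV. f j x)) * \<phi> x) = 0" by simp
  qed
  have B: "(\<Sum>j\<in>UNIV. f j x) = DR t x \<bullet> U t x + R t x * divU t x"
    by (simp add: f_def divU_def inner_vec_def sum.distrib sum_distrib_left mult.commute)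
  show ?thesis using A[of x] unfolding B by (simp only: add.assoc)
qed

lemma uniform_bounds:
  obtains K where "K > 0" "\<And>t x. t \<in> {0..T} \<Longrightarrow> norm (U t x) \<le> K"
    "\<And>t x. t \<in> {0..T} \<Longrightarrow> \<bar>divU t x\<bar> \<le> K"
    "\<And>t x y. t \<in> {0..T} \<Longrightarrow> norm (U t x - U t y) \<le> K * norm (x - y)"
proof -
  have "\<forall>i. \<exists>K. \<forall>t\<in>{0..T}. \<forall>x. \<bar>U t x $ i\<bar> \<le> K \<and> norm (DU i t x) \<le> K"
    using U_field unfolding classical_field_def by blast
  then obtain k where k: "\<And>i t x. t \<in> {0..T} \<Longrightarrow> \<bar>U t x $ i\<bar> \<le> k i"
      "\<And>i t x. t \<in> {0..T} \<Longrightarrow> norm (DU i t x) \<le> k i"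
    by metis
  define K where "K = (\<Sum>i\<in>UNIV. k i) + 1"
  have T0: "0 \<in> {0..T}" using T_pos by simp
  have k0: "k i \<ge> 0" for i using k(1)[OF T0, of undefined i] by (rule order_trans[OF abs_ge_zero])
  show ?thesis
  proof (rule that[of K])
    show "K > 0" unfolding K_def by (intro add_nonneg_pos sum_nonneg k0) simp
    show "norm (U t x) \<le> K" if "t \<in> {0..T}" for t x
    proof -
      have "norm (U t x) \<le> (\<Sum>i\<in>UNIV. \<bar>U t x $ i\<bar>)" by (rule norm_le_l1_cart)
      also have "\<dots> \<le> (\<Sum>i\<in>UNIV. k i)" by (intro sum_mono k that)
      finally show ?thesis by (simp add: K_def)
    qed
    show "\<bar>divU t x\<bar> \<le> K" if "t \<in> {0..T}" for t x
    proof -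
      have "\<bar>divU t x\<bar> \<le> (\<Sum>j\<in>UNIV. \<bar>DU j t x $ j\<bar>)" unfolding divU_def by (rule sum_abs)
      also have "\<dots> \<le> (\<Sum>i\<in>UNIV. k i)"
        by (intro sum_mono order_trans[OF component_le_norm_cart] k that)
      finally show ?thesis by (simp add: K_def)
    qed
    show "norm (U t x - U t y) \<le> K * norm (x - y)" if t: "t \<in> {0..T}" for t x y
    proof -
      have "norm (U t x - U t y) \<le> (\<Sum>i\<in>UNIV. \<bar>(U t x - U t y) $ i\<bar>)" by (rule norm_le_l1_cart)
      also have "\<dots> \<le> (\<Sum>i\<in>UNIV. k i * norm (x - y))"
        unfolding vector_minus_component by (intro sum_mono C1_grad_lipschitz[OF U_C1[OF t] k(2)[OF t]])
      also have "\<dots> \<le> K * norm (x - y)"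
        unfolding sum_distrib_right[symmetric] by (intro mult_right_mono) (auto simp: K_def)
      finally show ?thesis .
    qed
  qed
qed

lemma density_nonneg:
  assumes init: "\<And>x. R 0 x \<ge> 0" and t: "t \<in> {0..T}"
  shows "R t x \<ge> 0"
proof -
  obtain K where K: "K > 0" "\<And>t x. t \<in> {0..T} \<Longrightarrow> norm (U t x) \<le> K" "\<And>t x. t \<in> {0..T} \<Longrightarrow> \<bar>divU t x\<bar> \<le> K"
    using uniform_bounds by metis
  show ?thesis
    by (rule transport_nonneg[OF classical_fieldD(2)[OF R_field] R_C1 classical_fieldD(3)[OF R_field] mass_pointwise K(3),
          where ?t1.0 = 0 and ?t2.0 = t and \<eta> = 1 and V = K])
       (use t K init in auto)
qed

text \<open>
  Only the speed outside the initial ball matters, since the backward cone of an exterior point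
  stays outside that ball.
\<close>

lemma support_spreads_at_boundary_speed:
  assumes t12: "0 \<le> t1" "t1 \<le> t2" "t2 \<le> T" and V: "V \<ge> 0"
    and init: "\<And>x. norm x \<ge> r \<Longrightarrow> R t1 x = 0"
    and speed: "\<And>t x. t1 \<le> t \<Longrightarrow> t \<le> t2 \<Longrightarrow> norm x \<ge> r \<Longrightarrow> norm (U t x) \<le> V"
    and x: "norm x > r + V * (t2 - t1)"
  shows "R t2 x = 0"
proof -
  obtain K where K: "\<And>t x. t \<in> {0..T} \<Longrightarrow> \<bar>divU t x\<bar> \<le> K"
    using uniform_bounds by metis
  define \<eta> where "\<eta> = norm x - r - V * (t2 - t1)"
  have far: "norm y \<ge> r" if "norm (y - x) \<le> \<eta> + V * (t2 - t)" "t1 \<le> t" for y t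
  proof -
    have "V * (t2 - t) \<le> V * (t2 - t1)" using V that by (intro mult_left_mono) auto
    then show ?thesis using that norm_triangle_ineq2[of x "x - y"] norm_minus_commute[of x y] by (simp add: \<eta>_def)
  qed
  show ?thesis
  proof (rule transport_zero[OF classical_fieldD(2)[OF R_field] R_C1 classical_fieldD(3)[OF R_field] mass_pointwise K t12,
          where \<eta> = \<eta> and V = V])
    show "\<eta> > 0" using x by (simp add: \<eta>_def)
    show "norm (U t y) \<le> V" if "t1 \<le> t" "t \<le> t2" "norm (y - x) \<le> \<eta> + V * (t2 - t)" for t y
      using speed[OF that(1,2) far[OF that(3,1)]] .
    show "R t1 y = 0" if "norm (y - x) \<le> \<eta> + V * (t2 - t1)" for y
      using init[OF far[OF that order_refl]] .
  qed (use V in auto)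
qed

text \<open>
  All terms that contain the density vanish against test functions supported in the vacuum,
  including the time derivative of \<open>\<rho> u\<close>, because the mass equation makes
  \<open>\<partial>\<^sub>t\<rho>\<close> zero there.
\<close>

lemma exterior_momentum:
  assumes t: "t \<in> {0..T}" and r: "r > 0" and zero: "\<And>x. norm x \<ge> r \<Longrightarrow> R t x = 0"
    and \<phi>: "test_function \<phi>" and supp: "\<And>x. norm x \<le> r \<Longrightarrow> \<phi> x = 0"
  shows "\<mu> * (\<Sum>j\<in>UNIV. LINT x|lborel. U t x $ i * pdiff j (pdiff j \<phi>) x)
        + (lam + \<mu>) * (\<Sum>j\<in>UNIV. LINT x|lborel. U t x $ j * pdiff j (pdiff i \<phi>) x) = 0"
proof -
  have Rd: "R t x * pdiff j \<phi> x = 0" for j x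
  proof (cases "norm x \<ge> r")
    case False
    have "pdiff j \<phi> x = 0"
      by (rule pdiff_eq_0_open[of "ball 0 r"]) (use False supp in auto)
    then show ?thesis by simp
  qed (simp add: zero)
  have R'\<phi>: "(R' t x * U t x $ i + R t x * U' i t x) * \<phi> x = 0" for x
  proof (cases "norm x > r")
    case True
    have "DR t x $ j = 0" for j
      unfolding C1_grad_pdiff[OF R_C1[OF t], symmetric]
      by (rule pdiff_eq_0_open[of "{x. norm x > r}"])
         (use True zero in \<open>auto intro!: open_Collect_less continuous_intros\<close>)
    then have "DR t x = 0" by (simp add: vec_eq_iff)
    then have "R' t x = 0" using mass_pointwise[OF t, of x] zero[of x] True by simp
    then show ?thesis using zero[of x] True by simp
  qed (simp add: supp)
  have z: "(\<lambda>x. R t x * U t x $ i * U t x $ j * pdiff j \<phi> x) = (\<lambda>x. 0)" for j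
    using Rd[of _ j] by (auto simp: fun_eq_iff)
  show ?thesis using momentum[OF t \<phi>, of i] unfolding z by (simp add: R'\<phi> Rd)
qed

end

section \<open>Rigidity of the velocity outside the gas\<close>

lemma UNIV_eq_pair:
  assumes "CARD('n::finite) = 2" "(i::'n) \<noteq> j"
  shows "UNIV = {i, j}"
proof -
  have "{i, j} = UNIV" by (rule card_subset_eq) (use assms in auto)
  then show ?thesis by simp
qed

lemma ex_other_if_CARD_2:
  assumes "CARD('n::finite) = 2"
  shows "\<exists>j. j \<noteq> (i::'n)"
proof (rule ccontr)
  assume "\<not> (\<exists>j. j \<noteq> i)"
  then have "(UNIV :: 'n set) = {i}" by auto
  then have "CARD('n) = card {i}" by (rule arg_cong)
  then show False using assms by simp
qed

lemma UNIV_eq_single: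
  assumes "CARD('n::finite) = 1"
  shows "UNIV = {i::'n}"
proof -
  have "{i} = UNIV" by (rule card_subset_eq) (use assms in auto)
  then show ?thesis by simp
qed

text \<open>
  The unit vector \<open>x / c\<close> is \<open>(cos \<theta>, sin \<theta>)\<close>.
\<close>

lemma rotate_plane_transitive:
  fixes x :: "real^'n::finite"
  assumes ij: "UNIV = {i, j}" "i \<noteq> j" and c: "c \<noteq> 0" "norm x = \<bar>c\<bar>"
  obtains \<theta> where "x = rotate_plane i j \<theta> (c *\<^sub>R axis i 1)"
proof -
  have "(x $ i)\<^sup>2 + (x $ j)\<^sup>2 = c\<^sup>2"
    unfolding norm_plane(1)[OF ij, symmetric] c(2) by simp
  then have "(x $ i / c)\<^sup>2 + (x $ j / c)\<^sup>2 = 1"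
    using c(1) by (simp add: power_divide add_divide_distrib[symmetric])
  then obtain \<theta> where \<theta>: "x $ i / c = cos \<theta>" "x $ j / c = sin \<theta>" by (rule sincos_total_2pi)
  have "x $ i = rotate_plane i j \<theta> (c *\<^sub>R axis i 1) $ i" "x $ j = rotate_plane i j \<theta> (c *\<^sub>R axis i 1) $ j"
    using ij(2) c(1) by (simp_all add: rotate_plane_def axis_def \<theta>[symmetric])
  then have "x = rotate_plane i j \<theta> (c *\<^sub>R axis i 1)"
    using ij(1) by (metis UNIV_I insertE singletonD vec_eq_iff)
  then show ?thesis by (rule that)
qed

context ns_flow
begin

text \<open>
  In one dimension there is only one index; in two dimensions the field is radial.
\<close>

lemma curl_free:
  assumes t: "t \<in> {0..T}" and x: "x \<noteq> 0"
  shows "DU i t x $ j = DU j t x $ i"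
proof (cases "i = j")
  case False
  have "CARD('n) \<noteq> 1"
  proof
    assume "CARD('n) = 1"
    have "j \<in> {i}" unfolding UNIV_eq_single[OF \<open>CARD('n) = 1\<close>, of i, symmetric] by simp
    then show False using False by simp
  qed
  then have "CARD('n) = 2" using dim by simp
  then obtain w where "AE x in lborel. U t x = w (norm x) *\<^sub>R (x /\<^sub>R norm x)" using radial[OF _ t] by blast
  from radial_field_curl_free(1)[OF UNIV_eq_pair[OF \<open>CARD('n) = 2\<close> False] False U_C1[OF t] this x]
  show ?thesis .
qed simp

text \<open>
  Without curl the Laplacian of \<open>u\<close> is the gradient of its divergence, so the Lame
  operator becomes \<open>(\<lambda> + 2 \<mu>) \<nabla>div u\<close>. Since \<open>u\<close> is
  only \<open>C\<^sup>1\<close>, the exchange is done under the integral: integrate by parts once,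
  exchange the indices of the Jacobian, and integrate back.
\<close>

lemma weak_gradient_divergence_zero:
  assumes t: "t \<in> {0..T}" and r: "r > 0" and zero: "\<And>x. norm x \<ge> r \<Longrightarrow> R t x = 0"
    and \<phi>: "test_function \<phi>" and supp: "\<And>x. norm x \<le> r \<Longrightarrow> \<phi> x = 0"
  shows "(LINT x|lborel. divU t x * pdiff i \<phi> x) = 0"
proof -
  have d0: "pdiff j \<phi> 0 = 0" for j
    by (rule pdiff_eq_0_open[of "ball 0 r"]) (use r supp in auto)
  note ibp = integration_by_parts[OF U_C1[OF t] test_function_pdiff[OF \<phi>]]
  have grad: "(LINT x|lborel. U t x $ j * pdiff j (pdiff i \<phi>) x) = - (LINT x|lborel. DU j t x $ j * pdiff i \<phi> x)" for j
    by (rule ibp)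
  have "(LINT x|lborel. U t x $ i * pdiff j (pdiff j \<phi>) x) = (LINT x|lborel. U t x $ j * pdiff j (pdiff i \<phi>) x)" for j
  proof -
    have eq: "DU i t x $ j * pdiff j \<phi> x = DU j t x $ i * pdiff j \<phi> x" for x
    proof (cases "x = 0")
      case True then show ?thesis unfolding True d0 by simp
    next
      case False then show ?thesis by (simp only: curl_free[OF t False])
    qed
    have "(LINT x|lborel. U t x $ i * pdiff j (pdiff j \<phi>) x) = - (LINT x|lborel. DU i t x $ j * pdiff j \<phi> x)"
      by (rule ibp)
    also have "\<dots> = - (LINT x|lborel. DU j t x $ i * pdiff j \<phi> x)" unfolding eq ..
    also have "\<dots> = (LINT x|lborel. U t x $ j * pdiff i (pdiff j \<phi>) x)" by (rule ibp[symmetric])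
    also have "\<dots> = (LINT x|lborel. U t x $ j * pdiff j (pdiff i \<phi>) x)" unfolding pdiff_commute[OF \<phi>, of i j] ..
    finally show ?thesis .
  qed
  then have "\<mu> * (\<Sum>j\<in>UNIV. LINT x|lborel. U t x $ j * pdiff j (pdiff i \<phi>) x)
        + (lam + \<mu>) * (\<Sum>j\<in>UNIV. LINT x|lborel. U t x $ j * pdiff j (pdiff i \<phi>) x) = 0"
    using exterior_momentum[OF t r zero \<phi> supp, of i] by simp
  then have "(lam + 2 * \<mu>) * (\<Sum>j\<in>UNIV. LINT x|lborel. U t x $ j * pdiff j (pdiff i \<phi>) x) = 0"
    by (simp add: algebra_simps)
  then have "(\<Sum>j\<in>UNIV. LINT x|lborel. U t x $ j * pdiff j (pdiff i \<phi>) x) = 0" using visc by simp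
  then have s: "(\<Sum>j\<in>UNIV. LINT x|lborel. DU j t x $ j * pdiff i \<phi> x) = 0"
    unfolding grad by (simp add: sum_negf)
  have "integrable lborel (\<lambda>x. DU j t x $ j * pdiff i \<phi> x)" for j
    by (intro integrable_continuous_times_test continuous_on_component C1_gradD(2)[OF U_C1[OF t]] test_function_pdiff \<phi>)
  then show ?thesis
    unfolding divU_def sum_distrib_right using s by (subst Bochner_Integration.integral_sum) auto
qed

lemma divergence_constant_on_rays:
  assumes t: "t \<in> {0..T}" and r: "r > 0" and zero: "\<And>x. norm x \<ge> r \<Longrightarrow> R t x = 0"
    and \<sigma>: "\<sigma> = 1 \<or> \<sigma> = - 1" and s: "s1 > r" "s2 > r"
  shows "divU t ((\<sigma> * s1) *\<^sub>R axis i 1) = divU t ((\<sigma> * s2) *\<^sub>R axis i 1)"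
proof -
  let ?S = "{x::real^'n. norm x > r}"
  have "open ?S" by (intro open_Collect_less continuous_intros)
  have seg: "divU t (c *\<^sub>R axis i 1 + d *\<^sub>R axis i 1) = divU t (c *\<^sub>R axis i 1)"
    if "d \<ge> 0" "c > r \<or> c + d < - r" for c d
  proof (rule constant_on_segment_if_weak_derivative_zero[OF continuous_divU[OF t] _ \<open>open ?S\<close>])
    show "(LINT x|lborel. divU t x * pdiff i \<phi> x) = 0"
      if "test_function \<phi>" "\<And>x. x \<notin> ?S \<Longrightarrow> \<phi> x = 0" for \<phi>
      using weak_gradient_divergence_zero[OF t r zero that(1)] that(2) by auto
    show "c *\<^sub>R axis i 1 + \<tau> *\<^sub>R axis i 1 \<in> ?S" if "0 \<le> \<tau>" "\<tau> \<le> d" for \<tau>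
      using that \<open>c > r \<or> c + d < - r\<close> r by (auto simp flip: scaleR_add_left)
  qed fact
  have le: "divU t ((\<sigma> * s1) *\<^sub>R axis i 1) = divU t ((\<sigma> * s2) *\<^sub>R axis i 1)"
    if "s1 \<le> s2" "s1 > r" for s1 s2
    using \<sigma>
  proof
    assume "\<sigma> = 1"
    then show ?thesis using seg[of "s2 - s1" s1] that by (simp flip: scaleR_add_left)
  next
    assume "\<sigma> = - 1"
    then show ?thesis using seg[of "s2 - s1" "- s2"] that by (simp add: scaleR_diff_left)
  qed
  show ?thesis using le[of s1 s2] le[of s2 s1] s by linarith
qed

text \<open>
  On the ray the divergence is \<open>f' + (n - 1) f / s\<close> for the radial component
  \<open>f\<close>, so \<open>s\<^bsup>n-1\<^esup> f\<close> has derivative \<open>c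
  s\<^bsup>n-1\<^esup>\<close> with the constant \<open>c\<close> from the divergence.
\<close>

lemma ray_profile:
  assumes t: "t \<in> {0..T}" and r: "r > 0" and zero: "\<And>x. norm x \<ge> r \<Longrightarrow> R t x = 0"
    and \<sigma>: "\<sigma> = 1 \<or> \<sigma> = - 1"
  shows "\<exists>A B. \<forall>s>r. s ^ (CARD('n) - 1) * U t ((\<sigma> * s) *\<^sub>R axis i 1) $ i = A + B * s ^ CARD('n)"
proof -
  let ?n = "CARD('n)" and ?x = "\<lambda>s. (\<sigma> * s) *\<^sub>R axis i 1 :: real^'n"
  define c where "c = \<sigma> * divU t (?x (r + 1))"
  have c: "\<sigma> * divU t (?x s) = c" if "s > r" for s
    unfolding c_def using divergence_constant_on_rays[OF t r zero \<sigma> that, of "r + 1"] by simp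
  have \<sigma>2: "\<sigma> * \<sigma> = 1" using \<sigma> by auto
  have f: "((\<lambda>s. U t (?x s) $ i) has_real_derivative \<sigma> * DU i t (?x s) $ i) (at s)" for s
    using C1_grad_line[OF U_C1[OF t, of i], of 0 "\<sigma> *\<^sub>R axis i 1" s UNIV]
    by (simp add: inner_axis mult.commute)
  have p: "((\<lambda>s. s ^ (?n - 1) * U t (?x s) $ i) has_real_derivative c * s ^ (?n - 1)) (at s)" if s: "s > r" for s
    using dim
  proof
    assume n: "?n = 1"
    have "divU t (?x s) = DU i t (?x s) $ i"
      unfolding divU_def UNIV_eq_single[OF n, of i] by simp
    then show ?thesis using f[of s] c[OF s] by (simp add: n)
  next
    assume n: "?n = 2"
    obtain j where j: "j \<noteq> i" using ex_other_if_CARD_2[OF n, of i] by blast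
    note U2 = UNIV_eq_pair[OF n j[symmetric]]
    obtain w where w: "AE x in lborel. U t x = w (norm x) *\<^sub>R (x /\<^sub>R norm x)" using radial[OF n t] by blast
    have "?x s $ j = 0" "?x s $ i = \<sigma> * s" using j by (auto simp: axis_def)
    then have dj: "\<sigma> * s * DU j t (?x s) $ j = U t (?x s) $ i"
      using radial_field_curl_free(2)[OF U2 j[symmetric] U_C1[OF t] w, of "?x s"] by simp
    have "divU t (?x s) = DU i t (?x s) $ i + DU j t (?x s) $ j"
      unfolding divU_def U2 using j by simp
    then have "c * s = s * (\<sigma> * DU i t (?x s) $ i) + U t (?x s) $ i"
      unfolding c[OF s, symmetric] dj[symmetric] by (simp add: algebra_simps)
    moreover have "((\<lambda>s. s * U t (?x s) $ i) has_real_derivative s * (\<sigma> * DU i t (?x s) $ i) + U t (?x s) $ i) (at s)"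
      by (rule DERIV_cong[OF DERIV_mult[OF DERIV_ident f[of s]]]) (simp add: algebra_simps)
    ultimately show ?thesis by (simp add: n)
  qed
  let ?q = "\<lambda>s. s ^ (?n - 1) * U t (?x s) $ i - c / real ?n * s ^ ?n"
  have "(?q has_real_derivative 0) (at s within {r<..})" if "s \<in> {r<..}" for s
  proof -
    have "((\<lambda>s. c / real ?n * s ^ ?n) has_real_derivative c / real ?n * (real ?n * s ^ (?n - Suc 0))) (at s)"
      using DERIV_cmult[OF DERIV_pow[of ?n s UNIV], of "c / real ?n"] by simp
    from DERIV_diff[OF p this] have "(?q has_real_derivative 0) (at s)" using that by simp
    then show ?thesis by (rule DERIV_subset) simp
  qed
  then obtain A where "\<And>s. s \<in> {r<..} \<Longrightarrow> ?q s = A"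
    using has_field_derivative_zero_constant[OF convex_real_interval(3), of r ?q] by blast
  then have "\<forall>s>r. s ^ (?n - 1) * U t (?x s) $ i = A + c / real ?n * s ^ ?n"
    by (auto simp: diff_eq_eq)
  then show ?thesis by blast
qed

end

lemma integrable_reflect:
  fixes f :: "real^'n::finite \<Rightarrow> real"
  assumes "integrable lborel f" shows "integrable lborel (\<lambda>x. f (- x))"
proof -
  have eq: "lborel = distr lborel borel (\<lambda>x::real^'n. - x)"
    using lborel_affine[of "-1" "0::real^'n"] by (simp add: density_1)
  have "integrable (distr lborel borel (\<lambda>x::real^'n. - x)) f" using assms by (simp only: eq[symmetric])
  then show ?thesis by (subst (asm) integrable_distr_eq) (use assms in auto)
qed

lemma line_eq_axis:
  fixes x :: "real^'n::finite"
  assumes "CARD('n) = 1"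
  shows "x = x $ i *\<^sub>R axis i 1" and "norm x = \<bar>x $ i\<bar>"
proof -
  have all_i: "k = i" for k :: 'n
  proof -
    have "k \<in> {i}" unfolding UNIV_eq_single[OF assms, of i, symmetric] by simp
    then show ?thesis by simp
  qed
  have "x $ k = (x $ i *\<^sub>R axis i 1) $ k" for k
    unfolding all_i[of k] by (simp add: axis_def)
  then show x: "x = x $ i *\<^sub>R axis i 1" unfolding vec_eq_iff by blast
  have "norm x = norm (x $ i *\<^sub>R axis i 1 :: real^'n)" by (rule arg_cong[OF x])
  then show "norm x = \<bar>x $ i\<bar>" by simp
qed

context ns_flow
begin

text \<open>
  If \<open>A\<close> and \<open>B\<close> are not both zero then \<open>|f| \<ge> \<delta>
  s\<^bsup>1-n\<^esup>\<close> for large \<open>s\<close>, hence \<open>f\<^sup>2 \<ge>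
  \<delta>\<^sup>2 / s\<^sup>n\<close> because \<open>2 (n - 1) \<le> n\<close>, and such a
  function is not integrable near infinity.
\<close>

lemma ray_velocity_zero:
  assumes t: "t \<in> {0..T}" and r: "r > 0" and zero: "\<And>x. norm x \<ge> r \<Longrightarrow> R t x = 0"
    and \<sigma>: "\<sigma> = 1 \<or> \<sigma> = - 1" and s: "s > r"
  shows "U t ((\<sigma> * s) *\<^sub>R axis i 1) $ i = 0"
proof -
  let ?n = "CARD('n)"
  define f where "f s = U t ((\<sigma> * s) *\<^sub>R axis i 1) $ i" for s
  obtain A B where AB: "\<And>s. s > r \<Longrightarrow> s ^ (?n - 1) * f s = A + B * s ^ ?n"
    using ray_profile[OF t r zero \<sigma>] unfolding f_def by blast
  have "A = 0 \<and> B = 0"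
  proof (rule ccontr)
    assume "\<not> (A = 0 \<and> B = 0)"
    moreover have "?n \<ge> 1" using dim by auto
    ultimately obtain \<delta> S where \<delta>: "\<delta> > 0" "S \<ge> 1" "\<And>s. s \<ge> S \<Longrightarrow> \<bar>A + B * s ^ ?n\<bar> \<ge> \<delta>"
      using affine_power_bounded_below by blast
    have f_lower: "\<delta>\<^sup>2 / s ^ ?n \<le> (f s)\<^sup>2" if s: "s \<ge> max S (r + 1)" for s
    proof -
      have s1: "s \<ge> 1" "s > r" "s \<ge> S" using s \<delta>(2) by auto
      have "\<delta> \<le> \<bar>s ^ (?n - 1) * f s\<bar>" using \<delta>(3)[OF s1(3)] AB[OF s1(2)] by simp
      then have "\<delta>\<^sup>2 \<le> \<bar>s ^ (?n - 1) * f s\<bar>\<^sup>2" using \<delta>(1) by (intro power_mono) auto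
      also have "\<dots> = s ^ (2 * (?n - 1)) * (f s)\<^sup>2"
        by (simp add: power_mult_distrib mult.commute flip: power_mult)
      also have "\<dots> \<le> s ^ ?n * (f s)\<^sup>2"
        using dim s1 by (intro mult_right_mono power_increasing) auto
      finally show ?thesis using s1 by (simp add: pos_divide_le_eq mult.commute)
    qed
    \<comment> \<open>On the line only one of the two rays is known to carry a large velocity; adding the reflected field makes the lower bound hold in every direction.\<close>
    define h where "h x = (\<Sum>k\<in>UNIV. (U t x $ k)\<^sup>2) + (\<Sum>k\<in>UNIV. (U t (- x) $ k)\<^sup>2)" for x
    have "integrable lborel (\<lambda>x. \<Sum>k\<in>UNIV. (U t x $ k)\<^sup>2)"
      by (intro Bochner_Integration.integrable_sum U_L2 t)
    then have h_int: "integrable lborel h"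
      unfolding h_def using integrable_reflect by (intro Bochner_Integration.integrable_add) blast+
    have h_ge: "(U t x $ k)\<^sup>2 \<le> h x" "(U t (- x) $ k)\<^sup>2 \<le> h x" "(norm (U t x))\<^sup>2 \<le> h x" for x k
    proof -
      have m: "(v $ k)\<^sup>2 \<le> (\<Sum>k\<in>UNIV. (v $ k)\<^sup>2)" for v :: "real^'n" and k
        by (rule member_le_sum) auto
      have nn: "(\<Sum>k\<in>UNIV. (v $ k)\<^sup>2) \<ge> 0" for v :: "real^'n" by (rule sum_nonneg) simp
      show "(U t x $ k)\<^sup>2 \<le> h x" unfolding h_def using m[of "U t x" k] nn[of "U t (- x)"] by linarith
      show "(U t (- x) $ k)\<^sup>2 \<le> h x" unfolding h_def using m[of "U t (- x)" k] nn[of "U t x"] by linarith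
      have "(norm (U t x))\<^sup>2 = (\<Sum>k\<in>UNIV. (U t x $ k)\<^sup>2)"
        unfolding power2_norm_eq_inner inner_vec_def by (simp add: power2_eq_square)
      then show "(norm (U t x))\<^sup>2 \<le> h x"
        unfolding h_def using nn[of "U t (- x)"] by linarith
    qed
    show False
    proof (rule not_integrable_inverse_power[OF h_int, of "max S (r + 1)" "\<delta>\<^sup>2"])
      show "h x \<ge> 0" for x by (rule order_trans[OF zero_le_power2 h_ge(3)])
      show "\<delta>\<^sup>2 > 0" using \<delta> by simp
      fix x :: "real^'n" assume x: "norm x \<ge> max S (r + 1)"
      note fx = f_lower[OF x]
      show "\<delta>\<^sup>2 / norm x ^ ?n \<le> h x"
        using dim
      proof
        assume n: "?n = 1"
        have x1: "x = x $ i *\<^sub>R axis i 1" and nx: "norm x = \<bar>x $ i\<bar>"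
          by (rule line_eq_axis[OF n])+
        have "(\<sigma> * norm x) *\<^sub>R axis i 1 = x \<or> (\<sigma> * norm x) *\<^sub>R axis i 1 = - x"
        proof -
          have "\<sigma> * norm x = x $ i \<or> \<sigma> * norm x = - (x $ i)" using \<sigma> nx by auto
          moreover have "(- (x $ i)) *\<^sub>R axis i 1 = - x" using arg_cong[OF x1, of uminus] by simp
          ultimately show ?thesis using x1 by auto
        qed
        then have "(f (norm x))\<^sup>2 \<le> h x" unfolding f_def using h_ge(1,2)[of x i] by (elim disjE) (simp_all only:)
        then show ?thesis using fx by linarith
      next
        assume n: "?n = 2"
        obtain j where j: "j \<noteq> i" using ex_other_if_CARD_2[OF n, of i] by blast
        note U2 = UNIV_eq_pair[OF n j[symmetric]]
        obtain w where w: "AE x in lborel. U t x = w (norm x) *\<^sub>R (x /\<^sub>R norm x)" using radial[OF n t] by blast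
        have "r + 1 \<le> norm x" using x by simp
        then have nx: "norm x > 0" using r by linarith
        have c: "\<sigma> * norm x \<noteq> 0" "norm x = \<bar>\<sigma> * norm x\<bar>" using \<sigma> nx by auto
        obtain \<theta> where \<theta>: "x = rotate_plane i j \<theta> ((\<sigma> * norm x) *\<^sub>R axis i 1)"
          using rotate_plane_transitive[OF U2 j[symmetric] c] by blast
        have "U t x \<bullet> x = U t ((\<sigma> * norm x) *\<^sub>R axis i 1) \<bullet> ((\<sigma> * norm x) *\<^sub>R axis i 1)"
          using radial_field_plane(2)[OF U2 j[symmetric] continuous_U[OF t] w, of \<theta> "(\<sigma> * norm x) *\<^sub>R axis i 1"]
          unfolding \<theta>[symmetric] .
        then have "\<bar>U t x \<bullet> x\<bar> = norm x * \<bar>f (norm x)\<bar>"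
          using \<sigma> by (auto simp: f_def inner_axis abs_mult)
        then have "norm x * \<bar>f (norm x)\<bar> \<le> norm x * norm (U t x)"
          using Cauchy_Schwarz_ineq2[of "U t x" x] by (simp add: mult.commute)
        then have "\<bar>f (norm x)\<bar> \<le> norm (U t x)" using nx by simp
        then have "\<bar>f (norm x)\<bar>\<^sup>2 \<le> (norm (U t x))\<^sup>2" by (intro power_mono) auto
        then show ?thesis using fx h_ge(3)[of x] by simp
      qed
    qed
  qed
  then have "s ^ (?n - 1) * f s = 0" using AB[OF s] by simp
  then show ?thesis using s r by (simp add: f_def)
qed

text \<open>
  In one dimension each exterior point lies on one of the two rays; in the plane a rotation moves
  it onto a ray and preserves the radial component, which is the only one.
\<close>

lemma exterior_velocity_zero:
  assumes t: "t \<in> {0..T}" and r: "r > 0" and zero: "\<And>x. norm x \<ge> r \<Longrightarrow> R t x = 0" and x: "norm x > r"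
  shows "U t x = 0"
  using dim
proof
  assume n: "CARD('n) = 1"
  have "U t x $ i = 0" for i
  proof -
    have x1: "x = x $ i *\<^sub>R axis i 1" and nx: "norm x = \<bar>x $ i\<bar>"
      by (rule line_eq_axis[OF n])+
    define \<sigma> where "\<sigma> = (if x $ i > 0 then 1 else - 1 :: real)"
    have "\<sigma> = 1 \<or> \<sigma> = - 1" by (simp add: \<sigma>_def)
    from ray_velocity_zero[OF t r zero this x, of i]
    have "U t ((\<sigma> * norm x) *\<^sub>R axis i 1) $ i = 0" .
    moreover have "\<sigma> * norm x = x $ i" unfolding nx by (auto simp: \<sigma>_def)
    ultimately show ?thesis by (simp only: x1[symmetric])
  qed
  then show ?thesis by (simp add: vec_eq_iff)
next
  assume n: "CARD('n) = 2"
  obtain i j :: 'n where j: "j \<noteq> i" using ex_other_if_CARD_2[OF n] by blast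
  note U2 = UNIV_eq_pair[OF n j[symmetric]]
  obtain w where w: "AE x in lborel. U t x = w (norm x) *\<^sub>R (x /\<^sub>R norm x)" using radial[OF n t] by blast
  note rad = radial_field_plane[OF U2 j[symmetric] continuous_U[OF t] w]
  have c: "norm x \<noteq> 0" "norm x = \<bar>norm x\<bar>" using x r by auto
  obtain \<theta> where \<theta>: "x = rotate_plane i j \<theta> (norm x *\<^sub>R axis i 1)"
    using rotate_plane_transitive[OF U2 j[symmetric] c] by blast
  have "U t x \<bullet> x = U t (norm x *\<^sub>R axis i 1) \<bullet> (norm x *\<^sub>R axis i 1)"
    using rad(2)[of \<theta> "norm x *\<^sub>R axis i 1"] unfolding \<theta>[symmetric] .
  also have "\<dots> = 0"
    using ray_velocity_zero[OF t r zero _ x, of 1 i] by (simp add: inner_axis)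
  finally have dot: "U t x $ i * x $ i + U t x $ j * x $ j = 0" unfolding norm_plane(2)[OF U2 j[symmetric]] .
  have cross: "U t x $ i * x $ j = U t x $ j * x $ i" by (rule rad(1))
  have "(norm x)\<^sup>2 * U t x $ i = x $ i * (U t x $ i * x $ i + U t x $ j * x $ j)"
    unfolding norm_plane(1)[OF U2 j[symmetric]] using cross by (simp add: power2_eq_square algebra_simps)
  then have i0: "U t x $ i = 0" unfolding dot using c by simp
  have "(norm x)\<^sup>2 * U t x $ j = x $ j * (U t x $ i * x $ i + U t x $ j * x $ j)"
    unfolding norm_plane(1)[OF U2 j[symmetric]] using cross by (simp add: power2_eq_square algebra_simps)
  then have j0: "U t x $ j = 0" unfolding dot using c by simp
  have "(norm (U t x))\<^sup>2 = 0" unfolding norm_plane(1)[OF U2 j[symmetric]] i0 j0 by simp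
  then show ?thesis by simp
qed

section \<open>The support of the density is fixed\<close>

lemma density_zero_at_radius:
  assumes t: "t \<in> {0..T}" and r: "r > 0" and zero: "\<And>x. norm x > r \<Longrightarrow> R t x = 0" and x: "norm x \<ge> r"
  shows "R t x = 0"
  by (rule zero_on_sphere_if_zero_outside[OF C1_gradD(3)[OF R_C1[OF t]] zero r x])

text \<open>
  With the global speed bound \<open>K\<close> the gas stays within radius \<open>r + K (t -
  t1)\<close>, where the velocity vanishes; as \<open>K\<close> is also a Lipschitz constant, the
  speed outside radius \<open>r\<close> is at most \<open>K\<^sup>2 (t2 - t1)\<close>.
\<close>

lemma support_spreads_quadratically:
  assumes t12: "0 \<le> t1" "t1 \<le> t2" "t2 \<le> T" and r: "r > 0"
    and init: "\<And>x. norm x \<ge> r \<Longrightarrow> R t1 x = 0"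
    and K: "K \<ge> 0" "\<And>t x. t \<in> {0..T} \<Longrightarrow> norm (U t x) \<le> K"
      "\<And>t x y. t \<in> {0..T} \<Longrightarrow> norm (U t x - U t y) \<le> K * norm (x - y)"
    and x: "norm x \<ge> r + K\<^sup>2 * (t2 - t1)\<^sup>2"
  shows "R t2 x = 0"
proof -
  let ?V = "K\<^sup>2 * (t2 - t1)"
  have speed: "norm (U t y) \<le> ?V" if t: "t1 \<le> t" "t \<le> t2" and y: "norm y \<ge> r" for t y
  proof -
    have tT: "t \<in> {0..T}" using t t12 by auto
    define \<rho> where "\<rho> = r + K * (t - t1)"
    have \<rho>: "\<rho> \<ge> r" "\<rho> > 0" using r K t by (auto simp: \<rho>_def add_pos_nonneg)
    have "R t z = 0" if "norm z > \<rho>" for z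
      by (rule support_spreads_at_boundary_speed[OF t12(1) t(1) _ K(1) init]) (use tT t12 K that in \<open>auto simp: \<rho>_def\<close>)
    then have Rz: "R t z = 0" if "norm z \<ge> \<rho>" for z using density_zero_at_radius[OF tT \<rho>(2) _ that] by blast
    have Uz: "U t z = 0" if "norm z \<ge> \<rho>" for z
      by (rule zero_on_sphere_if_zero_outside[OF continuous_U[OF tT] exterior_velocity_zero[OF tT \<rho>(2) Rz] \<rho>(2) that])
    show ?thesis
    proof (cases "norm y \<ge> \<rho>")
      case True
      then show ?thesis using Uz t t12 by simp
    next
      case False
      define z where "z = (\<rho> / norm y) *\<^sub>R y"
      have ny: "norm y > 0" using y r by linarith
      have "norm z = \<rho>" using ny \<rho> by (simp add: z_def)
      then have "U t z = 0" using Uz by simp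
      moreover have "norm (y - z) = \<rho> - norm y"
      proof -
        have "y - z = (1 - \<rho> / norm y) *\<^sub>R y" by (simp add: z_def algebra_simps)
        then have "norm (y - z) = \<bar>1 - \<rho> / norm y\<bar> * norm y" by (simp only: norm_scaleR)
        also have "\<dots> = \<rho> - norm y" using False ny by (simp add: abs_if field_simps)
        finally show ?thesis .
      qed
      ultimately have "norm (U t y) \<le> K * (\<rho> - norm y)" using K(3)[OF tT, of y z] by simp
      also have "\<dots> \<le> K * (K * (t2 - t1))"
      proof (rule mult_left_mono[OF _ K(1)])
        have "K * (t - t1) \<le> K * (t2 - t1)" using K(1) t by (intro mult_left_mono) auto
        then show "\<rho> - norm y \<le> K * (t2 - t1)" using y by (simp add: \<rho>_def)
      qed
      finally show ?thesis by (simp add: power2_eq_square mult.assoc)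
    qed
  qed
  have V: "?V \<ge> 0" using t12 by simp
  let ?r = "r + K\<^sup>2 * (t2 - t1)\<^sup>2"
  have "R t2 z = 0" if "norm z > ?r" for z
    by (rule support_spreads_at_boundary_speed[OF t12 V init speed]) (use that in \<open>auto simp: power2_eq_square mult.assoc\<close>)
  moreover have "?r > 0" using r by (simp add: add_pos_nonneg)
  ultimately show ?thesis using density_zero_at_radius[of t2 ?r x] t12 x by simp
qed

text \<open>
  After \<open>N\<close> steps of length \<open>t / N\<close> the radius has grown by at most
  \<open>K\<^sup>2 t\<^sup>2 / N\<close>.
\<close>

lemma support_does_not_spread:
  assumes r: "r > 0" and init: "\<And>x. norm x \<ge> r \<Longrightarrow> R 0 x = 0" and t: "t \<in> {0..T}" and x: "norm x > r"
  shows "R t x = 0"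
proof -
  obtain K where K: "K > 0" "\<And>t x. t \<in> {0..T} \<Longrightarrow> norm (U t x) \<le> K"
      "\<And>t x y. t \<in> {0..T} \<Longrightarrow> norm (U t x - U t y) \<le> K * norm (x - y)"
    using uniform_bounds by metis
  obtain N :: nat where N: "K\<^sup>2 * t\<^sup>2 / (norm x - r) < real N" using reals_Archimedean2 by blast
  have N0: "real N > 0" using N x by (smt (verit) divide_nonneg_pos zero_le_mult_iff zero_le_power2)
  define h where "h = t / real N"
  have h: "h \<ge> 0" using t N0 by (simp add: h_def)
  have "\<forall>x. norm x \<ge> r + real k * (K\<^sup>2 * h\<^sup>2) \<longrightarrow> R (real k * h) x = 0" if "k \<le> N" for k
    using that
  proof (induction k)
    case 0
    then show ?case using init by simp
  next
    case (Suc k)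
    have hT: "real (Suc k) * h \<le> T"
    proof -
      have "real (Suc k) * h \<le> real N * h" using Suc.prems h by (intro mult_right_mono) auto
      then show ?thesis using t N0 by (simp add: h_def)
    qed
    show ?case
    proof (intro allI impI)
      fix x :: "real^'n" assume x: "norm x \<ge> r + real (Suc k) * (K\<^sup>2 * h\<^sup>2)"
      show "R (real (Suc k) * h) x = 0"
      proof (rule support_spreads_quadratically[OF _ _ hT _ _ less_imp_le[OF K(1)] K(2,3)])
        show "0 \<le> real k * h" "real k * h \<le> real (Suc k) * h" using h by (auto simp: mult_right_mono)
        show "r + real k * (K\<^sup>2 * h\<^sup>2) > 0" using r by (intro add_pos_nonneg) auto
        show "R (real k * h) y = 0" if "norm y \<ge> r + real k * (K\<^sup>2 * h\<^sup>2)" for y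
          using Suc.IH Suc.prems that by simp
        show "norm x \<ge> r + real k * (K\<^sup>2 * h\<^sup>2) + K\<^sup>2 * (real (Suc k) * h - real k * h)\<^sup>2"
          using x by (simp add: algebra_simps)
      qed
    qed
  qed
  from this[of N] have "norm x \<ge> r + real N * (K\<^sup>2 * h\<^sup>2) \<longrightarrow> R (real N * h) x = 0" by simp
  moreover have "real N * h = t" using N0 by (simp add: h_def)
  moreover have "real N * (K\<^sup>2 * h\<^sup>2) \<le> norm x - r"
  proof -
    have "real N * (K\<^sup>2 * h\<^sup>2) = K\<^sup>2 * t\<^sup>2 / real N"
      using N0 by (simp add: h_def power2_eq_square)
    also have "\<dots> \<le> norm x - r" using N x N0 by (simp add: pos_divide_less_eq pos_divide_le_eq mult.commute)
    finally show ?thesis .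
  qed
  ultimately show ?thesis by simp
qed

end

section \<open>The virial identity\<close>

lemma derivative_integral_times_test:
  fixes F F' :: "real \<Rightarrow> real^'n::finite \<Rightarrow> real"
  assumes deriv: "\<And>t x. t \<in> {0..T} \<Longrightarrow> ((\<lambda>s. F s x) has_real_derivative F' t x) (at t within {0..T})"
    and cont: "\<And>t. t \<in> {0..T} \<Longrightarrow> continuous_on UNIV (F t)"
    and cont': "continuous_on ({0..T} \<times> UNIV) (\<lambda>(t, x). F' t x)"
    and \<phi>: "test_function \<phi>" and t: "t \<in> {0..T}"
  shows "((\<lambda>s. LINT x|lborel. F s x * \<phi> x) has_real_derivative (LINT x|lborel. F' t x * \<phi> x)) (at t within {0..T})"
proof -
  obtain B where B: "\<And>x. norm x > B \<Longrightarrow> \<phi> x = 0" by (rule test_function_vanishes[OF \<phi>]) auto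
  note c\<phi> = test_function_integrable(2)[OF \<phi>]
  show ?thesis
  proof (rule derivative_under_integral[where B = B])
    show "((\<lambda>s. F s x * \<phi> x) has_real_derivative F' t x * \<phi> x) (at t within {0..T})" if "t \<in> {0..T}" for t x
      by (rule DERIV_cmult_right[OF deriv[OF that]])
    have "continuous_on ({0..T} \<times> UNIV) (\<lambda>p. (case p of (t, x) \<Rightarrow> F' t x) * \<phi> (snd p))"
      by (intro continuous_on_mult cont' continuous_on_compose2[OF c\<phi>] continuous_on_snd continuous_on_id) auto
    then show "continuous_on ({0..T} \<times> UNIV) (\<lambda>(t, x). F' t x * \<phi> x)"
      by (simp add: case_prod_unfold)
    show "continuous_on UNIV (\<lambda>x. F t x * \<phi> x)" if "t \<in> {0..T}" for t
      by (intro continuous_on_mult cont that c\<phi>)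
  qed (use B t in auto)
qed

lemma pdiff_cong_open:
  assumes "open S" "x \<in> S" "\<And>y. y \<in> S \<Longrightarrow> f y = g y" "(g has_derivative g') (at x)"
  shows "pdiff i f x = g' (axis i 1)"
proof -
  have "(f has_derivative g') (at x)"
    by (rule has_derivative_transform_within_open[OF assms(4,1,2)]) (simp add: assms(3))
  then show ?thesis by (rule pdiff_has_derivative)
qed

lemma increment_lower_bound:
  fixes f :: "real \<Rightarrow> real"
  assumes "\<And>s. s \<in> {0..T} \<Longrightarrow> (f has_real_derivative f' s) (at s within {0..T})"
    and "\<And>s. s \<in> {0..T} \<Longrightarrow> f' s \<ge> 0" and t: "t \<in> {0..T}"
  shows "f 0 \<le> f t"
proof (cases "t = 0")
  case False
  then have "0 < t" using t by simp
  moreover have "(f has_derivative (*) (f' s)) (at s within {0..t})" if "0 \<le> s" "s \<le> t" for s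
    using has_field_derivative_subset[OF assms(1)[of s], of "{0..t}"] that t
    by (simp add: has_field_derivative_def)
  ultimately obtain s where s: "s \<in> {0<..<t}" "f t - f 0 = f' s * (t - 0)"
    using mvt_simple[of 0 t f "\<lambda>s. (*) (f' s)"] by blast
  have "f' s * (t - 0) \<ge> 0" using s(1) t assms(2)[of s] by (intro mult_nonneg_nonneg) auto
  then show ?thesis using s(2) by linarith
qed simp

text \<open>
  Equal to \<open>1\<close> on the ball of radius \<open>r + 1\<close>, an open neighbourhood of
  the closed ball of radius \<open>r\<close>; therefore its derivatives vanish on that closed
  ball.
\<close>

definition cutoff :: "real \<Rightarrow> real^'n::finite \<Rightarrow> real" where
  "cutoff r = smooth_box 1 (- vec (r + 2)) (vec (r + 2))"

lemma test_function_cutoff: "test_function (cutoff r)"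
  by (simp add: cutoff_def test_function_smooth_box)

lemma cutoff_eq_1: "norm x < r + 1 \<Longrightarrow> cutoff r x = 1"
proof -
  assume x: "norm x < r + 1"
  have "\<bar>x $ i\<bar> < r + 1" for i using component_le_norm_cart[of x i] x by linarith
  then show ?thesis unfolding cutoff_def
    by (intro smooth_box_eq_1) (simp_all add: abs_less_iff, (smt (verit))+)
qed

lemma cutoff_derivatives:
  fixes x :: "real^'n::finite"
  assumes x: "norm x < r + 1"
  shows "pdiff j (cutoff r) x = 0"
    and "pdiff j (\<lambda>x. x $ i * cutoff r x) x = (if i = j then 1 else 0)"
    and "pdiff k (pdiff j (\<lambda>x. x $ i * cutoff r x)) x = 0"
    and "pdiff j (\<lambda>x. (x \<bullet> x) * cutoff r x) x = 2 * x $ j"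
proof -
  let ?S = "ball 0 (r + 1) :: (real^'n) set"
  have S: "open ?S" "x \<in> ?S" using x by auto
  have one: "cutoff r y = 1" if "y \<in> ?S" for y using that by (intro cutoff_eq_1) simp
  have "pdiff j (cutoff r) x = (\<lambda>h. 0) (axis j 1)"
    by (rule pdiff_cong_open[OF S one has_derivative_const])
  then show "pdiff j (cutoff r) x = 0" by simp
  have 2: "pdiff j (\<lambda>x. x $ i * cutoff r x) y = (if i = j then 1 else 0)" if y: "y \<in> ?S" for y j
  proof -
    have "((\<lambda>y::real^'n. y $ i) has_derivative (\<lambda>h. h $ i)) (at y)"
      by (intro bounded_linear_imp_has_derivative bounded_linear_vec_nth)
    then have "pdiff j (\<lambda>x. x $ i * cutoff r x) y = axis j 1 $ i"
      by (intro pdiff_cong_open[OF S(1) y]) (simp_all add: one)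
    then show ?thesis by (simp add: axis_def)
  qed
  from 2[OF S(2)] show "pdiff j (\<lambda>x. x $ i * cutoff r x) x = (if i = j then 1 else 0)" .
  have "pdiff k (pdiff j (\<lambda>x. x $ i * cutoff r x)) x = (\<lambda>h. 0) (axis k 1)"
    by (rule pdiff_cong_open[OF S 2 has_derivative_const])
  then show "pdiff k (pdiff j (\<lambda>x. x $ i * cutoff r x)) x = 0" by simp
  have "((\<lambda>y::real^'n. y \<bullet> y) has_derivative (\<lambda>h. x \<bullet> h + h \<bullet> x)) (at x)"
    by (intro has_derivative_inner has_derivative_ident)
  then have "pdiff j (\<lambda>x. (x \<bullet> x) * cutoff r x) x = x \<bullet> axis j 1 + axis j 1 \<bullet> x"
    by (intro pdiff_cong_open[OF S]) (simp_all add: one)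
  then show "pdiff j (\<lambda>x. (x \<bullet> x) * cutoff r x) x = 2 * x $ j"
    by (simp add: inner_axis inner_axis')
qed

lemma test_function_coord_cutoff: "test_function (\<lambda>x. x $ i * cutoff r x)"
  by (rule test_function_mult[OF test_function_cutoff Ck_coord])

lemma test_function_square_cutoff: "test_function (\<lambda>x::real^'n::finite. (x \<bullet> x) * cutoff r x)"
proof (rule test_function_mult[OF test_function_cutoff])
  fix k
  have sum: "Ck k (\<lambda>x::real^'n. \<Sum>i\<in>I. x $ i * x $ i)" if "finite I" for I
    using that
  proof (induction I rule: finite_induct)
    case (insert j I)
    then show ?case by (simp add: Ck_add Ck_mult Ck_coord)
  qed (simp add: Ck_const)
  show "Ck k (\<lambda>x::real^'n. x \<bullet> x)" unfolding inner_vec_def using sum[of UNIV] by simp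
qed

context ns_flow
begin

text \<open>
  All integrands vanish outside the ball of radius \<open>r\<close>, and on that ball the cut-off
  test functions have the derivatives of \<open>1\<close>, \<open>|x|\<^sup>2\<close> and
  \<open>x\<^sub>i\<close>. Integrating \<open>J' \<ge> a M\<close> and \<open>I' = 2 J\<close>
  from \<open>0\<close> to \<open>T\<close> bounds \<open>I T\<close> from below, and \<open>|x|
  \<le> r\<close> bounds it from above by \<open>r\<^sup>2 M\<close>.
\<close>

theorem virial_bound:
  assumes a: "a > 0" and r: "r > 0" and init: "\<And>x. norm x \<ge> r \<Longrightarrow> R 0 x = 0" and nonneg: "\<And>x. R 0 x \<ge> 0"
  defines "M \<equiv> LINT x|lborel. R 0 x * cutoff r x"
    and "J \<equiv> \<Sum>i\<in>UNIV. LINT x|lborel. R 0 x * U 0 x $ i * (x $ i * cutoff r x)"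
  shows "2 * J * T + a * M * T\<^sup>2 \<le> r\<^sup>2 * M"
proof -
  let ?\<chi> = "cutoff r :: real^'n \<Rightarrow> real"
  note tests = test_function_cutoff[of r] test_function_coord_cutoff[of _ r] test_function_square_cutoff[of r]
  have R0: "R t x = 0" if "t \<in> {0..T}" "norm x > r" for t x
    by (rule support_does_not_spread[OF r init that])
  have U0: "U t x = 0" if t: "t \<in> {0..T}" and "norm x > r" for t x
    by (rule exterior_velocity_zero[OF t r density_zero_at_radius[OF t r R0[OF t]] that(2)])
  have R_nn: "R t x \<ge> 0" if "t \<in> {0..T}" for t x by (rule density_nonneg[OF nonneg that])
  note cR = C1_gradD(3)[OF R_C1] and cU = C1_gradD(3)[OF U_C1]
  define Mt where "Mt t = (LINT x|lborel. R t x * ?\<chi> x)" for t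
  define It where "It t = (LINT x|lborel. R t x * ((x \<bullet> x) * ?\<chi> x))" for t
  define Jt where "Jt t = (\<Sum>i\<in>UNIV. LINT x|lborel. R t x * U t x $ i * (x $ i * ?\<chi> x))" for t
  have dR: "((\<lambda>s. LINT x|lborel. R s x * \<phi> x) has_real_derivative (LINT x|lborel. R' t x * \<phi> x)) (at t within {0..T})"
    if "test_function \<phi>" "t \<in> {0..T}" for \<phi> t
    by (rule derivative_integral_times_test[OF classical_fieldD(2)[OF R_field] cR classical_fieldD(5)[OF R_field] that])
  have M_deriv: "(Mt has_real_derivative 0) (at t within {0..T})" if t: "t \<in> {0..T}" for t
  proof -
    have "(\<lambda>x. R t x * U t x $ j * pdiff j ?\<chi> x) = (\<lambda>x. 0)" for j
    proof
      fix x show "R t x * U t x $ j * pdiff j ?\<chi> x = 0"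
        using R0[OF t, of x] cutoff_derivatives(1)[of x r j] by (cases "norm x > r") auto
    qed
    then have "(LINT x|lborel. R' t x * ?\<chi> x) = 0" using mass[OF t tests(1)] by simp
    then show ?thesis using dR[OF tests(1) t] unfolding Mt_def by simp
  qed
  have M_const: "Mt t = M" if t: "t \<in> {0..T}" for t
  proof -
    have "\<exists>c. \<forall>t\<in>{0..T}. Mt t = c"
      by (rule has_field_derivative_zero_constant[OF convex_real_interval(5) M_deriv])
    then have "Mt t = Mt 0" using t T_pos by auto
    then show ?thesis by (simp add: Mt_def M_def)
  qed
  have I_deriv: "(It has_real_derivative 2 * Jt t) (at t within {0..T})" if t: "t \<in> {0..T}" for t
  proof -
    have "(\<lambda>x. R t x * U t x $ j * pdiff j (\<lambda>x. (x \<bullet> x) * ?\<chi> x) x) = (\<lambda>x. 2 * (R t x * U t x $ j * (x $ j * ?\<chi> x)))" for j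
    proof
      fix x show "R t x * U t x $ j * pdiff j (\<lambda>x. (x \<bullet> x) * ?\<chi> x) x = 2 * (R t x * U t x $ j * (x $ j * ?\<chi> x))"
        using R0[OF t, of x] cutoff_derivatives(4)[of x r j] cutoff_eq_1[of x r] by (cases "norm x > r") auto
    qed
    then have "(LINT x|lborel. R' t x * ((x \<bullet> x) * ?\<chi> x)) = 2 * Jt t"
      using mass[OF t tests(3)] by (simp add: Jt_def sum_distrib_left)
    then show ?thesis using dR[OF tests(3) t] unfolding It_def by simp
  qed
  define E where "E t = (\<Sum>i\<in>UNIV. LINT x|lborel. R t x * (U t x $ i)\<^sup>2 * ?\<chi> x)" for t
  have J_deriv: "(Jt has_real_derivative E t + a * real CARD('n) * M) (at t within {0..T})" if t: "t \<in> {0..T}" for t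
  proof -
    have d: "((\<lambda>t. LINT x|lborel. R t x * U t x $ i * (x $ i * ?\<chi> x)) has_real_derivative
        (LINT x|lborel. (R' t x * U t x $ i + R t x * U' i t x) * (x $ i * ?\<chi> x))) (at t within {0..T})" for i
    proof (rule derivative_integral_times_test[OF _ _ _ tests(2) t])
      show "((\<lambda>s. R s x * U s x $ i) has_real_derivative R' t x * U t x $ i + R t x * U' i t x) (at t within {0..T})"
        if "t \<in> {0..T}" for t x
        by (rule DERIV_cong[OF DERIV_mult[OF classical_fieldD(2)[OF R_field that] classical_fieldD(2)[OF U_field that]]])
           (simp add: algebra_simps)
      show "continuous_on UNIV (\<lambda>x. R t x * U t x $ i)" if "t \<in> {0..T}" for t
        by (intro continuous_on_mult cR cU that)
      show "continuous_on ({0..T} \<times> UNIV) (\<lambda>(t, x). R' t x * U t x $ i + R t x * U' i t x)"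
        using classical_fieldD(3,5)[OF R_field] classical_fieldD(3,5)[OF U_field]
        unfolding case_prod_unfold by (intro continuous_on_add continuous_on_mult) auto
    qed
    have rhs: "(LINT x|lborel. (R' t x * U t x $ i + R t x * U' i t x) * (x $ i * ?\<chi> x))
        = (LINT x|lborel. R t x * (U t x $ i)\<^sup>2 * ?\<chi> x) + a * M" for i
    proof -
      have 1: "(\<lambda>x. R t x * U t x $ i * U t x $ j * pdiff j (\<lambda>x. x $ i * ?\<chi> x) x)
          = (\<lambda>x. if i = j then R t x * (U t x $ i)\<^sup>2 * ?\<chi> x else 0)" for j
      proof
        fix x show "R t x * U t x $ i * U t x $ j * pdiff j (\<lambda>x. x $ i * ?\<chi> x) x
          = (if i = j then R t x * (U t x $ i)\<^sup>2 * ?\<chi> x else 0)"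
          using R0[OF t, of x] cutoff_derivatives(2)[of x r j i] cutoff_eq_1[of x r]
          by (cases "norm x > r") (auto simp: power2_eq_square)
      qed
      have 2: "(\<lambda>x. U t x $ k * pdiff j (pdiff l (\<lambda>x. x $ i * ?\<chi> x)) x) = (\<lambda>x. 0)" for j k l
      proof
        fix x show "U t x $ k * pdiff j (pdiff l (\<lambda>x. x $ i * ?\<chi> x)) x = 0"
          using U0[OF t, of x] cutoff_derivatives(3)[of x r j l i] by (cases "norm x > r") auto
      qed
      have 3: "(\<lambda>x. R t x * pdiff i (\<lambda>x. x $ i * ?\<chi> x) x) = (\<lambda>x. R t x * ?\<chi> x)"
      proof
        fix x show "R t x * pdiff i (\<lambda>x. x $ i * ?\<chi> x) x = R t x * ?\<chi> x"
          using R0[OF t, of x] cutoff_derivatives(2)[of x r i i] cutoff_eq_1[of x r] by (cases "norm x > r") auto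
      qed
      have "(\<Sum>j\<in>UNIV. LINT x|lborel. (if i = j then R t x * (U t x $ i)\<^sup>2 * ?\<chi> x else 0))
        = (\<Sum>j\<in>UNIV. if i = j then (LINT x|lborel. R t x * (U t x $ i)\<^sup>2 * ?\<chi> x) else 0)"
        by (intro sum.cong) auto
      also have "\<dots> = (LINT x|lborel. R t x * (U t x $ i)\<^sup>2 * ?\<chi> x)" by simp
      finally show ?thesis
        using momentum[OF t tests(2), of i i] M_const[OF t] unfolding 1 2 3 Mt_def by simp
    qed
    show ?thesis
      using DERIV_sum[of UNIV "\<lambda>t i. LINT x|lborel. R t x * U t x $ i * (x $ i * ?\<chi> x)", OF d]
      unfolding rhs Jt_def E_def by (simp add: sum.distrib mult_ac)
  qed
  have E_nn: "E t \<ge> 0" if "t \<in> {0..T}" for t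
    unfolding E_def using R_nn[OF that]
    by (intro sum_nonneg integral_nonneg_AE AE_I2 mult_nonneg_nonneg) (auto simp: cutoff_def smooth_box_bounds)
  have intR: "integrable lborel (\<lambda>x. R t x * ?\<chi> x)" if "t \<in> {0..T}" for t
    by (rule integrable_continuous_times_test[OF cR[OF that] tests(1)])
  have \<chi>_nn: "?\<chi> x \<ge> 0" for x by (simp add: cutoff_def smooth_box_bounds)
  have T0: "0 \<in> {0..T}" "T \<in> {0..T}" using T_pos by auto
  have M_nn: "M \<ge> 0"
    unfolding M_def by (intro integral_nonneg_AE AE_I2 mult_nonneg_nonneg nonneg \<chi>_nn)
  have n1: "a * M \<le> a * real CARD('n) * M"
    using a M_nn dim by (auto simp: mult_right_mono)
  have J_lower: "J + a * M * t \<le> Jt t" if t: "t \<in> {0..T}" for t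
  proof -
    have "Jt 0 - a * M * 0 \<le> Jt t - a * M * t"
    proof (rule increment_lower_bound[where f = "\<lambda>t. Jt t - a * M * t", OF _ _ t])
      show "((\<lambda>t. Jt t - a * M * t) has_real_derivative E s + a * real CARD('n) * M - a * M) (at s within {0..T})"
        if "s \<in> {0..T}" for s
        using DERIV_diff[OF J_deriv[OF that] DERIV_cmult[OF DERIV_ident, of "a * M"]] by simp
      show "E s + a * real CARD('n) * M - a * M \<ge> 0" if "s \<in> {0..T}" for s
        using E_nn[OF that] n1 by linarith
    qed
    then show ?thesis by (simp add: Jt_def J_def)
  qed
  have "It 0 - (2 * J * 0 + a * M * 0\<^sup>2) \<le> It T - (2 * J * T + a * M * T\<^sup>2)"
  proof (rule increment_lower_bound[where f = "\<lambda>t. It t - (2 * J * t + a * M * t\<^sup>2)", OF _ _ T0(2)])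
    show "((\<lambda>t. It t - (2 * J * t + a * M * t\<^sup>2)) has_real_derivative 2 * Jt s - (2 * J + a * M * (2 * s))) (at s within {0..T})"
      if "s \<in> {0..T}" for s
    proof -
      have "((\<lambda>t. 2 * J * t + a * M * t\<^sup>2) has_real_derivative 2 * J + a * M * (2 * s)) (at s within {0..T})"
        by (rule derivative_eq_intros refl | simp)+
      then show ?thesis by (rule DERIV_diff[OF I_deriv[OF that]])
    qed
    show "2 * Jt s - (2 * J + a * M * (2 * s)) \<ge> 0" if "s \<in> {0..T}" for s
      using J_lower[OF that] by simp
  qed
  moreover have "It 0 \<ge> 0"
    unfolding It_def by (intro integral_nonneg_AE AE_I2 mult_nonneg_nonneg nonneg \<chi>_nn) simp
  moreover have "It T \<le> r\<^sup>2 * Mt T"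
  proof -
    have "It T \<le> (LINT x|lborel. r\<^sup>2 * (R T x * ?\<chi> x))"
      unfolding It_def
    proof (rule integral_mono)
      show "integrable lborel (\<lambda>x. R T x * ((x \<bullet> x) * ?\<chi> x))"
        by (rule integrable_continuous_times_test[OF cR[OF T0(2)] tests(3)])
      show "integrable lborel (\<lambda>x. r\<^sup>2 * (R T x * ?\<chi> x))" by (intro integrable_mult_right intR T0)
      show "R T x * ((x \<bullet> x) * ?\<chi> x) \<le> r\<^sup>2 * (R T x * ?\<chi> x)" for x
      proof (cases "norm x > r")
        case False
        then have "x \<bullet> x \<le> r\<^sup>2" by (simp add: power2_norm_eq_inner[symmetric] power_mono)
        then have "(x \<bullet> x) * (R T x * ?\<chi> x) \<le> r\<^sup>2 * (R T x * ?\<chi> x)"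
          by (intro mult_right_mono mult_nonneg_nonneg R_nn T0 \<chi>_nn)
        then show ?thesis by (simp only: mult.left_commute)
      qed (use R0[OF T0(2)] in simp)
    qed
    then show ?thesis by (simp add: Mt_def)
  qed
  ultimately show ?thesis using M_const[OF T0(2)] by simp
qed

end

section \<open>From distributional solutions to the contradiction\<close>

lemma dist_of_eq_integral:
  fixes f F :: "real^'n::finite \<Rightarrow> real"
  assumes "f \<in> borel_measurable borel" "continuous_on UNIV F" "AE x in lborel. f x = F x" "test_function \<phi>"
  shows "dist_of f \<phi> = (LINT x|lborel. F x * \<phi> x)"
  unfolding dist_of_def
proof (rule integral_cong_AE)
  have [measurable]: "\<phi> \<in> borel_measurable borel" "F \<in> borel_measurable borel"
    using test_function_integrable(2)[OF assms(4)] assms(2) by (auto intro: borel_measurable_continuous_onI)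
  note [measurable] = assms(1)
  show "(\<lambda>x. f x * \<phi> x) \<in> borel_measurable lborel" "(\<lambda>x. F x * \<phi> x) \<in> borel_measurable lborel" by measurable
  show "AE x in lborel. f x * \<phi> x = F x * \<phi> x" using assms(3) by eventually_elim simp
qed

lemma time_deriv_eq_integral:
  fixes f F F' :: "real \<Rightarrow> real^'n::finite \<Rightarrow> real"
  assumes T: "T > 0" and t: "t \<in> {0..T}" and \<phi>: "test_function \<phi>"
    and meas: "\<And>t. t \<in> {0..T} \<Longrightarrow> f t \<in> borel_measurable borel"
    and eq: "\<And>t. t \<in> {0..T} \<Longrightarrow> AE x in lborel. f t x = F t x"
    and deriv: "\<And>t x. t \<in> {0..T} \<Longrightarrow> ((\<lambda>s. F s x) has_real_derivative F' t x) (at t within {0..T})"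
    and cont: "\<And>t. t \<in> {0..T} \<Longrightarrow> continuous_on UNIV (F t)"
    and cont': "continuous_on ({0..T} \<times> UNIV) (\<lambda>(t, x). F' t x)"
  shows "time_deriv T f t \<phi> = (LINT x|lborel. F' t x * \<phi> x)"
proof -
  have "((\<lambda>s. LINT x|lborel. F s x * \<phi> x) has_real_derivative (LINT x|lborel. F' t x * \<phi> x)) (at t within {0..T})"
    by (rule derivative_integral_times_test[OF deriv cont cont' \<phi> t])
  then have "((\<lambda>s. dist_of (f s) \<phi>) has_real_derivative (LINT x|lborel. F' t x * \<phi> x)) (at t within {0..T})"
    by (rule has_field_derivative_transform_within[OF _ zero_less_one t])
       (rule dist_of_eq_integral[OF meas cont eq \<phi>, symmetric])
  then show ?thesis
    unfolding time_deriv_def has_real_derivative_iff_has_vector_derivative cbox_interval[symmetric]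
    by (rule vector_derivative_within_cbox[rotated 2]) (use T t in auto)
qed

lemma choose3:
  assumes "\<And>i. \<exists>x y z. P i x y z"
  obtains f g h where "\<And>i. P i (f i) (g i) (h i)"
proof -
  have "\<exists>f. \<forall>i. \<exists>y z. P i (f i) y z" by (rule choice) (rule allI, rule assms)
  then obtain f where "\<forall>i. \<exists>y z. P i (f i) y z" ..
  then have "\<exists>g. \<forall>i. \<exists>z. P i (f i) (g i) z" by (rule choice)
  then obtain g where "\<forall>i. \<exists>z. P i (f i) (g i) z" ..
  then have "\<exists>h. \<forall>i. P i (f i) (g i) (h i)" by (rule choice)
  then show ?thesis using that by blast
qed

lemma C1_sobolev_imp_L2:
  assumes "C1_sobolev m T f" "t \<in> {0..T}"
  shows "L2_function (f t)"
  using assms unfolding C1_sobolev_def sobolev_def by (elim exE) (drule (1) bspec, simp)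

text \<open>
  The distributions depend on the fields only up to null sets, so the continuous representatives
  can be substituted, and the time derivatives of the pairings are computed under the integral.
\<close>

lemma NS_solution_imp_ns_flow:
  fixes \<rho> :: "real \<Rightarrow> real^'n::finite \<Rightarrow> real" and u :: "real \<Rightarrow> real^'n \<Rightarrow> real^'n"
  assumes n: "CARD('n) \<in> {1, 2}" and m: "m > 2" and T: "T > 0" and visc: "lam + 2 * \<mu> > 0"
    and sol: "NS_solution a \<mu> lam m T \<rho>0 u0 \<rho> u"
    and sym: "\<And>t. CARD('n) = 2 \<Longrightarrow> t \<in> {0..T} \<Longrightarrow> spherically_symmetric (\<rho> t) (u t)"
  shows "\<exists>R DR R' U DU U'. ns_flow T a \<mu> lam R DR R' U DU U' \<and>
    (AE x in lborel. \<rho> 0 x = R 0 x) \<and> (AE x in lborel. u 0 x = U 0 x)"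
proof -
  let ?S = "{0..T}"
  have n2: "CARD('n) \<le> 2" using n by auto
  have \<rho>C: "C1_sobolev m T \<rho>" and uC: "\<And>i. C1_sobolev m T (\<lambda>t x. u t x $ i)"
    and mass: "mass_equation T \<rho> u" and mom: "momentum_equation a \<mu> lam T \<rho> u"
    using sol by (auto simp: NS_solution_def)
  note L2 = C1_sobolev_imp_L2
  have meas: "f t \<in> borel_measurable borel" if "C1_sobolev m T f" "t \<in> ?S" for f :: "real \<Rightarrow> real^'n \<Rightarrow> real" and t
    using L2[OF that] by (simp add: L2_function_def)
  obtain R DR R' where R: "classical_field T R DR R'" "\<And>t. t \<in> ?S \<Longrightarrow> AE x in lborel. \<rho> t x = R t x"
    using C1_sobolev_imp_classical_field[OF n2 m T \<rho>C] by blast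
  have ex: "\<exists>F DF F'. classical_field T F DF F' \<and> (\<forall>t\<in>?S. AE x in lborel. u t x $ i = F t x)" for i
    by (rule C1_sobolev_imp_classical_field[OF n2 m T uC])
  obtain V DU U' where VDU: "\<And>i. classical_field T (V i) (DU i) (U' i) \<and> (\<forall>t\<in>?S. AE x in lborel. u t x $ i = V i t x)"
  proof (rule choose3[of "\<lambda>i F DF F'. classical_field T F DF F' \<and> (\<forall>t\<in>?S. AE x in lborel. u t x $ i = F t x)", OF ex])
    fix V DU U'
    assume "\<And>i. classical_field T (V i) (DU i) (U' i) \<and> (\<forall>t\<in>?S. AE x in lborel. u t x $ i = V i t x)"
    then show thesis by (rule that)
  qed
  have V: "classical_field T (V i) (DU i) (U' i)" for i using VDU[of i] by (rule conjunct1)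
  have Vu: "AE x in lborel. u t x $ i = V i t x" if "t \<in> ?S" for i t
    using VDU[of i, THEN conjunct2] that by (rule bspec)
  define U where "U t x = (\<chi> i. V i t x)" for t x
  have Ui: "(\<lambda>t x. U t x $ i) = V i" for i by (simp add: U_def)
  have Uc: "U t x $ i = V i t x" for t x i by (simp add: U_def)
  have uU: "AE x in lborel. u t x = U t x" if t: "t \<in> ?S" for t
  proof -
    have "AE x in lborel. \<forall>i. u t x $ i = V i t x"
      by (rule eventually_all_finite) (rule Vu[OF t])
    then show ?thesis by eventually_elim (simp add: vec_eq_iff Uc)
  qed
  note cR = C1_gradD(3)[OF classical_fieldD(1)[OF R(1)]] and cV = C1_gradD(3)[OF classical_fieldD(1)[OF V]]
  note m\<rho> = meas[OF \<rho>C] and mu = meas[OF uC]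
  have d\<rho>u: "dist_of (\<lambda>x. \<rho> t x * u t x $ j) \<psi> = (LINT x|lborel. R t x * U t x $ j * \<psi> x)"
    if t: "t \<in> ?S" and "test_function \<psi>" for t j \<psi>
  proof (rule dist_of_eq_integral[OF _ _ _ that(2)])
    show "(\<lambda>x. \<rho> t x * u t x $ j) \<in> borel_measurable borel"
      by (intro borel_measurable_times m\<rho>[OF t] mu[OF t])
    show "continuous_on UNIV (\<lambda>x. R t x * U t x $ j)" unfolding Uc by (intro continuous_on_mult cR cV t)
    show "AE x in lborel. \<rho> t x * u t x $ j = R t x * U t x $ j"
      using R(2)[OF t] Vu[OF t, of j] by eventually_elim (simp add: Uc)
  qed
  have d\<rho>uu: "dist_of (\<lambda>x. \<rho> t x * u t x $ i * u t x $ j) \<psi> = (LINT x|lborel. R t x * U t x $ i * U t x $ j * \<psi> x)"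
    if t: "t \<in> ?S" and "test_function \<psi>" for t i j \<psi>
  proof (rule dist_of_eq_integral[OF _ _ _ that(2)])
    show "(\<lambda>x. \<rho> t x * u t x $ i * u t x $ j) \<in> borel_measurable borel"
      by (intro borel_measurable_times m\<rho>[OF t] mu[OF t])
    show "continuous_on UNIV (\<lambda>x. R t x * U t x $ i * U t x $ j)" unfolding Uc by (intro continuous_on_mult cR cV t)
    show "AE x in lborel. \<rho> t x * u t x $ i * u t x $ j = R t x * U t x $ i * U t x $ j"
      using R(2)[OF t] Vu[OF t, of j] Vu[OF t, of i] by eventually_elim (simp add: Uc)
  qed
  have du: "dist_of (\<lambda>x. u t x $ j) \<psi> = (LINT x|lborel. U t x $ j * \<psi> x)"
    if t: "t \<in> ?S" and "test_function \<psi>" for t j \<psi>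
    unfolding Uc by (rule dist_of_eq_integral[OF mu[OF t] cV[OF t] Vu[OF t] that(2)])
  have da\<rho>: "dist_of (\<lambda>x. a * \<rho> t x) \<psi> = a * (LINT x|lborel. R t x * \<psi> x)"
    if t: "t \<in> ?S" and "test_function \<psi>" for t \<psi>
    using dist_of_eq_integral[OF m\<rho>[OF t] cR[OF t] R(2)[OF t] that(2)] by (simp add: dist_of_def mult.assoc)
  have "ns_flow T a \<mu> lam R DR R' U DU U'"
  proof
    show "T > 0" "lam + 2 * \<mu> > 0" "CARD('n) = 1 \<or> CARD('n) = 2" using T visc n by auto
    show "classical_field T R DR R'" by (rule R(1))
    show "classical_field T (\<lambda>t x. U t x $ i) (DU i) (U' i)" for i unfolding Ui by (rule V)
    show "integrable lborel (\<lambda>x. (U t x $ i)\<^sup>2)" if t: "t \<in> ?S" for t i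
    proof -
      have "integrable lborel (\<lambda>x. (u t x $ i)\<^sup>2)" using L2[OF uC t] by (simp add: L2_function_def)
      then show ?thesis
      proof (rule integrable_cong_AE_imp)
        show "(\<lambda>x. (U t x $ i)\<^sup>2) \<in> borel_measurable lborel"
          unfolding Uc using cV[OF t] by (simp add: borel_measurable_continuous_onI continuous_on_power)
        show "AE x in lborel. (u t x $ i)\<^sup>2 = (U t x $ i)\<^sup>2"
          using Vu[OF t, of i] by eventually_elim (simp add: Uc)
      qed
    qed
    show "(LINT x|lborel. R' t x * \<phi> x) = (\<Sum>j\<in>UNIV. LINT x|lborel. R t x * U t x $ j * pdiff j \<phi> x)"
      if t: "t \<in> ?S" and \<phi>: "test_function \<phi>" for t \<phi>
    proof -
      have "time_deriv T \<rho> t \<phi> = (LINT x|lborel. R' t x * \<phi> x)"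
        by (rule time_deriv_eq_integral[OF T t \<phi> m\<rho> R(2) classical_fieldD(2)[OF R(1)] cR classical_fieldD(5)[OF R(1)]])
      moreover have "time_deriv T \<rho> t \<phi> + (\<Sum>j\<in>UNIV. dist_deriv j (dist_of (\<lambda>x. \<rho> t x * u t x $ j)) \<phi>) = 0"
        using mass t \<phi> unfolding mass_equation_def by blast
      ultimately show ?thesis
        unfolding dist_deriv_def using d\<rho>u[OF t test_function_pdiff[OF \<phi>]] by (simp add: sum_negf)
    qed
    show "(LINT x|lborel. (R' t x * U t x $ i + R t x * U' i t x) * \<phi> x) =
        (\<Sum>j\<in>UNIV. LINT x|lborel. R t x * U t x $ i * U t x $ j * pdiff j \<phi> x)
        + \<mu> * (\<Sum>j\<in>UNIV. LINT x|lborel. U t x $ i * pdiff j (pdiff j \<phi>) x)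
        + (lam + \<mu>) * (\<Sum>j\<in>UNIV. LINT x|lborel. U t x $ j * pdiff j (pdiff i \<phi>) x)
        + a * (LINT x|lborel. R t x * pdiff i \<phi> x)"
      if t: "t \<in> ?S" and \<phi>: "test_function \<phi>" for t i \<phi>
    proof -
      note t1 = test_function_pdiff[OF \<phi>] and t2 = test_function_pdiff[OF test_function_pdiff[OF \<phi>]]
      have td: "time_deriv T (\<lambda>s x. \<rho> s x * u s x $ i) t \<phi> = (LINT x|lborel. (R' t x * U t x $ i + R t x * U' i t x) * \<phi> x)"
      proof (rule time_deriv_eq_integral[OF T t \<phi>, where F = "\<lambda>t x. R t x * V i t x"])
        show "(\<lambda>x. \<rho> t x * u t x $ i) \<in> borel_measurable borel" if "t \<in> ?S" for t
          by (intro borel_measurable_times m\<rho> mu that)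
        show "AE x in lborel. \<rho> t x * u t x $ i = R t x * V i t x" if "t \<in> ?S" for t
          using R(2)[OF that] Vu[OF that, of i] by eventually_elim simp
        show "((\<lambda>s. R s x * V i s x) has_real_derivative R' t x * U t x $ i + R t x * U' i t x) (at t within ?S)"
          if "t \<in> ?S" for t x
          unfolding Uc
          by (rule DERIV_cong[OF DERIV_mult[OF classical_fieldD(2)[OF R(1) that] classical_fieldD(2)[OF V(1) that]]])
             (simp add: algebra_simps)
        show "continuous_on UNIV (\<lambda>x. R t x * V i t x)" if "t \<in> ?S" for t
          by (intro continuous_on_mult cR cV that)
        show "continuous_on (?S \<times> UNIV) (\<lambda>(t, x). R' t x * U t x $ i + R t x * U' i t x)"
          using classical_fieldD(3,5)[OF R(1)] classical_fieldD(3,5)[OF V[of i]]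
          unfolding Uc case_prod_unfold by (intro continuous_on_add continuous_on_mult) auto
      qed
      have "time_deriv T (\<lambda>s x. \<rho> s x * u s x $ i) t \<phi>
        + (\<Sum>j\<in>UNIV. dist_deriv j (dist_of (\<lambda>x. \<rho> t x * u t x $ i * u t x $ j)) \<phi>)
        - \<mu> * (\<Sum>j\<in>UNIV. dist_deriv j (dist_deriv j (dist_of (\<lambda>x. u t x $ i))) \<phi>)
        - (lam + \<mu>) * dist_deriv i (\<lambda>\<psi>. \<Sum>j\<in>UNIV. dist_deriv j (dist_of (\<lambda>x. u t x $ j)) \<psi>) \<phi>
        + dist_deriv i (dist_of (\<lambda>x. a * \<rho> t x)) \<phi> = 0"
        using mom t \<phi> unfolding momentum_equation_def by blast
      then show ?thesis
        unfolding td dist_deriv_def d\<rho>uu[OF t t1] du[OF t t2] da\<rho>[OF t t1]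
        by (simp add: sum_negf)
    qed
    show "\<exists>w. AE x in lborel. U t x = w (norm x) *\<^sub>R (x /\<^sub>R norm x)"
      if n2: "CARD('n) = 2" and t: "t \<in> ?S" for t
    proof -
      obtain rb w where "AE x in lborel. \<rho> t x = rb (norm x) \<and> u t x = w (norm x) *\<^sub>R (x /\<^sub>R norm x)"
        using sym[OF n2 t] unfolding spherically_symmetric_def by blast
      with uU[OF t] have "AE x in lborel. U t x = w (norm x) *\<^sub>R (x /\<^sub>R norm x)"
        by eventually_elim simp
      then show ?thesis by blast
    qed
  qed
  moreover have "0 \<in> ?S" using T by simp
  ultimately show ?thesis using R(2) uU by blast
qed

lemma AE_zero_outside_imp_zero_outside:
  fixes F :: "real^'n::finite \<Rightarrow> real"
  assumes F: "continuous_on UNIV F" and zero: "AE x in lborel. norm x > r \<longrightarrow> F x = 0" and x: "norm x > r"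
  shows "F x = 0"
proof -
  \<comment> \<open>A continuous weight that is positive exactly in the exterior replaces the condition on \<open>x\<close>.\<close>
  have "(\<lambda>x. max 0 (norm x - r) * F x) = (\<lambda>x. 0)"
  proof (rule AE_eq_continuous)
    show "AE x in lborel. max 0 (norm x - r) * F x = 0"
      using zero
    proof eventually_elim
      case (elim x)
      then show ?case by (cases "norm x > r") simp_all
    qed
    show "continuous_on UNIV (\<lambda>x. max 0 (norm x - r) * F x)"
      by (rule continuous_on_mult[OF continuous_on_max[OF continuous_on_const
            continuous_on_diff[OF continuous_on_norm[OF continuous_on_id] continuous_on_const]] F])
  qed (rule continuous_on_const)
  from fun_cong[OF this, of x] show ?thesis using x by simp
qed

lemma AE_nonneg_imp_nonneg:
  fixes F :: "real^'n::finite \<Rightarrow> real"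
  assumes F: "continuous_on UNIV F" and nonneg: "AE x in lborel. F x \<ge> 0"
  shows "F x \<ge> 0"
proof -
  have "AE x in lborel. max 0 (F x) = F x" using nonneg by eventually_elim simp
  then have "(\<lambda>x. max 0 (F x)) = F"
    by (rule AE_eq_continuous[OF _ continuous_on_max[OF continuous_on_const F] F])
  from fun_cong[OF this, of x] show ?thesis by simp
qed

theorem theorem1p1:
  fixes a \<mu> lam m :: real
    and \<rho>0 :: "real^'n::finite \<Rightarrow> real"
    and u0 :: "real^'n \<Rightarrow> real^'n"
  assumes "CARD('n) \<in> {1, 2}"
    and "a > 0"
    and "\<mu> > 0"
    and "lam + 2 / real CARD('n) * \<mu> > 0"
    and "m > 2"
    and "\<forall>x. \<rho>0 x \<ge> 0"
    and "compact (closure {x. \<rho>0 x \<noteq> 0})"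
    and "\<not> (AE x in lborel. \<rho>0 x = 0)"
    and "CARD('n) = 1 \<or> (CARD('n) = 2 \<and> spherically_symmetric \<rho>0 u0)"
  shows "\<not> (\<exists>\<rho> u. (\<forall>T>0. NS_solution a \<mu> lam m T \<rho>0 u0 \<rho> u) \<and>
                (CARD('n) = 2 \<longrightarrow> (\<forall>t\<ge>0. spherically_symmetric (\<rho> t) (u t))))"
proof
  assume "\<exists>\<rho> u. (\<forall>T>0. NS_solution a \<mu> lam m T \<rho>0 u0 \<rho> u) \<and>
                (CARD('n) = 2 \<longrightarrow> (\<forall>t\<ge>0. spherically_symmetric (\<rho> t) (u t)))"
  then obtain \<rho> u where sol: "\<And>T. T > 0 \<Longrightarrow> NS_solution a \<mu> lam m T \<rho>0 u0 \<rho> u"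
    and sym: "\<And>t. CARD('n) = 2 \<Longrightarrow> t \<ge> 0 \<Longrightarrow> spherically_symmetric (\<rho> t) (u t)"
    by blast
  have visc: "lam + 2 * \<mu> > 0" using assms(1,3,4) by auto
  have flow: "\<exists>R DR R' U DU U'. ns_flow T a \<mu> lam R DR R' U DU U' \<and>
    (AE x in lborel. \<rho> 0 x = R 0 x) \<and> (AE x in lborel. u 0 x = U 0 x)" if "T > 0" for T
    by (rule NS_solution_imp_ns_flow[OF assms(1,5) that visc sol[OF that]]) (use sym in auto)
  have \<rho>\<rho>0: "AE x in lborel. \<rho> 0 x = \<rho>0 x" using sol[OF zero_less_one] by (simp add: NS_solution_def)
  have C1: "C1_sobolev m 1 \<rho>" "C1_sobolev m 1 (\<lambda>t x. u t x $ i)" for i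
    using sol[OF zero_less_one] unfolding NS_solution_def by blast+
  have "0 \<in> {0..1::real}" by simp
  note L2 = C1_sobolev_imp_L2[OF C1(1) this] C1_sobolev_imp_L2[OF C1(2) this]
  have m\<rho>: "\<rho> 0 \<in> borel_measurable borel" and mu: "(\<lambda>x. u 0 x $ i) \<in> borel_measurable borel" for i
    using L2(1) L2(2)[of i] by (simp_all add: L2_function_def)
  have "bounded {x. \<rho>0 x \<noteq> 0}"
    using assms(7) bounded_subset[OF compact_imp_bounded closure_subset] by blast
  then obtain r0 where r0: "\<And>x. \<rho>0 x \<noteq> 0 \<Longrightarrow> norm x \<le> r0" by (auto simp: bounded_iff)
  \<comment> \<open>Positive and strictly larger than \<open>r0\<close>, so that the density already vanishes on the sphere of radius \<open>r\<close>.\<close>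
  define r where "r = \<bar>r0\<bar> + 1"
  have r: "r > 0" by (simp add: r_def)
  \<comment> \<open>Expressed by the given solution and not by a representative, so that these numbers do not depend on \<open>T\<close>.\<close>
  define M where "M = dist_of (\<rho> 0) (cutoff r)"
  define J where "J = (\<Sum>i\<in>UNIV. dist_of (\<lambda>x. \<rho> 0 x * u 0 x $ i) (\<lambda>x. x $ i * cutoff r x))"
  have bound: "2 * J * T + a * M * T\<^sup>2 \<le> r\<^sup>2 * M \<and> M > 0" if T: "T > 0" for T
  proof -
    obtain R DR R' U DU U' where fl: "ns_flow T a \<mu> lam R DR R' U DU U'"
      and R0: "AE x in lborel. \<rho> 0 x = R 0 x" and U0: "AE x in lborel. u 0 x = U 0 x"
      using flow[OF T] by blast
    interpret ns_flow T a \<mu> lam R DR R' U DU U' by (rule fl)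
    have 0: "0 \<in> {0..T}" using T by simp
    note cR = C1_gradD(3)[OF R_C1[OF 0]]
    have R\<rho>0: "AE x in lborel. R 0 x = \<rho>0 x" using R0 \<rho>\<rho>0 by eventually_elim simp
    have "AE x in lborel. R 0 x \<ge> 0" using R\<rho>0 by eventually_elim (simp add: assms(6))
    then have nonneg: "R 0 x \<ge> 0" for x by (rule AE_nonneg_imp_nonneg[OF cR])
    have init: "R 0 x = 0" if "norm x \<ge> r" for x
    proof (rule AE_zero_outside_imp_zero_outside[OF cR, of r0])
      show "AE x in lborel. norm x > r0 \<longrightarrow> R 0 x = 0"
        using R\<rho>0
      proof eventually_elim
        case (elim x)
        then show ?case using r0[of x] by (cases "\<rho>0 x = 0") auto
      qed
      show "norm x > r0" using that by (simp add: r_def)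
    qed
    have M_eq: "M = (LINT x|lborel. R 0 x * cutoff r x)"
      unfolding M_def by (rule dist_of_eq_integral[OF m\<rho> cR R0 test_function_cutoff])
    have "dist_of (\<lambda>x. \<rho> 0 x * u 0 x $ i) (\<lambda>x. x $ i * cutoff r x)
      = (LINT x|lborel. R 0 x * U 0 x $ i * (x $ i * cutoff r x))" for i
    proof (rule dist_of_eq_integral[OF _ _ _ test_function_coord_cutoff])
      show "(\<lambda>x. \<rho> 0 x * u 0 x $ i) \<in> borel_measurable borel" by (intro borel_measurable_times m\<rho> mu)
      show "continuous_on UNIV (\<lambda>x. R 0 x * U 0 x $ i)"
        by (intro continuous_on_mult cR C1_gradD(3)[OF U_C1[OF 0]])
      show "AE x in lborel. \<rho> 0 x * u 0 x $ i = R 0 x * U 0 x $ i"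
        using R0 U0 by eventually_elim simp
    qed
    then have J_eq: "J = (\<Sum>i\<in>UNIV. LINT x|lborel. R 0 x * U 0 x $ i * (x $ i * cutoff r x))"
      by (simp add: J_def)
    have \<chi>_nn: "cutoff r x \<ge> 0" for x :: "real^'n" by (simp add: cutoff_def smooth_box_bounds)
    have "M \<noteq> 0"
    proof
      assume "M = 0"
      then have "AE x in lborel. R 0 x * cutoff r x = 0"
        unfolding M_eq
        using integral_nonneg_eq_0_iff_AE[OF integrable_continuous_times_test[OF cR test_function_cutoff]
            AE_I2[OF mult_nonneg_nonneg[OF nonneg \<chi>_nn]]] by blast
      then have "AE x in lborel. \<rho>0 x = 0"
        using R\<rho>0
      proof eventually_elim
        case (elim x)
        show ?case
        proof (cases "norm x < r")
          case True
          then show ?thesis using elim cutoff_eq_1[of x r] by simp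
        next
          case False
          then show ?thesis using elim init[of x] by simp
        qed
      qed
      then show False using assms(8) by blast
    qed
    moreover have "M \<ge> 0"
      unfolding M_eq by (intro integral_nonneg_AE AE_I2 mult_nonneg_nonneg nonneg \<chi>_nn)
    ultimately show ?thesis
      using virial_bound[OF assms(2) r init nonneg] unfolding M_eq[symmetric] J_eq[symmetric] by simp
  qed
  have M: "M > 0" using bound[OF zero_less_one] by blast
  \<comment> \<open>With this \<open>T \<ge> 1\<close>, \<open>a M T\<close> exceeds \<open>2 |J| + r\<^sup>2 M\<close>.\<close>
  define T where "T = (2 * \<bar>J\<bar> + r\<^sup>2 * M) / (a * M) + 1"
  have aM: "a * M > 0" using assms(2) M by simp
  have T1: "T \<ge> 1" using aM M by (simp add: T_def)
  have "a * M * T = 2 * \<bar>J\<bar> + r\<^sup>2 * M + a * M" using assms(2) M by (simp add: T_def field_simps)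
  then have "a * M * T\<^sup>2 = (2 * \<bar>J\<bar> + r\<^sup>2 * M + a * M) * T" by (simp add: power2_eq_square flip: mult.assoc)
  then have "2 * J * T + a * M * T\<^sup>2 = 2 * (J + \<bar>J\<bar>) * T + r\<^sup>2 * M * T + a * M * T"
    by (simp add: algebra_simps)
  moreover have "2 * (J + \<bar>J\<bar>) * T \<ge> 0" using T1 by (intro mult_nonneg_nonneg) auto
  moreover have "r\<^sup>2 * M * 1 \<le> r\<^sup>2 * M * T" using T1 M by (intro mult_left_mono) auto
  moreover have "a * M * T > 0" using aM T1 by simp
  moreover have "2 * J * T + a * M * T\<^sup>2 \<le> r\<^sup>2 * M" using bound[of T] T1 by simp
  ultimately show False by linarith
qed

end
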